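(* Fix $\alpha$ with $0<\alpha<0.2$ and consider first passage percolation with law $\nu_\alpha$. Let $\rho:\mathbb R^2\to\mathbb R$ be a linear functional tangent to the $\ell_1$ unit ball. Then, almost surely, there is exactly one geodesic ray $\gamma$ starting at the origin with $\mathrm{Dir}(\gamma)=D_\rho$.
   Context: Model. $\mathbb Z^2$ is the nearest-neighbour square lattice, with edge set $\mathcal E$; $\mathsf e_1,\mathsf e_2$ are the canonical basis vectors. Fix $0<\alpha<0.2$. Let $\mathbb N=\{0,1,2,\dots\}$ and $\Omega=\{0,1,2,3,4\}^{\mathbb N}$ with the uniform (product) probability measure. Let $\sigma:\Omega\to\Omega$ be the 5-adic adding machine: add one (mod 5) to the first coordinate; as long as the result is $0$, carry and add one (mod 5) to the next coordinate; all later coordinates are unchanged; $\sigma(444\dots)=000\dots$. The map $\sigma$ is a bijection. Put $L(\omega)=\min\{i:\omega(i)>0\}$ (defined off a null set). Let $\omega_1,\omega_2$ be independent and uniform on $\Omega$. For a vertex $v=(x,y)$ set $k(v,v+\mathsf e_1)=L(\sigma^{y}(\omega_1))$ and $k(v,v+\mathsf e_2)=L(\sigma^{x}(\omega_2))$. Let $\{X_{j,e}\}_{j\in\mathbb N,e\in\mathcal E}$ be independent, independent of $(\omega_1,\omega_2)$, with $X_{j,e}$ uniform on $[0,\alpha^j(1-\alpha)/1000]$. The passage time of the edge $e$ is $t_e=1+\alpha^{k(e)}+X_{k(e),e}$, and $\nu_\alpha$ is the law of $(t_e)_{e\in\mathcal E}$. The length of a finite path is $\Gamma(\pi)=\sum_{e\in\pi}t_e$,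 and $T(u,v)=\inf\Gamma(\pi)$ over paths $\pi$ from $u$ to $v$. A geodesic between $u$ and $v$ is a path attaining this infimum (almost surely it exists and is unique). A geodesic ray is an infinite path every finite sub-path of which is a geodesic between its endpoints. Two geodesic rays are considered distinct if they intersect in only finitely many edges. The direction $\mathrm{Dir}(\Pi)\subset S^1$ of a sequence of points $\Pi=\{v_k\}_{k\ge0}$ is the set of limit points of the normalized vectors $v_k/\|v_k\|_2$. A linear functional $\rho$ is tangent to a convex set $\mathbf B$ if the line $\{x:\rho(x)=1\}$ is tangent to $\mathbf B$ at a point of differentiability of the boundary of $\mathbf B$. The limiting shape of this model (the unit ball of the norm $\|x\|=\lim_n T(0,nx)/n$, where $T$ is extended to $\mathbb R^2$ by coordinatewise floor) is the $\ell_1$ unit ball, and $D_\rho=\{x\in S^1:\rho(x)=\|x\|\}=\{x\in S^1:\rho(x)=|x|_1\}$. *)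

theory Defs
  imports "HOL-Probability.Probability" "HOL-Library.Numeral_Type"
begin

section \<open>The adding machine\<close>

text \<open>The digits $0,\dots,4$ are the elements of the type \<open>5\<close> of residues modulo 5, so that
  \<open>+\<close> on digits is addition modulo 5.\<close>

type_synonym digits = "nat \<Rightarrow> 5"

definition digits_measure :: "digits measure" where
  "digits_measure = PiM UNIV (\<lambda>_. uniform_count_measure UNIV)"

text \<open>Coordinate \<open>i\<close> receives a carry iff adding one gave \<open>0\<close> in all earlier coordinates.\<close>

definition adding_machine :: "digits \<Rightarrow> digits" where
  "adding_machine \<omega> = (\<lambda>i. if \<forall>j<i. \<omega> j + 1 = 0 then \<omega> i + 1 else \<omega> i)"

definition adding_machine_inv :: "digits \<Rightarrow> digits" where
  "adding_machine_inv \<omega> = (\<lambda>i. if \<forall>j<i. \<omega> j = 0 then \<omega> i - 1 else \<omega> i)"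

lemma adding_machine_inv_left: "adding_machine_inv (adding_machine \<omega>) = \<omega>"
proof
  fix i
  have "(\<forall>j<i. adding_machine \<omega> j = 0) \<longleftrightarrow> (\<forall>j<i. \<omega> j + 1 = 0)"
  proof (induction i)
    case (Suc i)
    have "adding_machine \<omega> i = 0 \<longleftrightarrow> \<omega> i + 1 = 0" if "\<forall>j<i. \<omega> j + 1 = 0"
      unfolding adding_machine_def if_P[OF that] by (rule refl)
    with Suc show ?case
      unfolding All_less_Suc by meson
  qed simp
  then show "adding_machine_inv (adding_machine \<omega>) i = \<omega> i"
    unfolding adding_machine_inv_def by (simp add: adding_machine_def)
qed

lemma adding_machine_inv_right: "adding_machine (adding_machine_inv \<omega>) = \<omega>"
proof
  fix i
  have "(\<forall>j<i. adding_machine_inv \<omega> j + 1 = 0) \<longleftrightarrow> (\<forall>j<i. \<omega> j = 0)"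
  proof (induction i)
    case (Suc i)
    have "adding_machine_inv \<omega> i + 1 = 0 \<longleftrightarrow> \<omega> i = 0" if "\<forall>j<i. \<omega> j = 0"
      unfolding adding_machine_inv_def if_P[OF that] diff_add_cancel by (rule refl)
    with Suc show ?case
      unfolding All_less_Suc by meson
  qed simp
  then show "adding_machine (adding_machine_inv \<omega>) i = \<omega> i"
    unfolding adding_machine_def by (simp add: adding_machine_inv_def)
qed

lemma bij_adding_machine: "bij adding_machine"
  by (rule o_bij[of adding_machine_inv])
     (auto simp: fun_eq_iff adding_machine_inv_left adding_machine_inv_right)

lemma inv_adding_machine: "inv adding_machine = adding_machine_inv"
  by (rule inv_equality) (simp_all add: adding_machine_inv_left adding_machine_inv_right)

definition adding_machine_power :: "int \<Rightarrow> digits \<Rightarrow> digits" where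
  "adding_machine_power z =
     (if 0 \<le> z then adding_machine ^^ nat z else inv adding_machine ^^ nat (- z))"

text \<open>Unspecified on the zero sequence, which has measure zero.\<close>

definition first_nonzero :: "digits \<Rightarrow> nat" where
  "first_nonzero \<omega> = (LEAST i. \<omega> i \<noteq> 0)"

section \<open>Edges of the square lattice\<close>

type_synonym vertex = "int \<times> int"

text \<open>An undirected edge is named by its left, respectively lower, endpoint.\<close>

datatype edge = Hor vertex | Ver vertex

fun edge_ends :: "edge \<Rightarrow> vertex set" where
  "edge_ends (Hor v) = {v, v + (1, 0)}"
| "edge_ends (Ver v) = {v, v + (0, 1)}"

lemma edge_ends_inject: "edge_ends e = edge_ends e' \<longleftrightarrow> e = e'"
  by (cases e; cases e') (auto simp: doubleton_eq_iff prod_eq_iff)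

definition adjacent :: "vertex \<Rightarrow> vertex \<Rightarrow> bool" where
  "adjacent u v \<longleftrightarrow> (\<exists>e. edge_ends e = {u, v})"

definition edge_between :: "vertex \<Rightarrow> vertex \<Rightarrow> edge" where
  "edge_between u v = (THE e. edge_ends e = {u, v})"

section \<open>The law of the passage times\<close>

fun edge_class :: "digits \<Rightarrow> digits \<Rightarrow> edge \<Rightarrow> nat" where
  "edge_class \<omega>\<^sub>1 \<omega>\<^sub>2 (Hor (x, y)) = first_nonzero (adding_machine_power y \<omega>\<^sub>1)"
| "edge_class \<omega>\<^sub>1 \<omega>\<^sub>2 (Ver (x, y)) = first_nonzero (adding_machine_power x \<omega>\<^sub>2)"

definition noise_measure :: "real \<Rightarrow> (nat \<times> edge \<Rightarrow> real) measure" where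
  "noise_measure \<alpha> =
     PiM UNIV (\<lambda>(j, e). uniform_measure lborel {0..\<alpha> ^ j * (1 - \<alpha>) / 1000})"

definition passage_times ::
  "real \<Rightarrow> (digits \<times> digits) \<times> (nat \<times> edge \<Rightarrow> real) \<Rightarrow> edge \<Rightarrow> real" where
  "passage_times \<alpha> = (\<lambda>((\<omega>\<^sub>1, \<omega>\<^sub>2), X) e.
     1 + \<alpha> ^ edge_class \<omega>\<^sub>1 \<omega>\<^sub>2 e + X (edge_class \<omega>\<^sub>1 \<omega>\<^sub>2 e, e))"

definition fpp_law :: "real \<Rightarrow> (edge \<Rightarrow> real) measure" where
  "fpp_law \<alpha> = distr ((digits_measure \<Otimes>\<^sub>M digits_measure) \<Otimes>\<^sub>M noise_measure \<alpha>)
     (PiM UNIV (\<lambda>_. borel)) (passage_times \<alpha>)"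

text \<open>Since \<open>distr\<close> is only meaningful for measurable maps, we check that \<open>passage_times\<close> is
  measurable and hence that \<open>fpp_law\<close> is a probability measure.\<close>

lemma space_digits_measure [simp]: "space digits_measure = UNIV"
  by (simp add: digits_measure_def space_PiM PiE_def space_uniform_count_measure)

lemma measurable_digit [measurable]:
  "(\<lambda>\<omega>. \<omega> i) \<in> digits_measure \<rightarrow>\<^sub>M count_space UNIV"
proof -
  have "(\<lambda>\<omega>. \<omega> i) \<in> digits_measure \<rightarrow>\<^sub>M uniform_count_measure (UNIV :: 5 set)"
    unfolding digits_measure_def by (rule measurable_component_singleton) simp
  also have "digits_measure \<rightarrow>\<^sub>M uniform_count_measure (UNIV :: 5 set) =
      digits_measure \<rightarrow>\<^sub>M count_space UNIV"
    by (intro measurable_cong_sets refl sets_uniform_count_measure_count_space)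
  finally show ?thesis .
qed

lemma measurable_digits_measureI:
  assumes "\<And>i. (\<lambda>x. f x i) \<in> M \<rightarrow>\<^sub>M count_space UNIV"
  shows "f \<in> M \<rightarrow>\<^sub>M digits_measure"
  unfolding digits_measure_def
  by (rule measurable_PiM_single')
     (use assms in \<open>auto simp: space_uniform_count_measure
        sets_uniform_count_measure_count_space cong: measurable_cong_sets\<close>)

lemma measurable_adding_machine [measurable]:
  "adding_machine \<in> digits_measure \<rightarrow>\<^sub>M digits_measure"
  by (rule measurable_digits_measureI) (unfold adding_machine_def, measurable)

lemma measurable_inv_adding_machine [measurable]:
  "inv adding_machine \<in> digits_measure \<rightarrow>\<^sub>M digits_measure"
  unfolding inv_adding_machine
  by (rule measurable_digits_measureI) (unfold adding_machine_inv_def, measurable)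

lemma measurable_adding_machine_power [measurable]:
  "adding_machine_power z \<in> digits_measure \<rightarrow>\<^sub>M digits_measure"
  by (auto simp: adding_machine_power_def)

lemma measurable_first_nonzero [measurable]:
  "first_nonzero \<in> digits_measure \<rightarrow>\<^sub>M count_space UNIV"
  unfolding first_nonzero_def by measurable

lemma measurable_edge_class [measurable]:
  "(\<lambda>(\<omega>\<^sub>1, \<omega>\<^sub>2). edge_class \<omega>\<^sub>1 \<omega>\<^sub>2 e)
     \<in> digits_measure \<Otimes>\<^sub>M digits_measure \<rightarrow>\<^sub>M count_space UNIV"
proof (cases e)
  case (Hor v)
  then show ?thesis
    by (cases v) (auto simp: case_prod_unfold intro!: measurable_compose[OF measurable_fst]
        measurable_compose[OF measurable_adding_machine_power measurable_first_nonzero])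
next
  case (Ver v)
  then show ?thesis
    by (cases v) (auto simp: case_prod_unfold intro!: measurable_compose[OF measurable_snd]
        measurable_compose[OF measurable_adding_machine_power measurable_first_nonzero])
qed

lemma measurable_noise [measurable]:
  "(\<lambda>X. X i) \<in> borel_measurable (noise_measure \<alpha>)"
proof -
  have "(\<lambda>X. X i) \<in> noise_measure \<alpha> \<rightarrow>\<^sub>M
      (case i of (j, e) \<Rightarrow> uniform_measure lborel {0..\<alpha> ^ j * (1 - \<alpha>) / 1000})"
    unfolding noise_measure_def by (rule measurable_component_singleton) simp
  then show ?thesis
    by (simp add: case_prod_unfold cong: measurable_cong_sets)
qed

lemma measurable_passage_times [measurable]:
  "passage_times \<alpha> \<in> (digits_measure \<Otimes>\<^sub>M digits_measure) \<Otimes>\<^sub>M noise_measure \<alpha>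
     \<rightarrow>\<^sub>M PiM UNIV (\<lambda>_. borel)"
proof (rule measurable_PiM_single')
  fix e
  let ?M = "(digits_measure \<Otimes>\<^sub>M digits_measure) \<Otimes>\<^sub>M noise_measure \<alpha>"
  let ?k = "\<lambda>p. (\<lambda>(\<omega>\<^sub>1, \<omega>\<^sub>2). edge_class \<omega>\<^sub>1 \<omega>\<^sub>2 e) (fst p)"
  have k: "?k \<in> ?M \<rightarrow>\<^sub>M count_space UNIV"
    by (rule measurable_compose[OF measurable_fst measurable_edge_class])
  have t: "(\<lambda>p. 1 + \<alpha> ^ k + snd p (k, e)) \<in> borel_measurable ?M" for k
    by (intro borel_measurable_add borel_measurable_const
        measurable_compose[OF measurable_snd measurable_noise])
  have "(\<lambda>p. 1 + \<alpha> ^ ?k p + snd p (?k p, e)) \<in> borel_measurable ?M"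
    by (rule measurable_compose_countable[where g = ?k, OF t k])
  then show "(\<lambda>p. passage_times \<alpha> p e)
      \<in> borel_measurable ((digits_measure \<Otimes>\<^sub>M digits_measure) \<Otimes>\<^sub>M noise_measure \<alpha>)"
    by (simp add: passage_times_def case_prod_unfold)
qed auto

lemma prob_space_digits_measure: "prob_space digits_measure"
  unfolding digits_measure_def
  by (intro prob_space_PiM prob_space_uniform_count_measure) auto

lemma prob_space_noise_measure:
  assumes "0 < \<alpha>" "\<alpha> < 1"
  shows "prob_space (noise_measure \<alpha>)"
  unfolding noise_measure_def
  using assms by (intro prob_space_PiM) (auto intro!: prob_space_uniform_measure)

lemma prob_space_fpp_law:
  assumes "0 < \<alpha>" "\<alpha> < 1"
  shows "prob_space (fpp_law \<alpha>)"
  unfolding fpp_law_def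
  using assms
  by (intro prob_space.prob_space_distr measurable_passage_times prob_space_pair
      prob_space_digits_measure prob_space_noise_measure)

section \<open>Geodesic rays\<close>

definition paths :: "vertex \<Rightarrow> vertex \<Rightarrow> vertex list set" where
  "paths u v = {\<pi>. \<pi> \<noteq> [] \<and> hd \<pi> = u \<and> last \<pi> = v \<and> successively adjacent \<pi>}"

definition path_time :: "(edge \<Rightarrow> real) \<Rightarrow> vertex list \<Rightarrow> real" where
  "path_time t \<pi> = (\<Sum>i<length \<pi> - 1. t (edge_between (\<pi> ! i) (\<pi> ! Suc i)))"

definition passage_time :: "(edge \<Rightarrow> real) \<Rightarrow> vertex \<Rightarrow> vertex \<Rightarrow> real" where
  "passage_time t u v = (INF \<pi>\<in>paths u v. path_time t \<pi>)"

definition is_geodesic :: "(edge \<Rightarrow> real) \<Rightarrow> vertex \<Rightarrow> vertex \<Rightarrow> vertex list \<Rightarrow> bool" where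
  "is_geodesic t u v \<pi> \<longleftrightarrow> \<pi> \<in> paths u v \<and> path_time t \<pi> = passage_time t u v"

definition geodesic_ray :: "(edge \<Rightarrow> real) \<Rightarrow> (nat \<Rightarrow> vertex) \<Rightarrow> bool" where
  "geodesic_ray t \<gamma> \<longleftrightarrow>
     (\<forall>n. adjacent (\<gamma> n) (\<gamma> (Suc n))) \<and>
     (\<forall>m n. m \<le> n \<longrightarrow> is_geodesic t (\<gamma> m) (\<gamma> n) (map \<gamma> [m..<Suc n]))"

definition ray_edges :: "(nat \<Rightarrow> vertex) \<Rightarrow> edge set" where
  "ray_edges \<gamma> = range (\<lambda>n. edge_between (\<gamma> n) (\<gamma> (Suc n)))"

definition distinct_rays :: "(nat \<Rightarrow> vertex) \<Rightarrow> (nat \<Rightarrow> vertex) \<Rightarrow> bool" where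
  "distinct_rays \<gamma> \<gamma>' \<longleftrightarrow> finite (ray_edges \<gamma> \<inter> ray_edges \<gamma>')"

section \<open>Directions and tangent functionals\<close>

definition vertex_point :: "vertex \<Rightarrow> real \<times> real" where
  "vertex_point = (\<lambda>(x, y). (of_int x, of_int y))"

text \<open>\<open>sgn v\<close> is the normalized vector, with \<open>sgn 0 = 0\<close>; intersecting with the unit circle
  discards visits to the origin.\<close>

definition Dir :: "(nat \<Rightarrow> vertex) \<Rightarrow> (real \<times> real) set" where
  "Dir vs = {x \<in> sphere 0 1.
     \<exists>r. strict_mono r \<and> (\<lambda>k. sgn (vertex_point (vs (r k)))) \<longlonglongrightarrow> x}"

definition l1_norm :: "real \<times> real \<Rightarrow> real" where
  "l1_norm x = \<bar>fst x\<bar> + \<bar>snd x\<bar>"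

definition l1_ball :: "(real \<times> real) set" where
  "l1_ball = {x. l1_norm x \<le> 1}"

definition tangent_directions :: "(real \<times> real \<Rightarrow> real) \<Rightarrow> (real \<times> real) set" where
  "tangent_directions \<rho> = {x \<in> sphere 0 1. \<rho> x = l1_norm x}"

text \<open>In suitable orthonormal coordinates centred at \<open>p\<close>, the boundary of \<open>B\<close> is near \<open>p\<close> the
  graph of a function \<open>g\<close> that is differentiable at \<open>0\<close>, and \<open>l\<close> is the tangent line to that
  graph at \<open>p\<close>.\<close>

definition is_boundary_tangent ::
  "(real \<times> real) set \<Rightarrow> real \<times> real \<Rightarrow> (real \<times> real) set \<Rightarrow> bool" where
  "is_boundary_tangent B p l \<longleftrightarrow> p \<in> frontier B \<and>
     (\<exists>u v g g' U. norm u = 1 \<and> norm v = 1 \<and> u \<bullet> v = 0 \<and>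
        open U \<and> p \<in> U \<and>
        frontier B \<inter> U = range (\<lambda>s. p + s *\<^sub>R u + g s *\<^sub>R v) \<inter> U \<and>
        g 0 = 0 \<and> (g has_real_derivative g') (at 0) \<and>
        l = range (\<lambda>s. p + s *\<^sub>R (u + g' *\<^sub>R v)))"

definition tangent_functional :: "(real \<times> real \<Rightarrow> real) \<Rightarrow> (real \<times> real) set \<Rightarrow> bool" where
  "tangent_functional \<rho> B \<longleftrightarrow> (\<exists>p. is_boundary_tangent B p {x. \<rho> x = 1})"

end

theory Submission
  imports Defs "HOL-Library.Diagonal_Subsequence"
begin

text \<open>Call a row or column fast if its class is high. Lines of class at least \<open>n\<close> have spacing
  \<open>5\<^sup>n\<close> and travelling along them costs at most \<open>1 + 1.001 \<alpha>\<^sup>n\<close> per step. Since \<open>5\<alpha> < 1\<close>,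
  climbing from line to faster line shows that a geodesic from the origin to a far vertex near the
  diagonal costs only a bounded amount more than the \<open>\<ell>\<^sub>1\<close> distance, so it hardly moves backwards.
  For infinitely many scales \<open>j\<close> the digits provide a row \<open>Y \<le> 5\<^sup>j\<close> that is by far the fastest
  one nearby, while the first equally fast column \<open>A\<close> is of order \<open>5\<^sup>j\<^sup>+\<^sup>m\<close>. An exchange argument
  then forces every such geodesic through the edge of row \<open>Y\<close> that leads to \<open>A\<close>. These edges are
  common to all geodesic rays that visit the diagonal infinitely often, which gives uniqueness. A
  limit of geodesics to the diagonal passes through all of them and, exchanging the roles of rows and
  columns and letting \<open>m\<close> grow, comes arbitrarily close to both axes, so its directions fill the
  quadrant.\<close>

section \<open>Walks\<close>

text \<open>Randomness enters only through the digits and the size of the noise: almost every sample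
  becomes a \<open>good_environment\<close> under each of the four reflections, and all geometry
  there is deterministic. A functional tangent to the diamond touches it inside a side, so its
  directions form a closed quarter circle, and reflections reduce the claim to the first quadrant.
  The obstacle is that a bounded excess over the distance is known only for endpoints in a cone
  around the diagonal. Edges are therefore forced only on geodesics ending in that cone, and it is
  the assumption that the direction set is the whole arc that brings an arbitrary ray back into the
  cone. As rays are distinct only if they share finitely many edges, an unbounded family of forced
  edges already gives uniqueness. Two parameters separate two demands: large \<open>j\<close> makes
  the excess at most \<open>5 ^ j\<close>, while large \<open>m\<close> makes the slope of the
  forced vertex, at most \<open>1 / 5 ^ m\<close>, small.\<close>

inductive walk :: "(edge \<Rightarrow> real) \<Rightarrow> nat \<Rightarrow> vertex \<Rightarrow> vertex \<Rightarrow> real \<Rightarrow> bool" for t where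
  walk_refl: "walk t 0 u u 0"
| walk_step: "adjacent u v \<Longrightarrow> walk t n v z c \<Longrightarrow> walk t (Suc n) u z (t (edge_between u v) + c)"

text \<open>The step count of \<open>walk\<close> serves arguments that bound or index the length;
  cost estimates forget it.\<close>

definition reach :: "(edge \<Rightarrow> real) \<Rightarrow> vertex \<Rightarrow> vertex \<Rightarrow> real \<Rightarrow> bool" where
  "reach t u v c \<longleftrightarrow> (\<exists>n. walk t n u v c)"

definition seg_time :: "(edge \<Rightarrow> real) \<Rightarrow> (nat \<Rightarrow> vertex) \<Rightarrow> nat \<Rightarrow> nat \<Rightarrow> real" where
  "seg_time t \<gamma> m n = (\<Sum>i=m..<n. t (edge_between (\<gamma> i) (\<gamma> (Suc i))))"

text \<open>Optimality is required of every stretch and phrased as a comparison with all walk costs,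
  so no infimum appears. A function on all of \<open>nat\<close>, whose values after
  \<open>n\<close> are irrelevant, makes restrictions and limits of geodesics immediate;
  \<open>geodesic_ray_iff\<close> links this to the original notion.\<close>

definition geodesic_upto :: "(edge \<Rightarrow> real) \<Rightarrow> (nat \<Rightarrow> vertex) \<Rightarrow> nat \<Rightarrow> bool" where
  "geodesic_upto t \<gamma> n \<longleftrightarrow> (\<forall>i<n. adjacent (\<gamma> i) (\<gamma> (Suc i))) \<and>
     (\<forall>s s' c. s \<le> s' \<and> s' \<le> n \<and> reach t (\<gamma> s) (\<gamma> s') c \<longrightarrow> seg_time t \<gamma> s s' \<le> c)"

lemma edge_between_eqI: "edge_ends e = {u, v} \<Longrightarrow> edge_between u v = e"
  unfolding edge_between_def by (rule the_equality) (auto simp: edge_ends_inject[symmetric])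

lemma edge_between_ends: "adjacent u v \<Longrightarrow> edge_ends (edge_between u v) = {u, v}"
  unfolding adjacent_def using edge_between_eqI by blast

lemma adjacent_sym: "adjacent u v \<longleftrightarrow> adjacent v u"
  by (simp add: adjacent_def insert_commute)

lemma edge_between_sym: "edge_between u v = edge_between v u"
  by (simp add: edge_between_def insert_commute)

lemma adjacent_right [simp]: "adjacent (x, y) (x + 1, y)"
  and adjacent_up [simp]: "adjacent (x, y) (x, y + 1)"
  and edge_between_right [simp]: "edge_between (x, y) (x + 1, y) = Hor (x, y)"
  and edge_between_up [simp]: "edge_between (x, y) (x, y + 1) = Ver (x, y)"
proof -
  have "edge_ends (Hor (x, y)) = {(x, y), (x + 1, y)}" "edge_ends (Ver (x, y)) = {(x, y), (x, y + 1)}"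
    by auto
  then show "adjacent (x, y) (x + 1, y)" "adjacent (x, y) (x, y + 1)"
    "edge_between (x, y) (x + 1, y) = Hor (x, y)" "edge_between (x, y) (x, y + 1) = Ver (x, y)"
    by (auto simp: adjacent_def intro!: edge_between_eqI simp del: edge_ends.simps)
qed

lemma adjacentE:
  assumes "adjacent u v"
  obtains (right) x y where "u = (x, y)" "v = (x + 1, y)"
  | (left) x y where "u = (x + 1, y)" "v = (x, y)"
  | (up) x y where "u = (x, y)" "v = (x, y + 1)"
  | (down) x y where "u = (x, y + 1)" "v = (x, y)"
proof -
  obtain e where e: "edge_ends e = {u, v}" using assms by (auto simp: adjacent_def)
  show ?thesis
  proof (cases e)
    case (Hor w)
    then show ?thesis using e right left by (cases w) (auto simp: doubleton_eq_iff)
  next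
    case (Ver w)
    then show ?thesis using e up down by (cases w) (auto simp: doubleton_eq_iff)
  qed
qed

lemma walk_trans: "walk t m u v c \<Longrightarrow> walk t n v z d \<Longrightarrow> walk t (m + n) u z (c + d)"
  by (induction rule: walk.induct) (auto intro: walk.intros simp: add.assoc)

lemma walk_single: "adjacent u v \<Longrightarrow> walk t (Suc 0) u v (t (edge_between u v))"
  using walk_step[OF _ walk_refl] by fastforce

lemma walk_rev: "walk t n u v c \<Longrightarrow> walk t n v u c"
proof (induction rule: walk.induct)
  case (walk_step u v n z c)
  then have "adjacent v u" by (simp add: adjacent_sym)
  from walk_trans[OF walk_step.IH walk_single[OF this]]
  show ?case
    unfolding edge_between_sym[of u v] add.commute[of "t (edge_between v u)" c] by simp
qed (rule walk_refl)

lemma reach_refl: "reach t u u 0"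
  using walk_refl reach_def by blast

lemma reach_trans: "reach t u v c \<Longrightarrow> reach t v z d \<Longrightarrow> reach t u z (c + d)"
  unfolding reach_def using walk_trans by blast

lemma reach_rev: "reach t u v c \<Longrightarrow> reach t v u c"
  unfolding reach_def using walk_rev by blast

lemma reach_single: "adjacent u v \<Longrightarrow> reach t u v (t (edge_between u v))"
  unfolding reach_def using walk_single by blast

lemma seg_time_split: "m \<le> k \<Longrightarrow> k \<le> n \<Longrightarrow> seg_time t \<gamma> m n = seg_time t \<gamma> m k + seg_time t \<gamma> k n"
  unfolding seg_time_def by (simp add: sum.atLeastLessThan_concat)

lemma reach_seg:
  assumes "s \<le> s'" "\<And>i. s \<le> i \<Longrightarrow> i < s' \<Longrightarrow> adjacent (\<gamma> i) (\<gamma> (Suc i))"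
  shows "reach t (\<gamma> s) (\<gamma> s') (seg_time t \<gamma> s s')"
  using assms
proof (induction s' rule: dec_induct)
  case (step n)
  then have "reach t (\<gamma> s) (\<gamma> (Suc n)) (seg_time t \<gamma> s n + t (edge_between (\<gamma> n) (\<gamma> (Suc n))))"
    by (intro reach_trans[of _ _ "\<gamma> n"] reach_single) auto
  then show ?case using step by (simp add: seg_time_def)
qed (simp add: seg_time_def reach_refl)

lemma walk_function:
  assumes "walk t n u v c"
  shows "\<exists>\<gamma>. \<gamma> 0 = u \<and> \<gamma> n = v \<and> (\<forall>i<n. adjacent (\<gamma> i) (\<gamma> (Suc i))) \<and> seg_time t \<gamma> 0 n = c"
  using assms
proof (induction rule: walk.induct)
  case (walk_refl u)
  show ?case by (rule exI[of _ "\<lambda>_. u"]) (simp add: seg_time_def)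
next
  case (walk_step u v n z c)
  then obtain \<gamma> where g: "\<gamma> 0 = v" "\<gamma> n = z" "\<forall>i<n. adjacent (\<gamma> i) (\<gamma> (Suc i))" "seg_time t \<gamma> 0 n = c"
    by blast
  let ?d = "case_nat u \<gamma>"
  have "seg_time t ?d 0 (Suc n) = t (edge_between u v) + seg_time t \<gamma> 0 n"
    unfolding seg_time_def by (subst sum.atLeast0_lessThan_Suc_shift) (simp add: g)
  moreover have "\<forall>i<Suc n. adjacent (?d i) (?d (Suc i))"
    using g walk_step.hyps by (auto split: nat.split)
  ultimately show ?case using g by (intro exI[of _ ?d]) auto
qed

section \<open>Translation between vertex lists and walks\<close>

lemma path_time_map: "path_time t (map \<gamma> [m..<Suc n]) = seg_time t \<gamma> m n" if "m \<le> n"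
proof -
  have "path_time t (map \<gamma> [m..<Suc n]) =
      (\<Sum>i<n - m. t (edge_between (map \<gamma> [m..<Suc n] ! i) (map \<gamma> [m..<Suc n] ! Suc i)))"
    using that by (simp add: path_time_def Suc_diff_le del: upt_Suc)
  also have "\<dots> = (\<Sum>i<n - m. t (edge_between (\<gamma> (i + m)) (\<gamma> (Suc (i + m)))))"
    by (rule sum.cong) (auto simp: add.commute simp del: upt_Suc)
  also have "\<dots> = seg_time t \<gamma> m n"
    unfolding seg_time_def
    using that sum.shift_bounds_nat_ivl[of "\<lambda>i. t (edge_between (\<gamma> i) (\<gamma> (Suc i)))" 0 m "n - m"]
    by (simp add: atLeast0LessThan)
  finally show ?thesis .
qed

lemma map_in_paths_iff:
  assumes "m \<le> n"
  shows "map \<gamma> [m..<Suc n] \<in> paths (\<gamma> m) (\<gamma> n) \<longleftrightarrow> (\<forall>i. m \<le> i \<and> i < n \<longrightarrow> adjacent (\<gamma> i) (\<gamma> (Suc i)))"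
proof -
  have "successively adjacent (map \<gamma> [m..<Suc n]) \<longleftrightarrow> (\<forall>i<n - m. adjacent (\<gamma> (m + i)) (\<gamma> (Suc (m + i))))"
    using assms by (auto simp: successively_conv_nth Suc_diff_le simp del: upt_Suc)
  also have "\<dots> \<longleftrightarrow> (\<forall>i. m \<le> i \<and> i < n \<longrightarrow> adjacent (\<gamma> i) (\<gamma> (Suc i)))"
  proof (intro iffI allI impI)
    fix i assume *: "\<forall>i<n - m. adjacent (\<gamma> (m + i)) (\<gamma> (Suc (m + i)))" and i: "m \<le> i \<and> i < n"
    then show "adjacent (\<gamma> i) (\<gamma> (Suc i))" using *[rule_format, of "i - m"] by auto
  qed auto
  finally show ?thesis using assms
    by (auto simp: paths_def hd_map last_map simp del: upt_Suc)
qed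

lemma reach_iff_path: "reach t u v c \<longleftrightarrow> (\<exists>\<pi>\<in>paths u v. path_time t \<pi> = c)"
proof
  assume "reach t u v c"
  then obtain n where "walk t n u v c" unfolding reach_def ..
  from walk_function[OF this] obtain \<gamma> where g: "\<gamma> 0 = u" "\<gamma> n = v"
      "\<forall>i<n. adjacent (\<gamma> i) (\<gamma> (Suc i))" "seg_time t \<gamma> 0 n = c"
    by blast
  have "map \<gamma> [0..<Suc n] \<in> paths u v"
    using map_in_paths_iff[of 0 n \<gamma>] g by (simp del: upt_Suc)
  moreover have "path_time t (map \<gamma> [0..<Suc n]) = c"
    using path_time_map[of 0 n t \<gamma>] g by (simp del: upt_Suc)
  ultimately show "\<exists>\<pi>\<in>paths u v. path_time t \<pi> = c" by blast
next
  assume "\<exists>\<pi>\<in>paths u v. path_time t \<pi> = c"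
  then obtain \<pi> where p: "\<pi> \<in> paths u v" "path_time t \<pi> = c" by blast
  define n where "n = length \<pi> - 1"
  have l: "\<pi> \<noteq> []" "hd \<pi> = u" "last \<pi> = v" "successively adjacent \<pi>" using p by (auto simp: paths_def)
  have "reach t (\<pi> ! 0) (\<pi> ! n) (seg_time t ((!) \<pi>) 0 n)"
    by (rule reach_seg) (use l in \<open>auto simp: successively_conv_nth n_def\<close>)
  moreover have "seg_time t ((!) \<pi>) 0 n = c"
    using p by (auto simp: seg_time_def path_time_def n_def atLeast0LessThan)
  ultimately show "reach t u v c"
    using l by (simp add: hd_conv_nth last_conv_nth n_def)
qed

text \<open>Nonnegative times bound the path times from below, which is what places the real infimum
  in \<open>passage_time\<close> below each of them.\<close>

lemma is_geodesic_iff: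
  assumes "\<And>e. 0 \<le> t e"
  shows "is_geodesic t u v \<pi> \<longleftrightarrow> \<pi> \<in> paths u v \<and> (\<forall>c. reach t u v c \<longrightarrow> path_time t \<pi> \<le> c)"
proof -
  have bdd: "bdd_below (path_time t ` paths u v)"
    by (rule bdd_belowI[of _ 0]) (auto simp: path_time_def intro!: sum_nonneg assms)
  show ?thesis
  proof (cases "\<pi> \<in> paths u v")
    case True
    have "path_time t \<pi> = passage_time t u v \<longleftrightarrow> (\<forall>\<pi>'\<in>paths u v. path_time t \<pi> \<le> path_time t \<pi>')"
    proof
      assume "path_time t \<pi> = passage_time t u v"
      then show "\<forall>\<pi>'\<in>paths u v. path_time t \<pi> \<le> path_time t \<pi>'"
        unfolding passage_time_def using bdd by (auto intro: cINF_lower)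
    next
      assume *: "\<forall>\<pi>'\<in>paths u v. path_time t \<pi> \<le> path_time t \<pi>'"
      show "path_time t \<pi> = passage_time t u v"
        unfolding passage_time_def
        by (rule antisym[OF cINF_greatest cINF_lower[OF bdd True]]) (use True * in auto)
    qed
    then show ?thesis using True by (auto simp: is_geodesic_def reach_iff_path)
  qed (simp add: is_geodesic_def)
qed

lemma geodesic_ray_iff:
  assumes "\<And>e. 0 \<le> t e"
  shows "geodesic_ray t \<gamma> \<longleftrightarrow> (\<forall>n. geodesic_upto t \<gamma> n)"
proof
  assume "geodesic_ray t \<gamma>"
  then show "\<forall>n. geodesic_upto t \<gamma> n"
    unfolding geodesic_ray_def geodesic_upto_def is_geodesic_iff[OF assms]
    by (metis path_time_map)
next
  assume *: "\<forall>n. geodesic_upto t \<gamma> n"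
  have a: "adjacent (\<gamma> n) (\<gamma> (Suc n))" for n
    using * unfolding geodesic_upto_def by (meson lessI)
  show "geodesic_ray t \<gamma>"
    unfolding geodesic_ray_def is_geodesic_iff[OF assms]
  proof (intro conjI allI impI)
    fix m n :: nat and c assume "m \<le> n"
    then show "map \<gamma> [m..<Suc n] \<in> paths (\<gamma> m) (\<gamma> n)"
      by (subst map_in_paths_iff) (auto simp: a)
    assume "reach t (\<gamma> m) (\<gamma> n) c"
    then show "path_time t (map \<gamma> [m..<Suc n]) \<le> c"
      using * \<open>m \<le> n\<close> unfolding path_time_map[OF \<open>m \<le> n\<close>] geodesic_upto_def by (meson order_refl)
  qed (rule a)
qed

section \<open>Existence of geodesics\<close>

lemma finite_neighbours: "finite {v. adjacent u v}"
proof -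
  obtain x y where u: "u = (x, y)" by (cases u)
  have "{v. adjacent u v} \<subseteq> {(x + 1, y), (x - 1, y), (x, y + 1), (x, y - 1)}"
    by (auto simp: u elim!: adjacentE)
  then show ?thesis by (rule finite_subset) simp
qed

lemma finite_walk_times: "finite {c. walk t n u v c}"
proof (induction n arbitrary: u)
  case 0
  have "{c. walk t 0 u v c} \<subseteq> {0}" by (auto elim: walk.cases)
  then show ?case by (rule finite_subset) simp
next
  case (Suc n)
  have "{c. walk t (Suc n) u v c} \<subseteq>
      (\<Union>z\<in>{z. adjacent u z}. (+) (t (edge_between u z)) ` {c. walk t n z v c})"
    by (auto elim!: walk.cases[of t "Suc n"])
  then show ?case by (rule finite_subset) (use Suc finite_neighbours in blast)
qed

lemma walk_ge:
  assumes "\<And>e. 1 \<le> t e" "walk t n u v c" shows "real n \<le> c"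
  using assms(2) by (induction rule: walk.induct) (auto intro: add_mono assms(1))

lemma lattice_induct:
  assumes "P (0::int, 0::int)" "\<And>u v. adjacent u v \<Longrightarrow> P u \<Longrightarrow> P v"
  shows "P v"
proof -
  have n: "P (int n, 0)" "P (- int n, 0)" for n
  proof (induction n)
    case (Suc n)
    show "P (int (Suc n), 0)" using Suc assms(2)[OF adjacent_right, of "int n" 0] by (simp add: add.commute)
    have "adjacent (- int n, 0) (- int (Suc n), 0)"
      using adjacent_right[of "- int (Suc n)" 0] adjacent_sym by simp
    then show "P (- int (Suc n), 0)" using Suc assms(2) by blast
  qed (use assms(1) in auto)
  have x: "P (x, 0)" for x
    using n[of "nat \<bar>x\<bar>"] by (cases "x \<ge> 0") auto
  have m: "P (x, int n)" "P (x, - int n)" for x n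
  proof (induction n)
    case (Suc n)
    show "P (x, int (Suc n))" using Suc assms(2)[OF adjacent_up, of x "int n"] by (simp add: add.commute)
    have "adjacent (x, - int n) (x, - int (Suc n))"
      using adjacent_up[of x "- int (Suc n)"] adjacent_sym by simp
    then show "P (x, - int (Suc n))" using Suc assms(2) by blast
  qed (use x in auto)
  obtain x y where "v = (x, y)" by (cases v)
  then show ?thesis using m[of x "nat \<bar>y\<bar>"] by (cases "y \<ge> 0") auto
qed

text \<open>Every edge costs at least 1, so walks of cost at most \<open>B\<close> have at most
  \<open>B\<close> steps. By finiteness of the degree they realise only finitely many costs, and the
  least one is attained.\<close>

lemma geodesic_exists:
  assumes t: "\<And>e. 1 \<le> t e"
  shows "\<exists>\<gamma> n. geodesic_upto t \<gamma> n \<and> \<gamma> 0 = (0, 0) \<and> \<gamma> n = v"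
proof -
  have "\<exists>c. reach t (0, 0) v c"
    by (rule lattice_induct[of "\<lambda>v. \<exists>c. reach t (0, 0) v c"])
      (meson reach_refl reach_trans reach_single)+
  then obtain B where B: "reach t (0, 0) v B" by blast
  define S where "S = {c. reach t (0, 0) v c \<and> c \<le> B}"
  have "n \<le> nat \<lceil>B\<rceil>" if "walk t n (0, 0) v c" "c \<le> B" for n c
    using walk_ge[OF t that(1)] that(2) by linarith
  then have "S \<subseteq> (\<Union>n\<in>{..nat \<lceil>B\<rceil>}. {c. walk t n (0, 0) v c})"
    unfolding S_def reach_def by blast
  then have fin: "finite S" by (rule finite_subset) (auto simp: finite_walk_times)
  have "Min S \<in> S" using fin B by (intro Min_in) (auto simp: S_def)
  have min: "Min S \<le> c" if "reach t (0, 0) v c" for c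
  proof (cases "c \<le> B")
    case True
    then show ?thesis using that fin by (intro Min_le) (auto simp: S_def)
  next
    case False
    then show ?thesis using \<open>Min S \<in> S\<close> by (auto simp: S_def)
  qed
  from \<open>Min S \<in> S\<close> obtain n where "walk t n (0, 0) v (Min S)"
    unfolding S_def reach_def by blast
  from walk_function[OF this] obtain \<gamma> where g: "\<gamma> 0 = (0, 0)" "\<gamma> n = v"
      "\<forall>i<n. adjacent (\<gamma> i) (\<gamma> (Suc i))" "seg_time t \<gamma> 0 n = Min S"
    by blast
  \<comment> \<open>Replacing the stretch between \<open>s\<close> and \<open>s'\<close> by a
    cheaper walk would make the whole walk cheaper than the minimum.\<close>
  have "seg_time t \<gamma> s s' \<le> c" if "s \<le> s'" "s' \<le> n" "reach t (\<gamma> s) (\<gamma> s') c" for s s' c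
  proof -
    have "reach t (\<gamma> 0) (\<gamma> n) (seg_time t \<gamma> 0 s + c + seg_time t \<gamma> s' n)"
      using that g by (intro reach_trans[of _ _ "\<gamma> s'"] reach_trans[of _ _ "\<gamma> s"] reach_seg) auto
    then have "seg_time t \<gamma> 0 n \<le> seg_time t \<gamma> 0 s + c + seg_time t \<gamma> s' n"
      using min g by simp
    with that show ?thesis
      using seg_time_split[of 0 s n t \<gamma>] seg_time_split[of s s' n t \<gamma>] by linarith
  qed
  then show ?thesis using g unfolding geodesic_upto_def by blast
qed

section \<open>Environments with rows and columns of increasing speed\<close>

definition reach_le :: "(edge \<Rightarrow> real) \<Rightarrow> vertex \<Rightarrow> vertex \<Rightarrow> real \<Rightarrow> bool" where
  "reach_le t u v c \<longleftrightarrow> (\<exists>c'\<le>c. reach t u v c')"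

lemma reach_le_refl: "0 \<le> c \<Longrightarrow> reach_le t u u c"
  unfolding reach_le_def using reach_refl by blast

lemma reach_le_trans:
  assumes "reach_le t u v c" "reach_le t v z d" "c + d \<le> e"
  shows "reach_le t u z e"
proof -
  obtain c' d' where "c' \<le> c" "d' \<le> d" "reach t u v c'" "reach t v z d'"
    using assms unfolding reach_le_def by blast
  then show ?thesis unfolding reach_le_def
    using assms(3) by (intro exI[of _ "c' + d'"]) (auto intro: reach_trans)
qed

lemma reach_le_rev: "reach_le t u v c \<Longrightarrow> reach_le t v u c"
  unfolding reach_le_def using reach_rev by blast

lemma geodesic_le:
  assumes "geodesic_upto t \<gamma> n" "s \<le> s'" "s' \<le> n" "reach_le t (\<gamma> s) (\<gamma> s') c"
  shows "seg_time t \<gamma> s s' \<le> c"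
  using assms unfolding geodesic_upto_def reach_le_def by (meson order_trans)

text \<open>On a nearest-neighbour path this is the number of horizontal steps, kept real-valued for
  comparison with costs.\<close>

definition hor_steps :: "(nat \<Rightarrow> vertex) \<Rightarrow> nat \<Rightarrow> nat \<Rightarrow> real" where
  "hor_steps \<gamma> m n = (\<Sum>i=m..<n. \<bar>real_of_int (fst (\<gamma> (Suc i)) - fst (\<gamma> i))\<bar>)"

definition ver_steps :: "(nat \<Rightarrow> vertex) \<Rightarrow> nat \<Rightarrow> nat \<Rightarrow> real" where
  "ver_steps \<gamma> m n = (\<Sum>i=m..<n. \<bar>real_of_int (snd (\<gamma> (Suc i)) - snd (\<gamma> i))\<bar>)"

lemma sum_abs_diff_ge:
  fixes f :: "nat \<Rightarrow> int"
  assumes "m \<le> n"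
  shows "\<bar>real_of_int (f n - f m)\<bar> \<le> (\<Sum>i=m..<n. \<bar>real_of_int (f (Suc i) - f i)\<bar>)"
  using assms by (induction n rule: dec_induct) auto

lemma hor_steps_ge: "m \<le> n \<Longrightarrow> \<bar>real_of_int (fst (\<gamma> n) - fst (\<gamma> m))\<bar> \<le> hor_steps \<gamma> m n"
  unfolding hor_steps_def by (rule sum_abs_diff_ge)

lemma ver_steps_ge: "m \<le> n \<Longrightarrow> \<bar>real_of_int (snd (\<gamma> n) - snd (\<gamma> m))\<bar> \<le> ver_steps \<gamma> m n"
  unfolding ver_steps_def by (rule sum_abs_diff_ge)

lemma hor_steps_split: "m \<le> k \<Longrightarrow> k \<le> n \<Longrightarrow> hor_steps \<gamma> m n = hor_steps \<gamma> m k + hor_steps \<gamma> k n"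
  unfolding hor_steps_def by (simp add: sum.atLeastLessThan_concat)

lemma ver_steps_split: "m \<le> k \<Longrightarrow> k \<le> n \<Longrightarrow> ver_steps \<gamma> m n = ver_steps \<gamma> m k + ver_steps \<gamma> k n"
  unfolding ver_steps_def by (simp add: sum.atLeastLessThan_concat)

lemma hor_steps_nonneg: "0 \<le> hor_steps \<gamma> m n"
  unfolding hor_steps_def by (auto intro: sum_nonneg)

lemma ver_steps_nonneg: "0 \<le> ver_steps \<gamma> m n"
  unfolding ver_steps_def by (auto intro: sum_nonneg)

text \<open>The deterministic content of a typical sample. Rows of class at least \<open>i\<close>
  form one residue class modulo \<open>5 ^ i\<close>, represented by \<open>p i\<close>, and
  likewise columns by \<open>q i\<close>. The factor 1.001 absorbs the noise, which is at most a
  thousandth of \<alpha> to the class.\<close>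

locale environment =
  fixes \<alpha> :: real and t :: "edge \<Rightarrow> real" and r c :: "int \<Rightarrow> nat" and p q :: "nat \<Rightarrow> int"
  assumes alpha_pos: "0 < \<alpha>" and alpha_less: "5 * \<alpha> < 1"
    and hor_lower: "1 + \<alpha> ^ r y \<le> t (Hor (x, y))"
    and hor_upper: "t (Hor (x, y)) \<le> 1 + 1.001 * \<alpha> ^ r y"
    and ver_lower: "1 + \<alpha> ^ c x \<le> t (Ver (x, y))"
    and ver_upper: "t (Ver (x, y)) \<le> 1 + 1.001 * \<alpha> ^ c x"
    and row_class: "i \<le> r y \<longleftrightarrow> 5 ^ i dvd y - p i"
    and col_class: "i \<le> c x \<longleftrightarrow> 5 ^ i dvd x - q i"
begin

lemma alpha_power_antimono: "i \<le> k \<Longrightarrow> \<alpha> ^ k \<le> \<alpha> ^ i"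
  using alpha_pos alpha_less by (intro power_decreasing) auto

lemma alpha_power_pos: "0 < \<alpha> ^ i"
  using alpha_pos by simp

lemma time_ge_1: "1 \<le> t e"
proof (cases e)
  case (Hor v)
  obtain x y where "v = (x, y)" by (cases v)
  then show ?thesis using Hor hor_lower[of y x] alpha_power_pos[of "r y"] by simp
next
  case (Ver v)
  obtain x y where "v = (x, y)" by (cases v)
  then show ?thesis using Ver ver_lower[of x y] alpha_power_pos[of "c x"] by simp
qed

lemma time_nonneg: "0 \<le> t e"
  using time_ge_1[of e] by simp

section \<open>Spacing of fast lines and the cost of following them\<close>

lemma row_unique:
  assumes "i \<le> r y" "i \<le> r y'" "\<bar>y - y'\<bar> < 5 ^ i" shows "y = y'"
proof -
  have "5 ^ i dvd (y - p i) - (y' - p i)" using assms by (intro dvd_diff[OF row_class[THEN iffD1] row_class[THEN iffD1]])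
  then have "5 ^ i dvd y - y'" by simp
  then show ?thesis using assms(3) zdvd_imp_le[of "5 ^ i" "\<bar>y - y'\<bar>"] by force
qed

lemma col_unique:
  assumes "i \<le> c x" "i \<le> c x'" "\<bar>x - x'\<bar> < 5 ^ i" shows "x = x'"
proof -
  have "5 ^ i dvd (x - q i) - (x' - q i)" using assms by (intro dvd_diff[OF col_class[THEN iffD1] col_class[THEN iffD1]])
  then have "5 ^ i dvd x - x'" by simp
  then show ?thesis using assms(3) zdvd_imp_le[of "5 ^ i" "\<bar>x - x'\<bar>"] by force
qed

lemma dvd_in_window: "\<exists>y. a \<le> y \<and> y < a + 5 ^ i \<and> 5 ^ i dvd y - (b :: int)"
proof (intro exI conjI)
  show "a \<le> a + (b - a) mod 5 ^ i" "a + (b - a) mod 5 ^ i < a + 5 ^ i" by auto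
  have "a + (b - a) mod 5 ^ i - b = - (5 ^ i * ((b - a) div 5 ^ i))"
    using mult_div_mod_eq[of "5 ^ i" "b - a"] by linarith
  then show "5 ^ i dvd a + (b - a) mod 5 ^ i - b" by simp
qed

lemma row_exists: "\<exists>y. a \<le> y \<and> y < a + 5 ^ i \<and> i \<le> r y"
  unfolding row_class by (rule dvd_in_window)

lemma col_exists: "\<exists>x. a \<le> x \<and> x < a + 5 ^ i \<and> i \<le> c x"
  unfolding col_class by (rule dvd_in_window)

lemma row_run_nat:
  assumes "i \<le> r y"
  shows "reach_le t (x, y) (x + int n, y) (real n * (1 + 1.001 * \<alpha> ^ i))"
proof (induction n)
  case (Suc n)
  have "t (Hor (x + int n, y)) \<le> 1 + 1.001 * \<alpha> ^ i"
    using hor_upper[of "x + int n" y] alpha_power_antimono[OF assms] by simp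
  then have "reach_le t (x + int n, y) (x + int n + 1, y) (1 + 1.001 * \<alpha> ^ i)"
    unfolding reach_le_def using reach_single[OF adjacent_right, of t "x + int n" y] by auto
  moreover have "real n * (1 + 1.001 * \<alpha> ^ i) + (1 + 1.001 * \<alpha> ^ i) \<le> real (Suc n) * (1 + 1.001 * \<alpha> ^ i)"
    by (simp add: distrib_right)
  ultimately show ?case using reach_le_trans[OF Suc] by (simp add: add.assoc add.commute[of 1])
qed (simp add: reach_le_refl)

lemma col_run_nat:
  assumes "i \<le> c x"
  shows "reach_le t (x, y) (x, y + int n) (real n * (1 + 1.001 * \<alpha> ^ i))"
proof (induction n)
  case (Suc n)
  have "t (Ver (x, y + int n)) \<le> 1 + 1.001 * \<alpha> ^ i"
    using ver_upper[of x "y + int n"] alpha_power_antimono[OF assms] by simp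
  then have "reach_le t (x, y + int n) (x, y + int n + 1) (1 + 1.001 * \<alpha> ^ i)"
    unfolding reach_le_def using reach_single[OF adjacent_up, of t x "y + int n"] by auto
  moreover have "real n * (1 + 1.001 * \<alpha> ^ i) + (1 + 1.001 * \<alpha> ^ i) \<le> real (Suc n) * (1 + 1.001 * \<alpha> ^ i)"
    by (simp add: distrib_right)
  ultimately show ?case using reach_le_trans[OF Suc] by (simp add: add.assoc add.commute[of 1])
qed (simp add: reach_le_refl)

lemma row_run:
  assumes "i \<le> r y"
  shows "reach_le t (x, y) (x', y) (\<bar>real_of_int (x' - x)\<bar> * (1 + 1.001 * \<alpha> ^ i))"
proof (cases "x \<le> x'")
  case True
  then show ?thesis using row_run_nat[OF assms, of x "nat (x' - x)"] by simp
next
  case False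
  then show ?thesis using reach_le_rev[OF row_run_nat[OF assms, of x' "nat (x - x')"]] by (simp add: abs_if)
qed

lemma col_run:
  assumes "i \<le> c x"
  shows "reach_le t (x, y) (x, y') (\<bar>real_of_int (y' - y)\<bar> * (1 + 1.001 * \<alpha> ^ i))"
proof (cases "y \<le> y'")
  case True
  then show ?thesis using col_run_nat[OF assms, of y "nat (y' - y)"] by simp
next
  case False
  then show ?thesis using reach_le_rev[OF col_run_nat[OF assms, of y' "nat (y - y')"]] by (simp add: abs_if)
qed

text \<open>The source of all lower bounds: a step raises exactly one of the two counters by 1, so
  the surpluses on rows and on columns are charged separately. Taking \<open>a\<close> or
  \<open>b\<close> to be 0 ignores the surplus of one kind.\<close>

lemma seg_time_lower:
  assumes adj: "\<And>i. m \<le> i \<Longrightarrow> i < n \<Longrightarrow> adjacent (\<gamma> i) (\<gamma> (Suc i))"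
    and row: "\<And>i. m \<le> i \<Longrightarrow> i < n \<Longrightarrow> snd (\<gamma> (Suc i)) = snd (\<gamma> i) \<Longrightarrow> a \<le> \<alpha> ^ r (snd (\<gamma> i))"
    and col: "\<And>i. m \<le> i \<Longrightarrow> i < n \<Longrightarrow> fst (\<gamma> (Suc i)) = fst (\<gamma> i) \<Longrightarrow> b \<le> \<alpha> ^ c (fst (\<gamma> i))"
  shows "(1 + a) * hor_steps \<gamma> m n + (1 + b) * ver_steps \<gamma> m n \<le> seg_time t \<gamma> m n"
proof -
  have "(1 + a) * \<bar>real_of_int (fst (\<gamma> (Suc i)) - fst (\<gamma> i))\<bar>
      + (1 + b) * \<bar>real_of_int (snd (\<gamma> (Suc i)) - snd (\<gamma> i))\<bar> \<le> t (edge_between (\<gamma> i) (\<gamma> (Suc i)))"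
    if i: "m \<le> i" "i < n" for i
    using adj[OF i]
  proof (cases rule: adjacentE)
    case (right x y)
    then show ?thesis using row[OF i] hor_lower[of y x] by simp
  next
    case (left x y)
    then show ?thesis using row[OF i] hor_lower[of y x] by (simp add: edge_between_sym[of "(x + 1, y)"])
  next
    case (up x y)
    then show ?thesis using col[OF i] ver_lower[of x y] by simp
  next
    case (down x y)
    then show ?thesis using col[OF i] ver_lower[of x y] by (simp add: edge_between_sym[of "(x, y + 1)"])
  qed
  then have "(\<Sum>i=m..<n. (1 + a) * \<bar>real_of_int (fst (\<gamma> (Suc i)) - fst (\<gamma> i))\<bar>
      + (1 + b) * \<bar>real_of_int (snd (\<gamma> (Suc i)) - snd (\<gamma> i))\<bar>) \<le> seg_time t \<gamma> m n"
    unfolding seg_time_def by (intro sum_mono) auto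
  then show ?thesis
    by (simp add: hor_steps_def ver_steps_def sum.distrib sum_distrib_left)
qed

lemma seg_time_ge_steps:
  assumes "\<And>i. m \<le> i \<Longrightarrow> i < n \<Longrightarrow> adjacent (\<gamma> i) (\<gamma> (Suc i))"
  shows "hor_steps \<gamma> m n + ver_steps \<gamma> m n \<le> seg_time t \<gamma> m n"
  using seg_time_lower[of m n \<gamma> 0 0, OF assms] alpha_power_pos by (simp add: less_imp_le)

text \<open>A vertex sees a row of class \<open>n + 1\<close> and a column of class \<open>n + 1\<close> within distance
  \<open>5\<^sup>n\<^sup>+\<^sup>1\<close>; travelling there on lines of class \<open>n\<close> costs \<open>O((5\<alpha>)\<^sup>n)\<close> more than the distance,
  which is summable.\<close>

lemma climb:
  fixes s :: int
  assumes s: "s = 1 \<or> s = - 1"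
  shows "\<exists>dx dy. 0 \<le> dx \<and> 4 * dx \<le> 5 ^ Suc n \<and> 0 \<le> dy \<and> 4 * dy \<le> 5 ^ Suc n \<and>
    n \<le> c (x + s * dx) \<and>
    reach_le t (x, y) (x + s * dx, y + s * dy) (of_int (dx + dy) + 7 * (\<Sum>i<n. (5 * \<alpha>) ^ i))"
proof (induction n)
  case 0
  show ?case by (rule exI[of _ 0], rule exI[of _ 0]) (auto simp: reach_le_refl)
next
  case (Suc n)
  then obtain dx dy where d: "0 \<le> dx" "4 * dx \<le> 5 ^ Suc n" "0 \<le> dy" "4 * dy \<le> 5 ^ Suc n"
    and cl: "n \<le> c (x + s * dx)"
    and re: "reach_le t (x, y) (x + s * dx, y + s * dy) (of_int (dx + dy) + 7 * (\<Sum>i<n. (5 * \<alpha>) ^ i))"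
    by blast
  have ex: "\<exists>z'. 0 \<le> z' \<and> z' \<le> 5 ^ Suc n \<and> P (z + s * z')"
    if ex: "\<And>a. \<exists>z. a \<le> z \<and> z < a + 5 ^ Suc n \<and> P z" for P z
  proof (cases "s = 1")
    case True
    obtain w where "z \<le> w" "w < z + 5 ^ Suc n" "P w" using ex by blast
    then show ?thesis using True by (intro exI[of _ "w - z"]) auto
  next
    case False
    obtain w where "z - 5 ^ Suc n \<le> w" "w < z - 5 ^ Suc n + 5 ^ Suc n" "P w" using ex by blast
    then show ?thesis using False s by (intro exI[of _ "z - w"]) auto
  qed
  obtain ey where ey: "0 \<le> ey" "ey \<le> 5 ^ Suc n" "Suc n \<le> r (y + s * dy + s * ey)"
    using ex[of "\<lambda>z. Suc n \<le> r z"] row_exists by blast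
  obtain ex where ex: "0 \<le> ex" "ex \<le> 5 ^ Suc n" "Suc n \<le> c (x + s * dx + s * ex)"
    using ex[of "\<lambda>z. Suc n \<le> c z"] col_exists by blast
  have abs: "\<bar>s * z\<bar> = z" if "0 \<le> z" for z using s that by auto
  have "reach_le t (x + s * dx, y + s * dy) (x + s * dx, y + s * dy + s * ey) (of_int ey * (1 + 1.001 * \<alpha> ^ n))"
    using col_run[OF cl, of "y + s * dy" "y + s * dy + s * ey"] abs[OF ey(1)]
    by (simp flip: of_int_abs of_int_mult)
  moreover have "reach_le t (x + s * dx, y + s * dy + s * ey)
      (x + s * dx + s * ex, y + s * dy + s * ey) (of_int ex * (1 + 1.001 * \<alpha> ^ Suc n))"
    using row_run[OF ey(3), of "x + s * dx" "x + s * dx + s * ex"] abs[OF ex(1)]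
    by (simp flip: of_int_abs of_int_mult)
  \<comment> \<open>The vertical leg has surplus at most \<open>5.005 * (5 * \<alpha>) ^ n\<close>
    and the horizontal leg at most \<open>1.001 * (5 * \<alpha>) ^ n\<close>; the factor 7 covers
    their sum.\<close>
  moreover have "of_int (dx + dy) + 7 * (\<Sum>i<n. (5 * \<alpha>) ^ i) + of_int ey * (1 + 1.001 * \<alpha> ^ n)
      + of_int ex * (1 + 1.001 * \<alpha> ^ Suc n)
      \<le> of_int ((dx + ex) + (dy + ey)) + 7 * (\<Sum>i<Suc n. (5 * \<alpha>) ^ i)"
  proof -
    have "real_of_int ey \<le> 5 ^ Suc n" "real_of_int ex \<le> 5 ^ Suc n"
      using ey(2) ex(2) by (metis of_int_le_iff of_int_numeral of_int_power)+
    then have "real_of_int ey * (1.001 * \<alpha> ^ n) \<le> 5 ^ Suc n * (1.001 * \<alpha> ^ n)"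
      "real_of_int ex * (1.001 * \<alpha> ^ Suc n) \<le> 5 ^ Suc n * (1.001 * \<alpha> ^ Suc n)"
      using alpha_pos by (auto intro!: mult_right_mono)
    moreover have "5 ^ Suc n * (1.001 * \<alpha> ^ n) = 5.005 * (5 * \<alpha>) ^ n"
      "5 ^ Suc n * (1.001 * \<alpha> ^ Suc n) = 1.001 * (5 * \<alpha>) * (5 * \<alpha>) ^ n"
      by (simp_all add: power_mult_distrib)
    moreover have "(5 * \<alpha>) * (5 * \<alpha>) ^ n \<le> 1 * (5 * \<alpha>) ^ n"
      using alpha_pos alpha_less by (intro mult_right_mono) auto
    moreover have "0 \<le> (5 * \<alpha>) ^ n" using alpha_pos by simp
    ultimately show ?thesis by (simp add: algebra_simps)
  qed
  ultimately have "reach_le t (x, y) (x + s * dx + s * ex, y + s * dy + s * ey)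
      (of_int ((dx + ex) + (dy + ey)) + 7 * (\<Sum>i<Suc n. (5 * \<alpha>) ^ i))"
    using re by (meson reach_le_trans order_refl)
  then show ?case
    using d ey ex by (intro exI[of _ "dx + ex"] exI[of _ "dy + ey"]) (auto simp: algebra_simps)
qed

text \<open>Each of the two climbs in \<open>cone_bound\<close> contributes at most
  \<open>7 / (1 - 5 * \<alpha>)\<close> by the geometric series; 70 generously covers the surplus
  60.06 of the stretch between them.\<close>

definition excess :: real where
  "excess = 14 / (1 - 5 * \<alpha>) + 70"

lemma excess_ge: "84 \<le> excess"
proof -
  have "14 / 1 \<le> 14 / (1 - 5 * \<alpha>)"
    using alpha_pos alpha_less by (intro divide_left_mono) auto
  then show ?thesis by (simp add: excess_def)
qed

text \<open>Climb to columns of class \<open>n\<close> from both ends, where \<open>5 ^ n\<close> is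
  comparable to the distance, and join them by a row of class \<open>n\<close>. The joining stretch
  has length at most \<open>a + b\<close>, which is at most three times the minimum and hence below
  \<open>60 * 5 ^ n\<close>; its surplus is of order \<open>(5 * \<alpha>) ^ n\<close> and so
  bounded.\<close>

lemma cone_bound:
  assumes "4 \<le> a" "4 \<le> b" "a \<le> 2 * b" "b \<le> 2 * a"
  shows "reach_le t (0, 0) (a, b) (of_int (a + b) + excess)"
proof -
  have "1 \<le> nat (min a b div 4)" using assms by linarith
  then obtain n where "5 ^ n \<le> nat (min a b div 4)" "nat (min a b div 4) < 5 ^ (n + 1)"
    using ex_power_ivl1[of 5 "nat (min a b div 4)"] by auto
  then have "int (5 ^ n) \<le> min a b div 4" "min a b div 4 < int (5 ^ (n + 1))"
    using assms by linarith+
  then have n: "4 * 5 ^ n \<le> min a b" "min a b < 4 * 5 ^ Suc n" by auto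
  have S: "7 * (\<Sum>i<n. (5 * \<alpha>) ^ i) \<le> 7 / (1 - 5 * \<alpha>)"
  proof -
    have "(\<Sum>i<n. (5 * \<alpha>) ^ i) = (1 - (5 * \<alpha>) ^ n) / (1 - 5 * \<alpha>)"
      using alpha_less by (subst sum_gp_strict) auto
    also have "\<dots> \<le> 1 / (1 - 5 * \<alpha>)"
      using alpha_pos alpha_less by (intro divide_right_mono) auto
    finally show ?thesis by simp
  qed
  obtain x1 y1 where u: "0 \<le> x1" "4 * x1 \<le> 5 ^ Suc n" "0 \<le> y1" "4 * y1 \<le> 5 ^ Suc n" "n \<le> c x1"
    "reach_le t (0, 0) (x1, y1) (of_int (x1 + y1) + 7 * (\<Sum>i<n. (5 * \<alpha>) ^ i))"
    using climb[of 1 n 0 0] by auto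
  obtain x2 y2 where v: "0 \<le> x2" "4 * x2 \<le> 5 ^ Suc n" "0 \<le> y2" "4 * y2 \<le> 5 ^ Suc n" "n \<le> c (a - x2)"
    "reach_le t (a, b) (a - x2, b - y2) (of_int (x2 + y2) + 7 * (\<Sum>i<n. (5 * \<alpha>) ^ i))"
    using climb[of "- 1" n a b] by auto
  obtain z where z: "b - y2 - 5 ^ n \<le> z" "z < b - y2" "n \<le> r z"
    using row_exists[of "b - y2 - 5 ^ n" n] by auto
  \<comment> \<open>Each climb moves at most \<open>1.25 * 5 ^ n\<close> in either coordinate and
    \<open>z\<close> is at most \<open>5 ^ n\<close> below the upper climb, while \<open>a\<close>
    and \<open>b\<close> are at least \<open>4 * 5 ^ n\<close>. Thus the route is monotone and has
    exactly \<open>a + b\<close> steps.\<close>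
  have le: "x1 \<le> a - x2" "y1 \<le> z"
    using u v z n by auto
  have 1: "reach_le t (x1, y1) (x1, z) (of_int (z - y1) * (1 + 1.001 * \<alpha> ^ n))"
    using col_run[OF u(5), of y1 z] le by (simp flip: of_int_abs)
  have 2: "reach_le t (x1, z) (a - x2, z) (of_int (a - x2 - x1) * (1 + 1.001 * \<alpha> ^ n))"
    using row_run[OF z(3), of x1 "a - x2"] le by (simp flip: of_int_abs)
  have 3: "reach_le t (a - x2, z) (a - x2, b - y2) (of_int (b - y2 - z) * (1 + 1.001 * \<alpha> ^ n))"
    using col_run[OF v(5), of z "b - y2"] z by (simp flip: of_int_abs)
  have tot: "of_int (x1 + y1) + 7 * (\<Sum>i<n. (5 * \<alpha>) ^ i) + of_int (z - y1) * (1 + 1.001 * \<alpha> ^ n)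
      + of_int (a - x2 - x1) * (1 + 1.001 * \<alpha> ^ n) + of_int (b - y2 - z) * (1 + 1.001 * \<alpha> ^ n)
      + (of_int (x2 + y2) + 7 * (\<Sum>i<n. (5 * \<alpha>) ^ i)) \<le> of_int (a + b) + excess"
  proof -
    have "a + b - x1 - x2 - y1 - y2 \<le> 60 * 5 ^ n" using u v n assms by auto
    then have "real_of_int (a + b - x1 - x2 - y1 - y2) \<le> 60 * 5 ^ n"
      by (metis of_int_le_iff of_int_mult of_int_numeral of_int_power)
    then have "real_of_int (a + b - x1 - x2 - y1 - y2) * (1.001 * \<alpha> ^ n) \<le> 60 * 5 ^ n * (1.001 * \<alpha> ^ n)"
      using alpha_pos by (intro mult_right_mono) auto
    also have "\<dots> = 60.06 * (5 * \<alpha>) ^ n" by (simp add: power_mult_distrib)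
    also have "\<dots> \<le> 60.06 * 1"
      using alpha_pos alpha_less by (intro mult_left_mono power_le_one) auto
    finally have *: "real_of_int (a + b - x1 - x2 - y1 - y2) * (1.001 * \<alpha> ^ n) \<le> 60.06" by simp
    define A where "A = 1.001 * \<alpha> ^ n"
    define B where "B = (\<Sum>i<n. (5 * \<alpha>) ^ i)"
    have "14 / (1 - 5 * \<alpha>) = 2 * (7 / (1 - 5 * \<alpha>))" by simp
    with * S show ?thesis unfolding excess_def A_def[symmetric] B_def[symmetric]
      by (simp add: algebra_simps)
  qed
  note A = reach_le_trans[OF _ _ order_refl]
  show ?thesis
    by (rule reach_le_trans[OF A[OF A[OF A[OF u(6) 1] 2] 3] reach_le_rev[OF v(6)] tot])
qed

text \<open>Every unit of backward motion has to be made up for, which adds two steps of cost at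
  least 1 each to the \<open>a + b\<close> unavoidable ones.\<close>

lemma backward_bound:
  assumes "geodesic_upto t \<gamma> n" "\<gamma> 0 = (0, 0)" "\<gamma> n = (a, b)" "0 \<le> a" "0 \<le> b"
    and "seg_time t \<gamma> 0 n \<le> of_int (a + b) + excess" "i \<le> n"
  shows "- excess \<le> 2 * of_int (fst (\<gamma> i))" "- excess \<le> 2 * of_int (snd (\<gamma> i))"
proof -
  have "hor_steps \<gamma> 0 n + ver_steps \<gamma> 0 n \<le> of_int (a + b) + excess"
    using seg_time_ge_steps[of 0 n \<gamma>] assms unfolding geodesic_upto_def by fastforce
  moreover have "hor_steps \<gamma> 0 n = hor_steps \<gamma> 0 i + hor_steps \<gamma> i n"
    "ver_steps \<gamma> 0 n = ver_steps \<gamma> 0 i + ver_steps \<gamma> i n"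
    using assms by (auto intro: hor_steps_split ver_steps_split)
  moreover note hor_steps_ge[of 0 i \<gamma>] hor_steps_ge[of i n \<gamma>] ver_steps_ge[of 0 i \<gamma>] ver_steps_ge[of i n \<gamma>]
  ultimately show "- excess \<le> 2 * of_int (fst (\<gamma> i))" "- excess \<le> 2 * of_int (snd (\<gamma> i))"
    using assms excess_ge by simp_all
qed

end

section \<open>Crossing times and exchange inequalities\<close>

lemma first_hit:
  fixes f :: "nat \<Rightarrow> int"
  assumes "s \<le> n" "f s \<le> v" "v \<le> f n" "\<And>i. s \<le> i \<Longrightarrow> i < n \<Longrightarrow> f (Suc i) \<le> f i + 1"
  shows "\<exists>i. s \<le> i \<and> i \<le> n \<and> f i = v \<and> (\<forall>k. s \<le> k \<and> k < i \<longrightarrow> f k < v)"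
proof -
  define i where "i = (LEAST i. s \<le> i \<and> v \<le> f i)"
  have i: "s \<le> i" "v \<le> f i"
    using LeastI[of "\<lambda>i. s \<le> i \<and> v \<le> f i" n] assms unfolding i_def by auto
  have le: "i \<le> n" unfolding i_def using assms by (intro Least_le) auto
  have lt: "f k < v" if "s \<le> k" "k < i" for k
    using not_less_Least[of k "\<lambda>i. s \<le> i \<and> v \<le> f i"] that unfolding i_def by auto
  \<comment> \<open>Only upward jumps are bounded, which suffices: just before \<open>i\<close> the
    value is below \<open>v\<close>, so it cannot overshoot. Downward crossings are treated through
    the negated function.\<close>
  have "f i = v"
  proof (cases "i = s")
    case False
    with i have "f (i - 1) < v" "f (Suc (i - 1)) \<le> f (i - 1) + 1" "Suc (i - 1) = i"
      using lt[of "i - 1"] assms(4)[of "i - 1"] le by auto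
    with i show ?thesis by simp
  qed (use i assms in auto)
  with i le lt show ?thesis by blast
qed

text \<open>The replacement makes no more steps of either kind, and its surplus is at most
  \<open>1.001 * (0.06 + 0.2) * P * H\<close>, less than the surplus \<open>P * H\<close> already
  paid by the horizontal steps of the original.\<close>

lemma exchange_below_row:
  fixes P H V D W S x y :: real
  assumes "(1 + P) * H + V \<le> S" "S \<le> D * (1 + 1.001 * x) + W * (1 + 1.001 * y)" "D \<le> V" "W \<le> H"
   "x * D \<le> (P / 5) * (0.3 * H)" "y * W \<le> (P / 5) * H" "0 < P * H"
  shows False
proof -
  have "H + P * H + V \<le> D + W + 1001 / 1000 * (x * D) + 1001 / 1000 * (y * W)"
    using assms(1,2) by (simp add: algebra_simps)
  moreover have "x * D \<le> 3 / 50 * (P * H)" "y * W \<le> 1 / 5 * (P * H)" using assms(5,6) by (simp_all add: algebra_simps)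
  ultimately show False using assms(3,4,7) by linarith
qed

text \<open>All steps of the original carry surplus \<open>P\<close>; those of the replacement carry
  about a fifth of it.\<close>

lemma exchange_low_detour:
  fixes P H V S B :: real
  assumes "(1 + P) * H + (1 + P) * V \<le> S" "S \<le> B" "B \<le> (H + V) * (1 + 1.001 * (P / 5))" "0 < P * (H + V)"
  shows False
proof -
  have "H + V + P * (H + V) \<le> S" "B \<le> H + V + 1001 / 5000 * (P * (H + V))" using assms(1,3) by (simp_all add: field_simps)
  then show False using assms(2,4) by linarith
qed

text \<open>Here only vertical steps are known to be slow. The constant 1.7 arises from
  \<open>H0 \<le> 0.7 * V\<close> and \<open>K \<le> V\<close>, and the surplus of the replacement
  is about \<open>0.34 * P * V\<close>.\<close>

lemma exchange_high_detour:
  fixes P H V S K x H0 :: real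
  assumes "H + (1 + P) * V \<le> S" "S \<le> (H0 + K) * (1 + 1.001 * x)" "H0 \<le> H" "K \<le> V" "(H0 + K) * x \<le> 1.7 * V * (P / 5)" "0 < P * V"
  shows False
proof -
  have "H + V + P * V \<le> S" "S \<le> H0 + K + 1001 / 1000 * ((H0 + K) * x)" "(H0 + K) * x \<le> 17 / 50 * (P * V)"
    using assms(1,2,5) by (simp_all add: field_simps)
  then show False using assms(3,4,6) by linarith
qed

context environment
begin

text \<open>The row \<open>Y\<close> is by far the best row near the origin, and \<open>A\<close> is the first column on the right
  that is equally good. A geodesic to the far north-east that avoids the edge leading to \<open>(A, Y)\<close>
  can be shortened: if it reaches the column \<open>A\<close> while still below the row \<open>Y\<close>, climb to that row
  at the first column of class \<open>j + 1\<close> instead; if it leaves the row \<open>Y\<close> before reaching \<open>A\<close>,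
  follow the row up to \<open>A\<close> and then the column \<open>A\<close>.\<close>

lemma bottleneck:
  assumes geo: "geodesic_upto t \<gamma> n" and g0: "\<gamma> 0 = (0, 0)" and gn: "\<gamma> n = (a, b)"
    and time: "seg_time t \<gamma> 0 n \<le> of_int (a + b) + excess"
    and m: "1 \<le> m" and j: "excess \<le> 5 ^ j"
    and Y: "0 \<le> Y" "Y \<le> 5 ^ j" "j + m + 1 \<le> r Y"
    and A: "2 * 5 ^ (j + m) \<le> A" "A \<le> 3 * 5 ^ (j + m)" "j + m + 1 \<le> c A"
    and ab: "A \<le> a" "Y \<le> b"
  shows "\<exists>i<n. \<gamma> i = (A - 1, Y) \<and> \<gamma> (Suc i) = (A, Y)"
proof -
  define X where "X i = fst (\<gamma> i)" for i
  define Z where "Z i = snd (\<gamma> i)" for i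
  have XZ: "\<gamma> i = (X i, Z i)" for i by (simp add: X_def Z_def)
  define C where "C = j + m + 1"
  have adj: "adjacent (\<gamma> i) (\<gamma> (Suc i))" if "i < n" for i
    using geo that by (simp add: geodesic_upto_def)
  have steps: "X (Suc i) = X i \<and> \<bar>Z (Suc i) - Z i\<bar> = 1 \<or> Z (Suc i) = Z i \<and> \<bar>X (Suc i) - X i\<bar> = 1"
    if "i < n" for i
    using adj[OF that] unfolding XZ by (auto elim!: adjacentE)
  have pow: "5 ^ Suc j \<le> (5 :: int) ^ (j + m)" using m by (intro power_increasing) auto
  define M where "M = (5 :: int) ^ (j + m)"
  have M: "5 ^ j \<le> M" "0 < M" "5 ^ C = 5 * M" "A \<le> 3 * M"
    using A(2) by (auto simp: M_def C_def intro: power_increasing)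
  have A0: "0 < A" using A(1) by (smt (verit) zero_less_power)
  have a0: "0 \<le> a" "0 \<le> b" using A0 ab Y by auto
  have backw: "- (5 ^ j) \<le> 2 * X i" "- (5 ^ j) \<le> 2 * Z i" if "i \<le> n" for i
  proof -
    have "- (5 ^ j) \<le> 2 * real_of_int (X i)" "- (5 ^ j) \<le> 2 * real_of_int (Z i)"
      using backward_bound[OF geo g0 gn a0 time that] j by (auto simp: X_def Z_def)
    then show "- (5 ^ j) \<le> 2 * X i" "- (5 ^ j) \<le> 2 * Z i"
      by (simp_all flip: of_int_le_iff[where 'a = real])
  qed
  \<comment> \<open>Backtracking is at most half of \<open>5 ^ j\<close>, so such a row is within
    \<open>1.5 * 5 ^ j\<close> of \<open>Y\<close>. Lines of class at least \<open>Suc j\<close> are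
    \<open>5 ^ Suc j\<close> apart, and \<open>Y\<close> is already one of them.\<close>
  have below: "r (Z i) \<le> j" if "i \<le> n" "Z i < Y" for i
    using row_unique[of "Suc j" "Z i" Y] backw[OF that(1)] that Y by fastforce
  have Suc_alpha: "\<alpha> ^ Suc k \<le> \<alpha> ^ k / 5" for k
    using mult_right_mono[of "5 * \<alpha>" 1 "\<alpha> ^ k"] alpha_less alpha_power_pos[of k] by simp
  have C_alpha: "\<alpha> ^ C \<le> \<alpha> ^ Suc j"
    unfolding C_def by (rule alpha_power_antimono) simp
  have X0: "X 0 = 0" "Z 0 = 0" "X n = a" "Z n = b" using g0 gn by (auto simp: X_def Z_def)
  have X1: "X (Suc i) \<le> X i + 1" "Z (Suc i) \<le> Z i + 1" "- Z (Suc i) \<le> - Z i + 1" if "i < n" for i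
    using steps[OF that] by auto
  obtain \<tau> where \<tau>: "\<tau> \<le> n" "X \<tau> = A" "\<And>k. k < \<tau> \<Longrightarrow> X k < A"
    using first_hit[of 0 n X A] X1 X0 A0 ab by auto
  obtain \<tau>' where \<tau>': "\<tau>' \<le> n" "Z \<tau>' = Y" "\<And>k. k < \<tau>' \<Longrightarrow> Z k < Y"
    using first_hit[of 0 n Z Y] X1 X0 Y ab by auto
  show ?thesis
  proof (cases "\<tau> < \<tau>'")
    case True
    \<comment> \<open>The replacement leaves the path at column \<open>x0\<close>, climbs it to the
      row \<open>Y\<close> and follows that row. Since \<open>m \<ge> 1\<close>, \<open>x0\<close>
      is below \<open>5 ^ (j + m)\<close>, so at least \<open>5 ^ Suc j\<close> horizontal steps
      remain before \<open>A\<close>, all of them on slow rows below \<open>Y\<close>.\<close>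
    obtain x0 where x0: "0 \<le> x0" "x0 < 5 ^ Suc j" "Suc j \<le> c x0"
      using col_exists[of 0 "Suc j"] by auto
    have "x0 \<le> A" using x0 A pow A0 by linarith
    then obtain \<sigma> where \<sigma>: "\<sigma> \<le> \<tau>" "X \<sigma> = x0"
      using first_hit[of 0 \<tau> X x0] X1 X0 x0 \<tau> by force
    define P where "P = \<alpha> ^ j"
    have P: "0 < P" "\<alpha> ^ Suc j \<le> P / 5" "\<alpha> ^ C \<le> P / 5"
      using Suc_alpha[of j] C_alpha alpha_power_pos[of j] by (auto simp: P_def simp del: power_Suc)
    define D H V where "D = real_of_int (Y - Z \<sigma>)" and "H = hor_steps \<gamma> \<sigma> \<tau>'" and "V = ver_steps \<gamma> \<sigma> \<tau>'"
    define W where "W = \<bar>real_of_int (X \<tau>' - x0)\<bar>"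
    have "(1 + P) * H + (1 + 0) * V \<le> seg_time t \<gamma> \<sigma> \<tau>'"
      unfolding H_def V_def
    proof (rule seg_time_lower)
      fix i assume i: "\<sigma> \<le> i" "i < \<tau>'"
      show "adjacent (\<gamma> i) (\<gamma> (Suc i))" using adj i \<tau>' by simp
      show "P \<le> \<alpha> ^ r (snd (\<gamma> i))"
        using below[of i] i \<tau>' unfolding P_def Z_def by (intro alpha_power_antimono) auto
    qed (simp add: alpha_power_pos less_imp_le)
    moreover have "seg_time t \<gamma> \<sigma> \<tau>' \<le> D * (1 + 1.001 * \<alpha> ^ Suc j) + W * (1 + 1.001 * \<alpha> ^ C)"
    proof (rule geodesic_le[OF geo])
      have "Z \<sigma> \<le> Y" using \<tau>'(3)[of \<sigma>] \<sigma> True by simp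
      then have "reach_le t (x0, Z \<sigma>) (x0, Y) (D * (1 + 1.001 * \<alpha> ^ Suc j))"
        using col_run[OF x0(3), of "Z \<sigma>" Y] unfolding D_def by (simp flip: of_int_abs)
      from reach_le_trans[OF this row_run[OF Y(3)[folded C_def]] order_refl, of "X \<tau>'"]
      show "reach_le t (\<gamma> \<sigma>) (\<gamma> \<tau>') (D * (1 + 1.001 * \<alpha> ^ Suc j) + W * (1 + 1.001 * \<alpha> ^ C))"
        using \<sigma> \<tau>' by (simp add: XZ W_def)
    qed (use \<sigma> True \<tau>' in auto)
    moreover have V: "D \<le> V" "0 \<le> D"
      using ver_steps_ge[of \<sigma> \<tau>' \<gamma>] \<sigma> True \<tau>'(2) \<tau>'(3)[of \<sigma>] by (auto simp: V_def D_def Z_def)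
    moreover have H: "W \<le> H" "5 * 5 ^ j \<le> H" "0 \<le> W"
    proof -
      show "W \<le> H" "0 \<le> W"
        using hor_steps_ge[of \<sigma> \<tau>' \<gamma>] \<sigma> True by (auto simp: H_def W_def X_def)
      have "real_of_int (A - x0) \<le> hor_steps \<gamma> \<sigma> \<tau>"
        using hor_steps_ge[of \<sigma> \<tau> \<gamma>] \<sigma> \<tau> by (simp add: X_def)
      also have "\<dots> \<le> H"
        unfolding H_def using hor_steps_split[of \<sigma> \<tau> \<tau>' \<gamma>] hor_steps_nonneg[of \<gamma> \<tau> \<tau>'] \<sigma> True by simp
      finally have "real_of_int (A - x0) \<le> H" .
      moreover have "5 ^ Suc j \<le> A - x0" using x0 A pow by linarith
      then have "real_of_int (5 ^ Suc j) \<le> real_of_int (A - x0)" by (simp only: of_int_le_iff)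
      ultimately show "5 * 5 ^ j \<le> H" by simp
    qed
    \<comment> \<open>The climb is at most \<open>1.5 * 5 ^ j\<close> high by the bound on
      backtracking, whereas \<open>H\<close> is at least \<open>5 * 5 ^ j\<close>.\<close>
    moreover have D: "D \<le> 0.3 * H"
    proof -
      have "2 * (Y - Z \<sigma>) \<le> 3 * 5 ^ j" using backw(2)[of \<sigma>] Y \<sigma> \<tau> by auto
      then have "real_of_int (2 * (Y - Z \<sigma>)) \<le> real_of_int (3 * 5 ^ j)" by (simp only: of_int_le_iff)
      then have "2 * D \<le> 3 * 5 ^ j" by (simp add: D_def)
      then show ?thesis using H(2) by linarith
    qed
    moreover have "\<alpha> ^ Suc j * D \<le> (P / 5) * (0.3 * H)"
      by (rule mult_mono) (use P V D in auto)
    moreover have "\<alpha> ^ C * W \<le> (P / 5) * H"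
      by (rule mult_mono) (use P H in auto)
    moreover have "0 < P * H" using P H(2) by (intro mult_pos_pos) (auto intro: less_le_trans[of 0 "5 * 5 ^ j"])
    ultimately have False by (intro exchange_below_row[of P H V "seg_time t \<gamma> \<sigma> \<tau>'"]) simp_all
    then show ?thesis ..
  next
    case False
    \<comment> \<open>The last visit to row \<open>Y\<close> up to the first visit to column
      \<open>A\<close>: from here on the path stays strictly on one side of the row until it reaches
      \<open>A\<close>.\<close>
    define w where "w = (GREATEST i. i \<le> \<tau> \<and> Z i = Y)"
    have w: "w \<le> \<tau>" "Z w = Y"
      using GreatestI_nat[of "\<lambda>i. i \<le> \<tau> \<and> Z i = Y" \<tau>' \<tau>] False \<tau>' unfolding w_def by auto
    have wn: "Z k \<noteq> Y" if "w < k" "k \<le> \<tau>" for k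
      using Greatest_le_nat[of "\<lambda>i. i \<le> \<tau> \<and> Z i = Y" k \<tau>] that unfolding w_def by auto
    show ?thesis
    proof (cases "w = \<tau>")
      case True
      \<comment> \<open>Column \<open>A\<close> is first entered by a horizontal step from column
        \<open>A - 1\<close>; when this happens in row \<open>Y\<close> it is the desired
        edge.\<close>
      have "\<tau> > 0" using \<tau>(2) X0 A0 by (cases \<tau>) auto
      then have "X (Suc (\<tau> - 1)) = A" "Z (Suc (\<tau> - 1)) = Y" "X (\<tau> - 1) < A" "\<tau> - 1 < n"
        using \<tau> w True by auto
      then show ?thesis using steps[of "\<tau> - 1"] by (intro exI[of _ "\<tau> - 1"]) (auto simp: XZ)
    next
      case False
      then have w\<tau>: "w < \<tau>" using w by simp
      \<comment> \<open>A horizontal step at time \<open>w\<close> would stay in row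
        \<open>Y\<close>, against the choice of \<open>w\<close>. So every horizontal step after
        leaving is made off the row.\<close>
      have not_hor: "w < i" if "w \<le> i" "i < n" "Z (Suc i) = Z i" for i
      proof (rule ccontr)
        assume "\<not> w < i"
        then have "i = w" using that(1) by simp
        then have "Z (Suc w) = Y" using that(3) w(2) by metis
        then show False using wn[of "Suc w"] w\<tau> by simp
      qed
      define H0 where "H0 = \<bar>real_of_int (A - X w)\<bar>"
      show ?thesis
      proof (cases "Z \<tau> < Y")
        case True
        have lt: "Z k < Y" if "w < k" "k \<le> \<tau>" for k
        proof (rule ccontr)
          assume "\<not> Z k < Y"
          moreover have "- Z (Suc i) \<le> - Z i + 1" if "i < \<tau>" for i
            using X1(3)[of i] that \<tau>(1) by linarith
          ultimately have "\<exists>i. k \<le> i \<and> i \<le> \<tau> \<and> - Z i = - Y \<and> (\<forall>k'. k \<le> k' \<and> k' < i \<longrightarrow> - Z k' < - Y)"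
            using that True by (intro first_hit) auto
          then obtain i where "k \<le> i" "i \<le> \<tau>" "- Z i = - Y" by blast
          then show False using wn[of i] that by simp
        qed
        \<comment> \<open>The endpoint is not below row \<open>Y\<close>, so the path returns to it.
          Until then all horizontal steps lie below the row, on rows of class at most
          \<open>j\<close>, and following row \<open>Y\<close> directly is cheaper.\<close>
        have "\<exists>i. \<tau> \<le> i \<and> i \<le> n \<and> Z i = Y \<and> (\<forall>k. \<tau> \<le> k \<and> k < i \<longrightarrow> Z k < Y)"
          using X1(2) X0(4) \<tau>(1) True ab(2) by (intro first_hit) auto
        then obtain \<kappa> where \<kappa>: "\<tau> \<le> \<kappa>" "\<kappa> \<le> n" "Z \<kappa> = Y" "\<And>k. \<tau> \<le> k \<Longrightarrow> k < \<kappa> \<Longrightarrow> Z k < Y"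
          by blast
        define H V where "H = hor_steps \<gamma> w \<kappa>" and "V = ver_steps \<gamma> w \<kappa>"
        have "(1 + \<alpha> ^ j) * H + (1 + 0) * V \<le> seg_time t \<gamma> w \<kappa>"
          unfolding H_def V_def
        proof (rule seg_time_lower)
          fix i assume i: "w \<le> i" "i < \<kappa>"
          show "adjacent (\<gamma> i) (\<gamma> (Suc i))" using adj i \<kappa> by simp
          assume "snd (\<gamma> (Suc i)) = snd (\<gamma> i)"
          then have "w < i" using not_hor i \<kappa> by (simp add: Z_def)
          then have "Z i < Y" using lt[of i] \<kappa>(4)[of i] i by (cases "i \<le> \<tau>") auto
          then show "\<alpha> ^ j \<le> \<alpha> ^ r (snd (\<gamma> i))"
            using below[of i] i \<kappa> unfolding Z_def by (intro alpha_power_antimono) auto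
        qed (simp add: alpha_power_pos less_imp_le)
        moreover have "seg_time t \<gamma> w \<kappa> \<le> \<bar>real_of_int (X \<kappa> - X w)\<bar> * (1 + 1.001 * \<alpha> ^ C)"
          using row_run[OF Y(3)[folded C_def], of "X w" "X \<kappa>"] w \<kappa>
          by (intro geodesic_le[OF geo]) (auto simp: XZ)
        moreover have "\<bar>real_of_int (X \<kappa> - X w)\<bar> * (1 + 1.001 * \<alpha> ^ C) \<le> H * (1 + \<alpha> ^ j)"
        proof (rule mult_mono)
          show "\<bar>real_of_int (X \<kappa> - X w)\<bar> \<le> H"
            using hor_steps_ge[of w \<kappa> \<gamma>] w \<kappa> by (simp add: H_def X_def)
          show "1 + 1.001 * \<alpha> ^ C \<le> 1 + \<alpha> ^ j"
            using C_alpha Suc_alpha[of j] alpha_power_pos[of j] by (simp del: power_Suc)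
        qed (auto simp: H_def hor_steps_nonneg alpha_power_pos less_imp_le)
        moreover have "0 < V"
          using ver_steps_ge[of w \<tau> \<gamma>] ver_steps_split[of w \<tau> \<kappa> \<gamma>] ver_steps_nonneg[of \<gamma> \<tau> \<kappa>] w \<kappa> True
          by (simp add: V_def Z_def)
        ultimately show ?thesis by (simp add: algebra_simps)
      next
        case False
        then have above: "Y < Z \<tau>" using wn[of \<tau>] w\<tau> by simp
        have gt: "Y < Z k" if "w < k" "k \<le> \<tau>" for k
        proof (rule ccontr)
          assume "\<not> Y < Z k"
          moreover have "Z (Suc i) \<le> Z i + 1" if "i < \<tau>" for i
            using X1(2)[of i] that \<tau>(1) by linarith
          ultimately have "\<exists>i. k \<le> i \<and> i \<le> \<tau> \<and> Z i = Y \<and> (\<forall>k'. k \<le> k' \<and> k' < i \<longrightarrow> Z k' < Y)"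
            using that above by (intro first_hit) auto
          then obtain i where "k \<le> i" "i \<le> \<tau>" "Z i = Y" by blast
          then show False using wn[of i] that by simp
        qed
        define H V where "H = hor_steps \<gamma> w \<tau>" and "V = ver_steps \<gamma> w \<tau>"
        define P where "P = \<alpha> ^ (C - 1)"
        have P: "0 < P" "\<alpha> ^ C \<le> P / 5"
          using Suc_alpha[of "C - 1"] alpha_power_pos unfolding P_def by (auto simp: C_def)
        have XA: "2 * (A - X w) \<le> 7 * 5 ^ (j + m)"
          using backw(1)[OF order_trans[OF w(1) \<tau>(1)]] M by (simp flip: M_def)
        \<comment> \<open>Columns visited before \<open>A\<close> are within
          \<open>3.5 * 5 ^ (j + m)\<close> of it, less than the spacing \<open>5 ^ C\<close>; hence
          their class is below \<open>C\<close>.\<close>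
        have col: "P \<le> \<alpha> ^ c (fst (\<gamma> i))" if "w \<le> i" "i < \<tau>" for i
        proof -
          have "i \<le> n" using that \<tau>(1) by simp
          then have "- (5 ^ j) \<le> 2 * X i" by (rule backw)
          moreover have "X i < A" using \<tau>(3) that by simp
          ultimately have "\<bar>X i - A\<bar> < 5 ^ C" "X i \<noteq> A" using M by linarith+
          then have "\<not> C \<le> c (X i)"
            using col_unique[of C "X i" A] A(3)[folded C_def] by blast
          then show ?thesis unfolding P_def X_def by (intro alpha_power_antimono) auto
        qed
        have upper: "seg_time t \<gamma> w \<tau> \<le> (H0 + of_int (Z \<tau> - Y)) * (1 + 1.001 * \<alpha> ^ C)"
        proof (rule geodesic_le[OF geo])
          have "reach_le t (A, Y) (A, Z \<tau>) (of_int (Z \<tau> - Y) * (1 + 1.001 * \<alpha> ^ C))"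
            using col_run[OF A(3)[folded C_def], of Y "Z \<tau>"] above by simp
          from reach_le_trans[OF row_run[OF Y(3)[folded C_def]] this order_refl, of "X w"]
          show "reach_le t (\<gamma> w) (\<gamma> \<tau>) ((H0 + of_int (Z \<tau> - Y)) * (1 + 1.001 * \<alpha> ^ C))"
            using w \<tau> by (simp add: XZ H0_def distrib_right)
        qed (use w \<tau> in auto)
        have H: "H0 \<le> H" "0 \<le> H0" using hor_steps_ge[of w \<tau> \<gamma>] w \<tau> by (auto simp: H_def H0_def X_def)
        have V: "of_int (Z \<tau> - Y) \<le> V" "0 < V" using ver_steps_ge[of w \<tau> \<gamma>] w above by (auto simp: V_def Z_def)
        have wadj: "adjacent (\<gamma> i) (\<gamma> (Suc i))" if "w \<le> i" "i < \<tau>" for i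
          using adj that \<tau> by simp
        show ?thesis
        \<comment> \<open>Within height \<open>5 ^ C\<close> above row \<open>Y\<close> there is no
          further row of class \<open>C\<close>, so all steps are slow. A higher detour may find a
          fast row, but its many vertical steps on slow columns alone outweigh the
          replacement.\<close>
        proof (cases "\<forall>k. w < k \<and> k < \<tau> \<longrightarrow> Z k - Y < 5 ^ C")
          case True
          have "(1 + P) * H + (1 + P) * V \<le> seg_time t \<gamma> w \<tau>"
            unfolding H_def V_def
          proof (rule seg_time_lower)
            fix i assume i': "w \<le> i" "i < \<tau>"
            show "adjacent (\<gamma> i) (\<gamma> (Suc i))" "P \<le> \<alpha> ^ c (fst (\<gamma> i))"
              using wadj[OF i'] col[OF i'] by auto
            assume "snd (\<gamma> (Suc i)) = snd (\<gamma> i)"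
            note i = i' this
            have "w < i" using not_hor[of i] i \<tau>(1) by (simp add: Z_def)
            then have "\<not> C \<le> r (Z i)"
              using row_unique[of C "Z i" Y] Y(3)[folded C_def] True gt[of i] i by auto
            then show "P \<le> \<alpha> ^ r (snd (\<gamma> i))"
              unfolding P_def Z_def by (intro alpha_power_antimono) auto
          qed
          moreover have "(H0 + of_int (Z \<tau> - Y)) * (1 + 1.001 * \<alpha> ^ C) \<le> (H + V) * (1 + 1.001 * (P / 5))"
            by (intro mult_mono) (use H V P alpha_power_pos[of C] above in auto)
          moreover have "0 < P * (H + V)" using P H V by (intro mult_pos_pos) auto
          ultimately have False using upper by (intro exchange_low_detour)
          then show ?thesis ..
        next
          case False
          then obtain k where k: "w < k" "k < \<tau>" "5 ^ C \<le> Z k - Y" by force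
          have lower: "(1 + 0) * H + (1 + P) * V \<le> seg_time t \<gamma> w \<tau>"
            unfolding H_def V_def
          proof (rule seg_time_lower)
            fix i assume i: "w \<le> i" "i < \<tau>"
            show "adjacent (\<gamma> i) (\<gamma> (Suc i))" "P \<le> \<alpha> ^ c (fst (\<gamma> i))"
              using wadj[OF i] col[OF i] by auto
          qed (simp add: alpha_power_pos less_imp_le)
          have "5 ^ C \<le> V"
          proof -
            have "real_of_int (5 ^ C) \<le> real_of_int (Z k - Y)" using k by (simp only: of_int_le_iff)
            also have "\<dots> \<le> ver_steps \<gamma> w k"
              using ver_steps_ge[of w k \<gamma>] k w by (simp add: Z_def)
            also have "\<dots> \<le> V"
              using ver_steps_split[of w k \<tau> \<gamma>] ver_steps_nonneg[of \<gamma> k \<tau>] k by (simp add: V_def)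
            finally show ?thesis by simp
          qed
          moreover have "H0 \<le> 0.7 * 5 ^ C"
          proof -
            have "real_of_int (2 * (A - X w)) \<le> real_of_int (7 * 5 ^ (j + m))" using XA by (simp only: of_int_le_iff)
            moreover have "H0 = real_of_int (A - X w)" using \<tau>(3)[OF w\<tau>] by (simp add: H0_def)
            ultimately show ?thesis by (simp add: C_def)
          qed
          ultimately have "H0 \<le> 0.7 * V" by linarith
          then have "(H0 + of_int (Z \<tau> - Y)) * \<alpha> ^ C \<le> (1.7 * V) * (P / 5)"
            by (intro mult_mono) (use H V P alpha_power_pos[of C] above in auto)
          moreover have "0 < P * V" using P V by (intro mult_pos_pos) auto
          moreover have "H + (1 + P) * V \<le> seg_time t \<gamma> w \<tau>" using lower by simp
          ultimately have False using upper H V by (intro exchange_high_detour)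
          then show ?thesis ..
        qed
      qed
    qed
  qed
qed

end

section \<open>Directions of lattice paths\<close>

definition quadrant_arc :: "(real \<times> real) set" where
  "quadrant_arc = {x \<in> sphere 0 1. 0 \<le> fst x \<and> 0 \<le> snd x}"

lemma norm_vertex_point: "norm (vertex_point v) = sqrt ((real_of_int (fst v))\<^sup>2 + (real_of_int (snd v))\<^sup>2)"
  by (cases v) (simp add: vertex_point_def norm_prod_def)

lemma abs_le_norm_vertex_point:
  "\<bar>real_of_int (fst v)\<bar> \<le> norm (vertex_point v)" "\<bar>real_of_int (snd v)\<bar> \<le> norm (vertex_point v)"
  unfolding norm_vertex_point by (auto intro: real_le_rsqrt)

lemma norm_vertex_point_at_top:
  assumes "inj f"
  shows "filterlim (\<lambda>i. norm (vertex_point (f i))) at_top sequentially"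
  unfolding filterlim_at_top
proof
  fix K :: real
  let ?B = "{- \<lceil>K\<rceil>..\<lceil>K\<rceil>} \<times> {- \<lceil>K\<rceil>..\<lceil>K\<rceil>}"
  have "finite (f -` ?B)" using assms by (intro finite_vimageI) auto
  then have "\<forall>\<^sub>F i in sequentially. i \<notin> f -` ?B"
    unfolding cofinite_eq_sequentially[symmetric] eventually_cofinite by (simp add: vimage_def)
  then show "\<forall>\<^sub>F i in sequentially. K \<le> norm (vertex_point (f i))"
  proof (rule eventually_mono)
    fix i assume "i \<notin> f -` ?B"
    then have "K \<le> \<bar>real_of_int (fst (f i))\<bar> \<or> K \<le> \<bar>real_of_int (snd (f i))\<bar>"
      by (cases "f i") (auto simp: mem_Times_iff; linarith)
    then show "K \<le> norm (vertex_point (f i))"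
      using abs_le_norm_vertex_point[of "f i"] by linarith
  qed
qed

lemma DirI:
  assumes "norm x = 1" "\<And>\<epsilon>. 0 < \<epsilon> \<Longrightarrow> \<exists>\<^sub>F i in sequentially. dist (sgn (vertex_point (f i))) x < \<epsilon>"
  shows "x \<in> Dir f"
proof -
  have "\<exists>r. \<forall>k. dist (sgn (vertex_point (f (r k)))) x < 1 / Suc k \<and> r k < r (Suc k)"
  proof (rule dependent_nat_choice)
    show "\<exists>i. dist (sgn (vertex_point (f i))) x < 1 / Suc 0"
      using assms(2)[of 1] by (auto simp: frequently_sequentially)
    show "\<exists>i'. dist (sgn (vertex_point (f i'))) x < 1 / Suc (Suc k) \<and> i < i'" for i k
    proof -
      have "\<exists>\<^sub>F i in sequentially. dist (sgn (vertex_point (f i))) x < 1 / Suc (Suc k)"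
        by (rule assms(2)) simp
      then obtain i' where "Suc i \<le> i'" "dist (sgn (vertex_point (f i'))) x < 1 / Suc (Suc k)"
        unfolding frequently_sequentially by blast
      then show ?thesis by (intro exI[of _ i']) auto
    qed
  qed
  then obtain r where *: "\<forall>k. dist (sgn (vertex_point (f (r k)))) x < 1 / Suc k \<and> r k < r (Suc k)" ..
  note r = conjunct1[OF *[rule_format]] conjunct2[OF *[rule_format]]
  have "dist (sgn (vertex_point (f (r k)))) x \<le> inverse (real (Suc k))" for k
    unfolding inverse_eq_divide by (rule less_imp_le[OF r(1)])
  then have "(\<lambda>k. dist (sgn (vertex_point (f (r k)))) x) \<longlonglongrightarrow> 0"
    by (intro tendsto_sandwich[OF always_eventually always_eventually tendsto_const
          LIMSEQ_inverse_real_of_nat] allI zero_le_dist)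
  then have "(\<lambda>k. sgn (vertex_point (f (r k)))) \<longlonglongrightarrow> x"
    by (rule tendsto_dist_iff[THEN iffD2])
  moreover have "strict_mono r" using r(2) by (simp add: strict_mono_Suc_iff)
  moreover have "x \<in> sphere 0 1" using assms(1) by simp
  ultimately show ?thesis unfolding Dir_def by blast
qed

text \<open>For unit vectors, the inner product \<open>s\<close> and the determinant
  \<open>k\<close> satisfy \<open>s^2 + k^2 = 1\<close>, and the squared distance is
  \<open>2 - 2 * s\<close>. A small \<open>k\<close> leaves \<open>s\<close> near 1 or -1; the lower
  bounds on the coordinates give \<open>s \<ge> - 1 / 2\<close> and exclude the latter.\<close>

lemma dist_le_cross:
  fixes u d :: "real \<times> real"
  assumes "norm u = 1" "norm d = 1" "0 \<le> fst d" "0 \<le> snd d" "- (1 / 4) \<le> fst u" "- (1 / 4) \<le> snd u"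
    and "\<bar>fst d * snd u - snd d * fst u\<bar> \<le> \<epsilon>" "\<epsilon> \<le> 1 / 2"
  shows "dist u d \<le> 2 * \<epsilon>"
proof -
  define s where "s = fst d * fst u + snd d * snd u"
  define k where "k = fst d * snd u - snd d * fst u"
  have u: "(fst u)\<^sup>2 + (snd u)\<^sup>2 = 1" and d: "(fst d)\<^sup>2 + (snd d)\<^sup>2 = 1"
    using assms(1,2) by (simp_all add: norm_prod_def)
  have "s\<^sup>2 + k\<^sup>2 = ((fst u)\<^sup>2 + (snd u)\<^sup>2) * ((fst d)\<^sup>2 + (snd d)\<^sup>2)"
    by (simp add: s_def k_def power2_eq_square algebra_simps)
  then have sk: "s\<^sup>2 = 1 - k\<^sup>2" using u d by simp
  have k: "k\<^sup>2 \<le> \<epsilon>\<^sup>2" using assms(7) by (intro power2_le_iff_abs_le[THEN iffD2]) (auto simp: k_def)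
  have "\<epsilon>\<^sup>2 \<le> (1 / 2)\<^sup>2" using assms(7,8) by (intro power_mono) auto
  then have s34: "3 / 4 \<le> s\<^sup>2" using sk k by (simp add: power2_eq_square)
  have "(fst d)\<^sup>2 \<le> 1\<^sup>2" "(snd d)\<^sup>2 \<le> 1\<^sup>2" using d zero_le_power2[of "fst d"] zero_le_power2[of "snd d"]
    unfolding one_power2 by linarith+
  then have "fst d \<le> 1" "snd d \<le> 1" using power2_le_imp_le zero_le_one by blast+
  then have "fst d * (- (1 / 4)) \<ge> - (1 / 4)" "snd d * (- (1 / 4)) \<ge> - (1 / 4)" by auto
  moreover have "fst d * (- (1 / 4)) \<le> fst d * fst u" "snd d * (- (1 / 4)) \<le> snd d * snd u"
    by (rule mult_left_mono[OF assms(5,3)], rule mult_left_mono[OF assms(6,4)])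
  ultimately have "- (1 / 2) \<le> s" unfolding s_def by linarith
  have s0: "0 \<le> s"
  proof (rule ccontr)
    assume "\<not> 0 \<le> s"
    then have "(- s)\<^sup>2 \<le> (1 / 2)\<^sup>2" using \<open>- (1 / 2) \<le> s\<close> by (intro power_mono) auto
    then show False using s34 by (simp add: power2_eq_square)
  qed
  have "s\<^sup>2 \<le> 1\<^sup>2" using sk by simp
  then have "s \<le> 1" by (rule power2_le_imp_le) simp
  then have "s\<^sup>2 \<le> s" using s0 by (simp add: power2_eq_square mult_left_le)
  then have "1 - s \<le> \<epsilon>\<^sup>2" using sk k by simp
  have s4: "2 - 2 * s \<le> 4 * \<epsilon>\<^sup>2"
    using \<open>1 - s \<le> \<epsilon>\<^sup>2\<close> zero_le_power2[of \<epsilon>] by linarith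
  have "(dist u d)\<^sup>2 = (fst u - fst d)\<^sup>2 + (snd u - snd d)\<^sup>2"
    by (simp add: dist_prod_def dist_real_def)
  also have "\<dots> = ((fst u)\<^sup>2 + (snd u)\<^sup>2) + ((fst d)\<^sup>2 + (snd d)\<^sup>2) - 2 * s"
    by (simp add: s_def power2_eq_square algebra_simps)
  also have "\<dots> \<le> (2 * \<epsilon>)\<^sup>2" using u d s4 by (simp add: power_mult_distrib)
  finally show ?thesis by (rule power2_le_imp_le) (use assms(7) in auto)
qed

lemma Dir_subset_quadrant_arc:
  assumes inj: "inj f" and lower: "\<And>i. - K \<le> real_of_int (fst (f i))" "\<And>i. - K \<le> real_of_int (snd (f i))"
  shows "Dir f \<subseteq> quadrant_arc"
proof
  fix x assume "x \<in> Dir f"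
  then obtain r where x: "norm x = 1" and r: "strict_mono r" "(\<lambda>k. sgn (vertex_point (f (r k)))) \<longlonglongrightarrow> x"
    unfolding Dir_def by auto
  let ?n = "\<lambda>k. norm (vertex_point (f (r k)))"
  have "filterlim ?n at_top sequentially"
    using filterlim_compose[OF norm_vertex_point_at_top[OF inj] filterlim_subseq[OF r(1)]] .
  then have lim: "(\<lambda>k. - K / ?n k) \<longlonglongrightarrow> 0"
    by (rule real_tendsto_divide_at_top[OF tendsto_const])
  have "(\<lambda>k. fst (sgn (vertex_point (f (r k))))) \<longlonglongrightarrow> fst x" "(\<lambda>k. snd (sgn (vertex_point (f (r k))))) \<longlonglongrightarrow> snd x"
    using r(2) by (auto intro: tendsto_fst tendsto_snd)
  moreover have "- K / ?n k \<le> fst (sgn (vertex_point (f (r k))))" "- K / ?n k \<le> snd (sgn (vertex_point (f (r k))))" for k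
    using divide_right_mono[OF lower(1), of "?n k" "r k"] divide_right_mono[OF lower(2), of "?n k" "r k"]
    by (auto simp: sgn_div_norm vertex_point_def case_prod_beta divide_inverse mult.commute)
  ultimately have "0 \<le> fst x" "0 \<le> snd x"
    using lim by (blast intro: LIMSEQ_le)+
  then show "x \<in> quadrant_arc" using x by (simp add: quadrant_arc_def)
qed

text \<open>The determinant of a fixed direction and \<open>f i\<close> changes by at most 1 in each step, so it cannot
  change its sign without being small compared to \<open>f i\<close>.\<close>

lemma Dir_eq_quadrant_arc:
  fixes f :: "nat \<Rightarrow> vertex"
  assumes inj: "inj f" and adj: "\<And>i. adjacent (f i) (f (Suc i))"
    and lower: "\<And>i. - K \<le> real_of_int (fst (f i))" "\<And>i. - K \<le> real_of_int (snd (f i))"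
    and right: "\<And>\<epsilon>. 0 < \<epsilon> \<Longrightarrow> \<exists>\<^sub>F i in sequentially. 0 \<le> fst (f i) \<and> real_of_int (snd (f i)) \<le> \<epsilon> * of_int (fst (f i))"
    and up: "\<And>\<epsilon>. 0 < \<epsilon> \<Longrightarrow> \<exists>\<^sub>F i in sequentially. 0 \<le> snd (f i) \<and> real_of_int (fst (f i)) \<le> \<epsilon> * of_int (snd (f i))"
  shows "Dir f = quadrant_arc"
proof (rule antisym[OF Dir_subset_quadrant_arc[OF inj lower]], rule subsetI)
  fix d assume "d \<in> quadrant_arc"
  then have d: "norm d = 1" "0 \<le> fst d" "0 \<le> snd d" by (auto simp: quadrant_arc_def)
  have d1: "fst d \<le> 1" "snd d \<le> 1"
    using d norm_fst_le[of "fst d" "snd d"] norm_snd_le[of "snd d" "fst d"] by auto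
  define N where "N i = norm (vertex_point (f i))" for i
  define g where "g i = fst d * of_int (snd (f i)) - snd d * of_int (fst (f i))" for i
  have step: "\<bar>g (Suc i) - g i\<bar> \<le> 1" for i
    using adj[of i] d d1 unfolding g_def by (cases rule: adjacentE) (auto simp: algebra_simps)
  have N: "\<forall>\<^sub>F i in sequentially. C \<le> N i" for C
    using norm_vertex_point_at_top[OF inj] unfolding filterlim_at_top N_def by blast
  show "d \<in> Dir f"
  proof (rule DirI[OF d(1)])
    fix \<epsilon> :: real assume "0 < \<epsilon>"
    \<comment> \<open>\<open>dist_le_cross\<close> loses a factor 2 and requires its bound to be at
      most \<open>1 / 2\<close>.\<close>
    define \<delta> where "\<delta> = min (\<epsilon> / 3) (1 / 2)"
    have \<delta>: "0 < \<delta>" "2 * \<delta> < \<epsilon>" "\<delta> \<le> 1 / 2" using \<open>0 < \<epsilon>\<close> by (auto simp: \<delta>_def)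
    have low: "\<exists>\<^sub>F i in sequentially. g i \<le> \<delta> * N i"
      using right[OF \<delta>(1)]
    proof (rule frequently_elim1)
      fix i assume i: "0 \<le> fst (f i) \<and> real_of_int (snd (f i)) \<le> \<delta> * real_of_int (fst (f i))"
      have "fst d * of_int (snd (f i)) \<le> 1 * (\<delta> * of_int (fst (f i)))"
        by (rule order_trans[OF mult_left_mono mult_right_mono]) (use i d d1 \<delta> in auto)
      moreover have "0 \<le> snd d * of_int (fst (f i))" using i d by auto
      moreover have "\<delta> * of_int (fst (f i)) \<le> \<delta> * N i"
        using abs_le_norm_vertex_point(1)[of "f i"] \<delta> by (intro mult_left_mono) (auto simp: N_def)
      ultimately show "g i \<le> \<delta> * N i" unfolding g_def by linarith
    qed
    have high: "\<exists>\<^sub>F i in sequentially. - (\<delta> * N i) \<le> g i"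
      using up[OF \<delta>(1)]
    proof (rule frequently_elim1)
      fix i assume i: "0 \<le> snd (f i) \<and> real_of_int (fst (f i)) \<le> \<delta> * real_of_int (snd (f i))"
      have "snd d * of_int (fst (f i)) \<le> 1 * (\<delta> * of_int (snd (f i)))"
        by (rule order_trans[OF mult_left_mono mult_right_mono]) (use i d d1 \<delta> in auto)
      moreover have "0 \<le> fst d * of_int (snd (f i))" using i d by auto
      moreover have "\<delta> * of_int (snd (f i)) \<le> \<delta> * N i"
        using abs_le_norm_vertex_point(2)[of "f i"] \<delta> by (intro mult_left_mono) (auto simp: N_def)
      ultimately show "- (\<delta> * N i) \<le> g i" unfolding g_def by linarith
    qed
    have "\<exists>\<^sub>F i in sequentially. \<bar>g i\<bar> \<le> \<delta> * N i"
    proof (rule ccontr)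
      assume "\<not> (\<exists>\<^sub>F i in sequentially. \<bar>g i\<bar> \<le> \<delta> * N i)"
      \<comment> \<open>With \<open>2 / \<delta> \<le> N i\<close> the forbidden band around 0
        reaches beyond 1 on both sides, so a step of size at most 1 cannot jump across it.\<close>
      then have "\<forall>\<^sub>F i in sequentially. \<bar>g i\<bar> > \<delta> * N i \<and> 2 / \<delta> \<le> N i"
        using N by (auto simp: not_frequently not_le intro: eventually_conj)
      then obtain i0 where i0: "\<And>i. i \<ge> i0 \<Longrightarrow> \<bar>g i\<bar> > \<delta> * N i \<and> 2 / \<delta> \<le> N i"
        unfolding eventually_sequentially by blast
      have big: "1 < \<delta> * N i" if "i \<ge> i0" for i
        using i0[OF that] \<delta> by (simp add: field_simps)
      obtain i1 where i1: "i1 \<ge> i0" "g i1 \<le> \<delta> * N i1"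
        using low unfolding frequently_sequentially by blast
      have "g i < - (\<delta> * N i)" if "i \<ge> i1" for i
        using that
      proof (induction i rule: dec_induct)
        case base
        then show ?case using i0[OF i1(1)] i1 by linarith
      next
        case (step i)
        then have "i0 \<le> i" using i1 by simp
        then show ?case using i0[of "Suc i"] big[of i] big[of "Suc i"] \<open>\<bar>g (Suc i) - g i\<bar> \<le> 1\<close> step by linarith
      qed
      then show False
        using high unfolding frequently_sequentially by (meson not_le)
    qed
    \<comment> \<open>The bound \<open>4 * K\<close> makes the normalised coordinates at least
      \<open>- 1 / 4\<close>, as \<open>dist_le_cross\<close> requires.\<close>
    moreover have "\<forall>\<^sub>F i in sequentially. 1 \<le> N i \<and> 4 * K \<le> N i" using N by (auto intro: eventually_conj)
    ultimately have "\<exists>\<^sub>F i in sequentially. \<bar>g i\<bar> \<le> \<delta> * N i \<and> (1 \<le> N i \<and> 4 * K \<le> N i)"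
      by (rule frequently_eventually_frequently)
    then show "\<exists>\<^sub>F i in sequentially. dist (sgn (vertex_point (f i))) d < \<epsilon>"
    proof (rule frequently_elim1)
      fix i assume i: "\<bar>g i\<bar> \<le> \<delta> * N i \<and> (1 \<le> N i \<and> 4 * K \<le> N i)"
      define u where "u = sgn (vertex_point (f i))"
      have u: "fst u = of_int (fst (f i)) / N i" "snd u = of_int (snd (f i)) / N i"
        by (simp_all add: u_def N_def sgn_div_norm vertex_point_def case_prod_beta divide_inverse)
      have Npos: "0 < N i" using i by linarith
      have "dist u d \<le> 2 * \<delta>"
      proof (rule dist_le_cross[OF _ d])
        show "norm u = 1" using Npos by (auto simp: u_def N_def norm_sgn)
        show "- (1 / 4) \<le> fst u" "- (1 / 4) \<le> snd u"
          using lower[of i] i Npos by (simp_all add: u field_simps)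
        have "fst d * snd u - snd d * fst u = g i / N i" by (simp add: u g_def diff_divide_distrib)
        moreover have "\<bar>g i / N i\<bar> \<le> \<delta>"
          using i Npos by (simp add: pos_divide_le_eq)
        ultimately show "\<bar>fst d * snd u - snd d * fst u\<bar> \<le> \<delta>" by simp
      qed (rule \<delta>)
      then show "dist (sgn (vertex_point (f i))) d < \<epsilon>" using \<delta>(2) by (simp add: u_def)
    qed
  qed
qed

text \<open>The diagonal direction belongs to the arc. Coordinates between 3/4 and 5/4 of a common
  large value have ratio at most 5/3, which leaves room below 2.\<close>

lemma Dir_diagonal_cone:
  assumes inj: "inj f" and Dir: "Dir f = quadrant_arc"
  shows "\<exists>n a b. f n = (a, b) \<and> N \<le> a \<and> N \<le> b \<and> a \<le> 2 * b \<and> b \<le> 2 * a"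
proof -
  define h where "h = sqrt (1 / 2)"
  have h: "h\<^sup>2 = 1 / 2" "0 < h" by (simp_all add: h_def)
  have "(h, h) \<in> quadrant_arc" using h by (simp add: quadrant_arc_def norm_prod_def)
  then obtain r where r: "strict_mono r" "(\<lambda>k. sgn (vertex_point (f (r k)))) \<longlonglongrightarrow> (h, h)"
    unfolding Dir[symmetric] Dir_def by auto
  have ev1: "\<forall>\<^sub>F k in sequentially. max 1 (4 * of_int N / h) \<le> norm (vertex_point (f (r k)))"
    using filterlim_compose[OF norm_vertex_point_at_top[OF inj] filterlim_subseq[OF r(1)]]
    unfolding filterlim_at_top by blast
  have ev2: "\<forall>\<^sub>F k in sequentially. dist (sgn (vertex_point (f (r k)))) (h, h) < h / 4"
    using h by (intro tendstoD[OF r(2)]) simp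
  obtain k where k: "max 1 (4 * of_int N / h) \<le> norm (vertex_point (f (r k)))"
    "dist (sgn (vertex_point (f (r k)))) (h, h) < h / 4"
    using eventually_conj[OF ev1 ev2] unfolding eventually_sequentially by blast
  obtain a b where ab: "f (r k) = (a, b)" by (cases "f (r k)")
  define n where "n = norm (vertex_point (f (r k)))"
  have n: "1 \<le> n" "4 * of_int N \<le> n * h" using k(1) h by (auto simp: n_def field_simps)
  have s: "sgn (vertex_point (f (r k))) = (of_int a / n, of_int b / n)"
    by (simp add: sgn_div_norm n_def ab vertex_point_def divide_inverse)
  have "dist (of_int a / n) h < h / 4" "dist (of_int b / n) h < h / 4"
    using k(2) dist_fst_le[of "sgn (vertex_point (f (r k)))" "(h, h)"]
      dist_snd_le[of "sgn (vertex_point (f (r k)))" "(h, h)"] by (auto simp: s)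
  then have "3 * h / 4 < of_int a / n" "of_int a / n < 5 * h / 4" "3 * h / 4 < of_int b / n" "of_int b / n < 5 * h / 4"
    using h(2) unfolding dist_real_def by linarith+
  then have *: "3 * (n * h) < 4 * of_int a" "4 * of_int a < 5 * (n * h)" "3 * (n * h) < 4 * of_int b" "4 * of_int b < 5 * (n * h)"
    using n by (simp_all add: field_simps)
  moreover have "0 < n * h" using n h by simp
  ultimately have "real_of_int N < of_int a" "real_of_int N < of_int b" "real_of_int a < 2 * of_int b" "real_of_int b < 2 * of_int a"
    using n by linarith+
  then have "N \<le> a" "N \<le> b" "a \<le> 2 * b" "b \<le> 2 * a" by linarith+
  then show ?thesis using ab by blast
qed

section \<open>Lattice symmetries\<close>

text \<open>Edges are determined by their endpoints, so \<open>E\<close> inherits the involution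
  property from \<open>R\<close>; it transports passage times by composition.\<close>

definition lattice_symmetry :: "(vertex \<Rightarrow> vertex) \<Rightarrow> (edge \<Rightarrow> edge) \<Rightarrow> bool" where
  "lattice_symmetry R E \<longleftrightarrow> (\<forall>v. R (R v) = v) \<and> (\<forall>e. edge_ends (E e) = R ` edge_ends e)"

context
  fixes R :: "vertex \<Rightarrow> vertex" and E :: "edge \<Rightarrow> edge"
  assumes sym: "lattice_symmetry R E"
begin

lemma symmetry_involution: "R (R v) = v" "R \<circ> (R \<circ> \<gamma>) = \<gamma>"
proof -
  have *: "R (R v) = v" for v using sym unfolding lattice_symmetry_def by blast
  show "R (R v) = v" "R \<circ> (R \<circ> \<gamma>) = \<gamma>" by (simp_all add: * comp_def)
qed

lemma symmetry_edge_involution: "E (E e) = e" "t \<circ> E \<circ> E = t"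
proof -
  have *: "E (E e) = e" for e
    using sym unfolding edge_ends_inject[symmetric]
    by (simp add: lattice_symmetry_def image_image symmetry_involution)
  show "E (E e) = e" "t \<circ> E \<circ> E = t" by (simp_all add: * comp_def)
qed

lemma symmetry_adjacent:
  assumes "adjacent u v"
  shows "adjacent (R u) (R v)" "edge_between (R u) (R v) = E (edge_between u v)"
proof -
  have "edge_ends (E (edge_between u v)) = {R u, R v}"
    using sym edge_between_ends[OF assms] by (simp add: lattice_symmetry_def)
  then show "adjacent (R u) (R v)" "edge_between (R u) (R v) = E (edge_between u v)"
    by (auto simp: adjacent_def intro: edge_between_eqI)
qed

lemma symmetry_walk: "walk t n u v c \<Longrightarrow> walk (t \<circ> E) n (R u) (R v) c"
proof (induction rule: walk.induct)
  case (walk_step u v n z c)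
  have "(t \<circ> E) (edge_between (R u) (R v)) = t (edge_between u v)"
    using symmetry_adjacent(2)[OF walk_step.hyps(1)] symmetry_edge_involution(1) by simp
  then show ?case
    using walk.walk_step[OF symmetry_adjacent(1)[OF walk_step.hyps(1)] walk_step.IH] by simp
qed (rule walk_refl)

lemma symmetry_seg_time:
  assumes "\<And>i. m \<le> i \<Longrightarrow> i < n \<Longrightarrow> adjacent (\<gamma> i) (\<gamma> (Suc i))"
  shows "seg_time (t \<circ> E) (R \<circ> \<gamma>) m n = seg_time t \<gamma> m n"
  unfolding seg_time_def using assms
  by (intro sum.cong) (auto simp: symmetry_adjacent(2) symmetry_edge_involution(1))

lemma symmetry_geodesic:
  assumes "geodesic_upto t \<gamma> n"
  shows "geodesic_upto (t \<circ> E) (R \<circ> \<gamma>) n"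
  unfolding geodesic_upto_def
proof (intro conjI allI impI)
  fix i assume "i < n"
  then show "adjacent ((R \<circ> \<gamma>) i) ((R \<circ> \<gamma>) (Suc i))"
    using assms by (simp add: geodesic_upto_def symmetry_adjacent(1))
next
  fix s s' c assume *: "s \<le> s' \<and> s' \<le> n \<and> reach (t \<circ> E) ((R \<circ> \<gamma>) s) ((R \<circ> \<gamma>) s') c"
  then obtain k where "walk (t \<circ> E) k (R (\<gamma> s)) (R (\<gamma> s')) c" by (auto simp: reach_def)
  from symmetry_walk[OF this] have "reach t (\<gamma> s) (\<gamma> s') c"
    by (auto simp: reach_def symmetry_involution symmetry_edge_involution)
  then have "seg_time t \<gamma> s s' \<le> c" using assms * by (auto simp: geodesic_upto_def)
  moreover have "seg_time (t \<circ> E) (R \<circ> \<gamma>) s s' = seg_time t \<gamma> s s'"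
    using assms * by (intro symmetry_seg_time) (auto simp: geodesic_upto_def)
  ultimately show "seg_time (t \<circ> E) (R \<circ> \<gamma>) s s' \<le> c" by simp
qed

lemma symmetry_geodesic_ray:
  assumes "\<And>e. 0 \<le> t e"
  shows "geodesic_ray (t \<circ> E) (R \<circ> \<gamma>) \<longleftrightarrow> geodesic_ray t \<gamma>"
proof -
  have "geodesic_upto t \<gamma> n" if "geodesic_upto (t \<circ> E) (R \<circ> \<gamma>) n" for n
    using symmetry_geodesic[OF that] by (simp add: symmetry_involution symmetry_edge_involution)
  then show ?thesis
    using assms by (auto simp: geodesic_ray_iff symmetry_geodesic)
qed

end

section \<open>Good scales\<close>

text \<open>The two lines have comparable classes, but the row is exceptionally close to the origin
  for its class while the column is at a typical distance. This imbalance is what makes the row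
  worth using.\<close>

definition good_scale :: "(int \<Rightarrow> nat) \<Rightarrow> (int \<Rightarrow> nat) \<Rightarrow> nat \<Rightarrow> nat \<Rightarrow> bool" where
  "good_scale r c j m \<longleftrightarrow> (\<exists>Y A. 0 \<le> Y \<and> Y \<le> 5 ^ j \<and> j + m + 1 \<le> r Y \<and>
     2 * 5 ^ (j + m) \<le> A \<and> A \<le> 3 * 5 ^ (j + m) \<and> j + m + 1 \<le> c A)"

definition in_cone :: "int \<Rightarrow> int \<Rightarrow> bool" where
  "in_cone a b \<longleftrightarrow> 4 \<le> a \<and> 4 \<le> b \<and> a \<le> 2 * b \<and> b \<le> 2 * a"

fun swap_edge :: "edge \<Rightarrow> edge" where
  "swap_edge (Hor (x, y)) = Ver (y, x)"
| "swap_edge (Ver (x, y)) = Hor (y, x)"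

lemma lattice_symmetry_swap: "lattice_symmetry prod.swap swap_edge"
  unfolding lattice_symmetry_def
proof (intro conjI allI)
  show "edge_ends (swap_edge e) = prod.swap ` edge_ends e" for e
    by (cases e rule: swap_edge.cases) auto
qed simp

section \<open>Compactness and edges forced on all geodesics\<close>

lemma exists_agreeing_limit:
  fixes F :: "nat \<Rightarrow> nat \<Rightarrow> 'a"
  assumes fin: "\<And>i. finite (range (\<lambda>k. F k i))"
  shows "\<exists>f. \<forall>n. \<exists>\<^sub>F k in sequentially. \<forall>i\<le>n. F k i = f i"
proof -
  \<comment> \<open>Diagonal argument: each entry takes finitely many values, so it is constant
    along a further subsequence, and the diagonal sequence stabilises every entry.\<close>
  define P where "P n s \<longleftrightarrow> (\<exists>c. \<forall>k. F (s k) n = c)" for n and s :: "nat \<Rightarrow> nat"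
  interpret subseqs P
  proof
    fix n and s :: "nat \<Rightarrow> nat" assume s: "strict_mono s"
    have "range (\<lambda>k. F (s k) n) \<subseteq> range (\<lambda>k. F k n)" by auto
    then have "finite ((\<lambda>k. F (s k) n) ` UNIV)" using fin finite_subset by blast
    then obtain k0 where inf: "infinite {k \<in> UNIV. F (s k) n = F (s k0) n}"
      using pigeonhole_infinite[of UNIV "\<lambda>k. F (s k) n"] by auto
    let ?S = "{k. F (s k) n = F (s k0) n}"
    have "strict_mono (enumerate ?S)"
      using inf by (intro strict_mono_enumerate) simp
    moreover have "F (s (enumerate ?S k)) n = F (s k0) n" for k
      using enumerate_in_set[of ?S k] inf by simp
    ultimately show "\<exists>r'. strict_mono r' \<and> P n (s \<circ> r')"
      unfolding P_def by (intro exI[of _ "enumerate ?S"]) auto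
  qed
  have "\<exists>c. \<forall>k\<ge>Suc i. F (diagseq k) i = c" for i
  proof -
    have "P i (diagseq \<circ> (+) (Suc i))"
    proof (rule diagseq_holds)
      fix n and s r' :: "nat \<Rightarrow> nat" assume "strict_mono r'" "P n s"
      then show "P n (s \<circ> r')" by (auto simp: P_def)
    qed
    then obtain c where c: "\<And>k. F (diagseq (Suc i + k)) i = c" by (auto simp: P_def)
    have "F (diagseq k) i = c" if "k \<ge> Suc i" for k using c[of "k - Suc i"] that by simp
    then show ?thesis by blast
  qed
  then obtain f where f: "\<And>i k. k \<ge> Suc i \<Longrightarrow> F (diagseq k) i = f i" by metis
  have "\<exists>\<^sub>F k in sequentially. \<forall>i\<le>n. F k i = f i" for n
    unfolding frequently_sequentially
  proof
    fix N
    have "N \<le> diagseq (max N (Suc n))"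
      using seq_suble[OF subseq_diagseq, of "max N (Suc n)"] by simp
    then show "\<exists>k\<ge>N. \<forall>i\<le>n. F k i = f i"
      using f by (intro exI[of _ "diagseq (max N (Suc n))"]) auto
  qed
  then show ?thesis by blast
qed

context environment
begin

lemma swap_environment: "environment \<alpha> (t \<circ> swap_edge) c r q p"
  by unfold_locales
    (use alpha_pos alpha_less hor_lower hor_upper ver_lower ver_upper row_class col_class in auto)

lemma geodesic_time_cone:
  assumes "geodesic_upto t \<gamma> n" "\<gamma> 0 = (0, 0)" "\<gamma> n = (a, b)" "in_cone a b"
  shows "seg_time t \<gamma> 0 n \<le> of_int (a + b) + excess"
  by (rule geodesic_le[OF assms(1)]) (use assms cone_bound[of a b] in \<open>auto simp: in_cone_def\<close>)

lemma excess_le_power: "\<exists>N. \<forall>j\<ge>N. excess \<le> 5 ^ j"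
proof -
  obtain N where N: "excess < 5 ^ N" using real_arch_pow[of 5 excess] by auto
  have "excess \<le> 5 ^ j" if "j \<ge> N" for j
    by (rule order_trans[OF less_imp_le[OF N] power_increasing[OF that]]) simp
  then show ?thesis by blast
qed

definition forced_edge :: "vertex \<Rightarrow> vertex \<Rightarrow> bool" where
  "forced_edge u v \<longleftrightarrow> adjacent u v \<and> 0 \<le> fst v \<and> 0 \<le> snd v \<and>
     (\<forall>\<gamma> n a b. geodesic_upto t \<gamma> n \<and> \<gamma> 0 = (0, 0) \<and> \<gamma> n = (a, b) \<and> in_cone a b \<and>
       fst v \<le> a \<and> snd v \<le> b \<longrightarrow> (\<exists>i<n. \<gamma> i = u \<and> \<gamma> (Suc i) = v))"

text \<open>A large scale brings the excess below \<open>5 ^ j\<close>, as \<open>bottleneck\<close>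
  demands, and \<open>Y \<le> 5 ^ j\<close> against \<open>A \<ge> 2 * 5 ^ (j + m)\<close> gives the
  ratio.\<close>

lemma forced_edge_if_good_scale:
  assumes scales: "\<And>m N. 1 \<le> m \<Longrightarrow> \<exists>j\<ge>N. good_scale r c j m" and m: "1 \<le> m"
  shows "\<exists>Y A. int N \<le> A \<and> 5 ^ m * Y \<le> A \<and> forced_edge (A - 1, Y) (A, Y)"
proof -
  obtain N0 where N0: "\<And>j. j \<ge> N0 \<Longrightarrow> excess \<le> 5 ^ j" using excess_le_power by blast
  obtain j where j: "j \<ge> max N N0" "good_scale r c j m" using scales[OF m] by blast
  then obtain Y A where YA: "0 \<le> Y" "Y \<le> 5 ^ j" "j + m + 1 \<le> r Y"
      "2 * 5 ^ (j + m) \<le> A" "A \<le> 3 * 5 ^ (j + m)" "j + m + 1 \<le> c A"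
    by (auto simp: good_scale_def)
  have ej: "excess \<le> 5 ^ j" using N0 j(1) by simp
  have "5 ^ m * Y \<le> 5 ^ m * 5 ^ j" using YA(2) by (intro mult_left_mono) auto
  moreover have "5 ^ m * 5 ^ j = (5 :: int) ^ (j + m)" "0 < (5 :: int) ^ (j + m)"
    by (simp_all add: power_add)
  ultimately have 5: "5 ^ m * Y \<le> A" using YA(4) by linarith
  have "N \<le> j" using j(1) by simp
  also have "j \<le> 5 ^ j" using power_gt_expt[of 5 j] by simp
  also have "(5 :: nat) ^ j \<le> 5 ^ (j + m)" by (rule power_increasing) auto
  finally have "int N \<le> int (5 ^ (j + m))" by (simp only: of_nat_le_iff)
  then have "int N \<le> 5 ^ (j + m)" by (simp only: of_nat_power of_nat_numeral)
  moreover have "0 < (5 :: int) ^ (j + m)" by simp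
  ultimately have N: "int N \<le> A" using YA(4) by linarith
  have "forced_edge (A - 1, Y) (A, Y)"
    unfolding forced_edge_def
  proof (intro conjI allI impI)
    show "adjacent (A - 1, Y) (A, Y)" using adjacent_right[of "A - 1" Y] by simp
    show "0 \<le> fst (A, Y)" "0 \<le> snd (A, Y)" using N YA by auto
    fix \<gamma> n a b
    assume *: "geodesic_upto t \<gamma> n \<and> \<gamma> 0 = (0, 0) \<and> \<gamma> n = (a, b) \<and> in_cone a b \<and> fst (A, Y) \<le> a \<and> snd (A, Y) \<le> b"
    then show "\<exists>i<n. \<gamma> i = (A - 1, Y) \<and> \<gamma> (Suc i) = (A, Y)"
      using geodesic_time_cone by (intro bottleneck[OF _ _ _ _ m ej YA]) auto
  qed
  then show ?thesis using 5 N by blast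
qed

end

lemma (in environment) forced_edge_swap:
  assumes "environment.forced_edge (t \<circ> swap_edge) u v"
  shows "forced_edge (prod.swap u) (prod.swap v)"
proof -
  interpret s: environment \<alpha> "t \<circ> swap_edge" c r q p by (rule swap_environment)
  note f = assms[unfolded s.forced_edge_def]
  show ?thesis
    unfolding forced_edge_def
  proof (intro conjI allI impI)
    show "adjacent (prod.swap u) (prod.swap v)"
      using f symmetry_adjacent(1)[OF lattice_symmetry_swap] by blast
    show "0 \<le> fst (prod.swap v)" "0 \<le> snd (prod.swap v)" using f by auto
    fix \<gamma> n a b
    assume *: "geodesic_upto t \<gamma> n \<and> \<gamma> 0 = (0, 0) \<and> \<gamma> n = (a, b) \<and> in_cone a b \<and>
      fst (prod.swap v) \<le> a \<and> snd (prod.swap v) \<le> b"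
    have "geodesic_upto (t \<circ> swap_edge) (prod.swap \<circ> \<gamma>) n"
      using * by (intro symmetry_geodesic[OF lattice_symmetry_swap]) auto
    moreover have "(prod.swap \<circ> \<gamma>) 0 = (0, 0)" "(prod.swap \<circ> \<gamma>) n = (b, a)" "in_cone b a" "fst v \<le> b" "snd v \<le> a"
      using * by (auto simp: in_cone_def)
    ultimately obtain i where i: "i < n" "prod.swap (\<gamma> i) = u" "prod.swap (\<gamma> (Suc i)) = v"
      using f unfolding comp_def by blast
    show "\<exists>i<n. \<gamma> i = prod.swap u \<and> \<gamma> (Suc i) = prod.swap v"
      using i(1) unfolding i(2,3)[symmetric] by auto
  qed
qed

lemma abs_coordinates_le_steps:
  assumes "\<And>i. i < n \<Longrightarrow> adjacent (\<gamma> i) (\<gamma> (Suc i))" "\<gamma> 0 = (0, 0)" "i \<le> n"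
  shows "\<bar>fst (\<gamma> i)\<bar> \<le> int i" "\<bar>snd (\<gamma> i)\<bar> \<le> int i"
proof -
  have "\<bar>fst (\<gamma> i)\<bar> \<le> int i \<and> \<bar>snd (\<gamma> i)\<bar> \<le> int i"
    using assms(3)
  proof (induction i)
    case (Suc i)
    then have "adjacent (\<gamma> i) (\<gamma> (Suc i))" using assms(1) by simp
    then show ?case using Suc by (cases rule: adjacentE) auto
  qed (simp add: assms(2))
  then show "\<bar>fst (\<gamma> i)\<bar> \<le> int i" "\<bar>snd (\<gamma> i)\<bar> \<le> int i" by auto
qed

lemma frequently_if_unbounded:
  fixes g :: "nat \<Rightarrow> int"
  assumes "\<And>N. \<exists>i. int N \<le> g i \<and> P i"
  shows "\<exists>\<^sub>F i in sequentially. P i"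
  unfolding frequently_sequentially
proof
  fix N
  define B where "B = Max (insert 0 (g ` {..N}))"
  have B: "g i \<le> B" if "i \<le> N" for i unfolding B_def using that by (intro Max_ge) auto
  obtain i where "int (nat (B + 1)) \<le> g i" "P i" using assms by blast
  moreover from this have "\<not> i \<le> N" using B[of i] by linarith
  ultimately show "\<exists>i\<ge>N. P i" by (intro exI[of _ i]) auto
qed

lemma (in environment) ray_inj:
  assumes "\<And>n. geodesic_upto t \<gamma> n" shows "inj \<gamma>"
proof (rule linorder_injI)
  fix s s' :: nat assume "s < s'"
  show "\<gamma> s \<noteq> \<gamma> s'"
  proof
    assume "\<gamma> s = \<gamma> s'"
    then have "seg_time t \<gamma> s s' \<le> 0"
      using assms[of s'] \<open>s < s'\<close> reach_refl unfolding geodesic_upto_def by (metis less_imp_le order_refl)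
    moreover have "(\<Sum>i=s..<s'. 1) \<le> seg_time t \<gamma> s s'"
      unfolding seg_time_def using time_ge_1 by (intro sum_mono) auto
    ultimately show False using \<open>s < s'\<close> by simp
  qed
qed

lemma (in environment) ray_adjacent: "(\<And>n. geodesic_upto t \<gamma> n) \<Longrightarrow> adjacent (\<gamma> i) (\<gamma> (Suc i))"
  unfolding geodesic_upto_def by (meson lessI)

text \<open>The diagonal is one of the directions of the ray, so the ray visits the cone beyond
  \<open>v\<close>, and its initial segment up to that visit is a geodesic to which forcing
  applies.\<close>

lemma (in environment) ray_uses_forced_edge:
  assumes geo: "\<And>n. geodesic_upto t \<gamma> n" and g0: "\<gamma> 0 = (0, 0)" and Dir: "Dir \<gamma> = quadrant_arc"
    and forced: "forced_edge u v"
  shows "edge_between u v \<in> ray_edges \<gamma>"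
proof -
  obtain n a b where n: "\<gamma> n = (a, b)" "max 4 (max (fst v) (snd v)) \<le> a" "max 4 (max (fst v) (snd v)) \<le> b"
      "a \<le> 2 * b" "b \<le> 2 * a"
    using Dir_diagonal_cone[OF ray_inj[OF geo] Dir] by blast
  then have "in_cone a b" by (simp add: in_cone_def)
  then obtain i where "\<gamma> i = u" "\<gamma> (Suc i) = v"
    using forced geo[of n] g0 n unfolding forced_edge_def by (metis max.bounded_iff)
  then show ?thesis by (auto simp: ray_edges_def)
qed

section \<open>The ray in the first quadrant\<close>

locale good_environment = environment +
  assumes row_scales: "1 \<le> m \<Longrightarrow> \<exists>j\<ge>N. good_scale r c j m"
    and col_scales: "1 \<le> m \<Longrightarrow> \<exists>j\<ge>N. good_scale c r j m"
begin

lemma forced_right: "1 \<le> m \<Longrightarrow> \<exists>Y A. int N \<le> A \<and> 5 ^ m * Y \<le> A \<and> forced_edge (A - 1, Y) (A, Y)"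
  using forced_edge_if_good_scale row_scales by blast

lemma forced_up: "1 \<le> m \<Longrightarrow> \<exists>Y A. int N \<le> A \<and> 5 ^ m * Y \<le> A \<and> forced_edge (Y, A - 1) (Y, A)"
proof -
  assume "1 \<le> m"
  interpret s: environment \<alpha> "t \<circ> swap_edge" c r q p by (rule swap_environment)
  show ?thesis
    using s.forced_edge_if_good_scale[OF col_scales \<open>1 \<le> m\<close>, of N] forced_edge_swap by fastforce
qed

text \<open>Both rays contain every forced edge, and forced horizontal edges exist arbitrarily far
  to the right, so the common edges cannot be finite in number.\<close>

lemma rays_not_distinct:
  assumes "\<And>n. geodesic_upto t \<gamma> n" "\<gamma> 0 = (0, 0)" "Dir \<gamma> = quadrant_arc"
    and "\<And>n. geodesic_upto t \<gamma>' n" "\<gamma>' 0 = (0, 0)" "Dir \<gamma>' = quadrant_arc"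
  shows "\<not> distinct_rays \<gamma> \<gamma>'"
proof
  assume "distinct_rays \<gamma> \<gamma>'"
  then have "finite (ray_edges \<gamma> \<inter> ray_edges \<gamma>')" by (simp add: distinct_rays_def)
  then have "finite {A. \<exists>Y. Hor (A, Y) \<in> ray_edges \<gamma> \<inter> ray_edges \<gamma>'}"
  proof (rule finite_surj[of _ _ "\<lambda>e. case e of Hor v \<Rightarrow> fst v | Ver v \<Rightarrow> 0"])
    show "{A. \<exists>Y. Hor (A, Y) \<in> ray_edges \<gamma> \<inter> ray_edges \<gamma>'}
      \<subseteq> (\<lambda>e. case e of Hor v \<Rightarrow> fst v | Ver v \<Rightarrow> 0) ` (ray_edges \<gamma> \<inter> ray_edges \<gamma>')"
      by (force simp: image_iff)
  qed
  then have "bdd_above {A. \<exists>Y. Hor (A, Y) \<in> ray_edges \<gamma> \<inter> ray_edges \<gamma>'}" by simp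
  then obtain B where B: "\<And>A Y. Hor (A, Y) \<in> ray_edges \<gamma> \<inter> ray_edges \<gamma>' \<Longrightarrow> A \<le> B"
    unfolding bdd_above_def by blast
  obtain Y A where A: "int (nat (B + 2)) \<le> A" "forced_edge (A - 1, Y) (A, Y)"
    using forced_right[of 1 "nat (B + 2)"] by auto
  have "edge_between (A - 1, Y) (A, Y) = Hor (A - 1, Y)" using edge_between_right[of "A - 1" Y] by simp
  then have "Hor (A - 1, Y) \<in> ray_edges \<gamma> \<inter> ray_edges \<gamma>'"
    using ray_uses_forced_edge[OF _ _ _ A(2)] assms by auto
  from B[OF this] A(1) show False by linarith
qed

text \<open>A limit of geodesics to diagonal points. The bounds on backtracking do not depend on the
  endpoint, so they hold for the limit; so do the passages through forced edges, which happen after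
  boundedly many steps.\<close>

lemma ray_exists:
  "\<exists>\<gamma>. (\<forall>n. geodesic_upto t \<gamma> n) \<and> \<gamma> 0 = (0, 0) \<and>
     (\<forall>i. - excess \<le> of_int (fst (\<gamma> i)) \<and> - excess \<le> of_int (snd (\<gamma> i))) \<and>
     (\<forall>u v. forced_edge u v \<longrightarrow> (\<exists>i. \<gamma> (Suc i) = v))"
proof -
  have "\<forall>k. \<exists>\<gamma> n. geodesic_upto t \<gamma> n \<and> \<gamma> 0 = (0, 0) \<and> \<gamma> n = (int k + 4, int k + 4)"
    using geodesic_exists[of t, OF time_ge_1] by blast
  then obtain G L where G: "\<And>k. geodesic_upto t (G k) (L k)" "\<And>k. G k 0 = (0, 0)"
      "\<And>k. G k (L k) = (int k + 4, int k + 4)"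
    by metis
  have in_cone: "in_cone (int k + 4) (int k + 4)" for k by (simp add: in_cone_def)
  have adj: "adjacent (G k i) (G k (Suc i))" if "i < L k" for i k
    using G(1)[of k] that by (simp add: geodesic_upto_def)
  have L: "k \<le> L k" for k
    using abs_coordinates_le_steps(1)[of "L k" "G k" "L k"] adj G by fastforce
  \<comment> \<open>Freezing each geodesic at its endpoint keeps entry \<open>i\<close> in the box
    of radius \<open>i\<close> for every \<open>k\<close>.\<close>
  define F where "F k i = G k (min i (L k))" for k i
  have "finite (range (\<lambda>k. F k i))" for i
  proof (rule finite_subset)
    have "\<bar>fst (F k i)\<bar> \<le> int i \<and> \<bar>snd (F k i)\<bar> \<le> int i" for k
      using abs_coordinates_le_steps[of "L k" "G k" "min i (L k)"] adj G(2) unfolding F_def by force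
    then have "F k i \<in> {- int i..int i} \<times> {- int i..int i}" for k
      by (simp add: mem_Times_iff abs_le_iff) (metis minus_le_iff)
    then show "range (\<lambda>k. F k i) \<subseteq> {- int i..int i} \<times> {- int i..int i}" by blast
  qed auto
  then obtain f where f: "\<And>n. \<exists>\<^sub>F k in sequentially. \<forall>i\<le>n. F k i = f i"
    using exists_agreeing_limit[of F] by blast
  have ex: "\<exists>k\<ge>N. n \<le> L k \<and> (\<forall>i\<le>n. G k i = f i)" for n N
  proof -
    obtain k where k: "k \<ge> max n N" "\<forall>i\<le>n. F k i = f i"
      using f[of n] unfolding frequently_sequentially by blast
    then have "n \<le> L k" using L[of k] by simp
    then show ?thesis using k by (intro exI[of _ k]) (auto simp: F_def min_def)
  qed
  have geo: "geodesic_upto t f n" for n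
  proof -
    obtain k where k: "n \<le> L k" "\<And>i. i \<le> n \<Longrightarrow> G k i = f i" using ex[of 0 n] by blast
    have seg: "seg_time t f s s' = seg_time t (G k) s s'" if "s' \<le> n" for s s'
      unfolding seg_time_def using that k(2) by (intro sum.cong) auto
    show ?thesis
      using G(1)[of k] k unfolding geodesic_upto_def by (auto simp: seg simp flip: k(2))
  qed
  have f0: "f 0 = (0, 0)" using ex[of 0 0] G(2) by force
  have low: "- excess \<le> of_int (fst (f i)) \<and> - excess \<le> of_int (snd (f i))" for i
  proof -
    obtain k where k: "i \<le> L k" "G k i = f i" using ex[of 0 i] by blast
    have "- excess \<le> 2 * of_int (fst (G k i))" "- excess \<le> 2 * of_int (snd (G k i))"
      using backward_bound[OF G(1) G(2) G(3) _ _ geodesic_time_cone[OF G(1) G(2) G(3) in_cone] k(1)] by auto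
    then show ?thesis using k(2) excess_ge by simp
  qed
  have "\<exists>i. f (Suc i) = v" if forced: "forced_edge u v" for u v
  proof -
    \<comment> \<open>\<open>B\<close> is the cost of one walk to \<open>v\<close>, independent of
      \<open>k\<close>. Each geodesic through \<open>v\<close> reaches it at cost at most
      \<open>B\<close>, hence within \<open>B\<close> steps, a range on which suitable
      \<open>G k\<close> agree with the limit.\<close>
    obtain B where B: "reach t (0, 0) v B"
    proof -
      obtain \<gamma> n where g: "geodesic_upto t \<gamma> n" "\<gamma> 0 = (0, 0)" "\<gamma> n = v"
        using geodesic_exists[of t, OF time_ge_1] by blast
      then have "reach t (\<gamma> 0) (\<gamma> n) (seg_time t \<gamma> 0 n)"
        by (intro reach_seg) (auto simp: geodesic_upto_def)
      then show ?thesis using g that by simp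
    qed
    obtain k where k: "k \<ge> nat (max (fst v) (snd v))" "nat \<lceil>B\<rceil> \<le> L k"
        "\<And>i. i \<le> nat \<lceil>B\<rceil> \<Longrightarrow> G k i = f i"
      using ex[of "nat (max (fst v) (snd v))" "nat \<lceil>B\<rceil>"] by blast
    have "fst v \<le> int k + 4" "snd v \<le> int k + 4" using k(1) by linarith+
    then obtain i where i: "i < L k" "G k (Suc i) = v"
      using forced G[of k] in_cone[of k] unfolding forced_edge_def by blast
    have "(\<Sum>i=0..<Suc i. 1) \<le> seg_time t (G k) 0 (Suc i)"
      unfolding seg_time_def using time_ge_1 by (intro sum_mono) auto
    also have "\<dots> \<le> B"
      using G(1)[of k] G(2)[of k] B i unfolding geodesic_upto_def by (metis Suc_leI le0)
    finally have "Suc i \<le> nat \<lceil>B\<rceil>" by (simp add: le_nat_iff) linarith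
    then show ?thesis using k(3) i by metis
  qed
  then show ?thesis using geo f0 low by blast
qed

lemma quadrant_ray:
  "(\<exists>\<gamma>. geodesic_ray t \<gamma> \<and> \<gamma> 0 = (0, 0) \<and> Dir \<gamma> = quadrant_arc) \<and>
   (\<forall>\<gamma> \<gamma>'. geodesic_ray t \<gamma> \<and> \<gamma> 0 = (0, 0) \<and> Dir \<gamma> = quadrant_arc \<and>
      geodesic_ray t \<gamma>' \<and> \<gamma>' 0 = (0, 0) \<and> Dir \<gamma>' = quadrant_arc \<longrightarrow> \<not> distinct_rays \<gamma> \<gamma>')"
proof
  obtain f where f: "\<And>n. geodesic_upto t f n" "f 0 = (0, 0)"
      "\<And>i. - excess \<le> of_int (fst (f i))" "\<And>i. - excess \<le> of_int (snd (f i))"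
      "\<And>u v. forced_edge u v \<Longrightarrow> \<exists>i. f (Suc i) = v"
    using ray_exists by blast
  have small: "\<exists>m\<ge>1. 1 / 5 ^ m \<le> \<epsilon>" if pos: "0 < \<epsilon>" for \<epsilon> :: real
  proof -
    obtain m where "(1 / 5) ^ m < \<epsilon>" using real_arch_pow_inv[OF pos, of "1 / 5"] by auto
    moreover have "(1 / 5 :: real) ^ Suc m \<le> (1 / 5) ^ m" by simp
    ultimately show ?thesis by (intro exI[of _ "Suc m"]) (simp add: power_one_over)
  qed
  have le: "real_of_int Y \<le> \<epsilon> * real_of_int A" if "1 / 5 ^ m \<le> \<epsilon>" "5 ^ m * Y \<le> A" "0 \<le> A" for Y A m \<epsilon>
  proof -
    have "real_of_int (5 ^ m * Y) \<le> real_of_int A" using that(2) by (simp only: of_int_le_iff)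
    then have "real_of_int Y \<le> (1 / 5 ^ m) * real_of_int A" by (simp add: field_simps)
    also have "\<dots> \<le> \<epsilon> * real_of_int A" using that by (intro mult_right_mono) auto
    finally show ?thesis .
  qed
  have "Dir f = quadrant_arc"
  \<comment> \<open>Forced vertices of slope at most \<open>1 / 5 ^ m\<close> bring the ray into
    every thin sector at the horizontal axis, and their mirror images do so at the vertical
    axis.\<close>
  proof (rule Dir_eq_quadrant_arc[of f excess, OF ray_inj[OF f(1)] ray_adjacent[OF f(1)] f(3,4)])
    fix \<epsilon> :: real assume "0 < \<epsilon>"
    then obtain m where m: "1 \<le> m" "1 / 5 ^ m \<le> \<epsilon>" using small by blast
    show "\<exists>\<^sub>F i in sequentially. 0 \<le> fst (f i) \<and> real_of_int (snd (f i)) \<le> \<epsilon> * real_of_int (fst (f i))"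
    proof (rule frequently_if_unbounded[of "\<lambda>i. fst (f i)"])
      fix N
      obtain Y A where A: "int N \<le> A" "5 ^ m * Y \<le> A" "forced_edge (A - 1, Y) (A, Y)"
        using forced_right[OF m(1)] by blast
      obtain i where "f (Suc i) = (A, Y)" using f(5)[OF A(3)] by blast
      then show "\<exists>i. int N \<le> fst (f i) \<and> 0 \<le> fst (f i) \<and> real_of_int (snd (f i)) \<le> \<epsilon> * real_of_int (fst (f i))"
        using le[OF m(2) A(2)] A(1) by (intro exI[of _ "Suc i"]) auto
    qed
    show "\<exists>\<^sub>F i in sequentially. 0 \<le> snd (f i) \<and> real_of_int (fst (f i)) \<le> \<epsilon> * real_of_int (snd (f i))"
    proof (rule frequently_if_unbounded[of "\<lambda>i. snd (f i)"])
      fix N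
      obtain Y A where A: "int N \<le> A" "5 ^ m * Y \<le> A" "forced_edge (Y, A - 1) (Y, A)"
        using forced_up[OF m(1)] by blast
      obtain i where "f (Suc i) = (Y, A)" using f(5)[OF A(3)] by blast
      then show "\<exists>i. int N \<le> snd (f i) \<and> 0 \<le> snd (f i) \<and> real_of_int (fst (f i)) \<le> \<epsilon> * real_of_int (snd (f i))"
        using le[OF m(2) A(2)] A(1) by (intro exI[of _ "Suc i"]) auto
    qed
  qed
  then show "\<exists>\<gamma>. geodesic_ray t \<gamma> \<and> \<gamma> 0 = (0, 0) \<and> Dir \<gamma> = quadrant_arc"
    using f(1,2) by (auto simp: geodesic_ray_iff[OF time_nonneg])
next
  show "\<forall>\<gamma> \<gamma>'. geodesic_ray t \<gamma> \<and> \<gamma> 0 = (0, 0) \<and> Dir \<gamma> = quadrant_arc \<and>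
      geodesic_ray t \<gamma>' \<and> \<gamma>' 0 = (0, 0) \<and> Dir \<gamma>' = quadrant_arc \<longrightarrow> \<not> distinct_rays \<gamma> \<gamma>'"
    using rays_not_distinct by (auto simp: geodesic_ray_iff[OF time_nonneg])
qed

end

section \<open>Reflections\<close>

definition reflect :: "int \<Rightarrow> int \<Rightarrow> vertex \<Rightarrow> vertex" where
  "reflect s\<^sub>1 s\<^sub>2 v = (s\<^sub>1 * fst v, s\<^sub>2 * snd v)"

text \<open>A reflection may turn the left or lower endpoint, which names an edge, into the right or
  upper one; \<open>min\<close> restores the naming convention.\<close>

fun reflect_edge :: "int \<Rightarrow> int \<Rightarrow> edge \<Rightarrow> edge" where
  "reflect_edge s\<^sub>1 s\<^sub>2 (Hor (x, y)) = Hor (min (s\<^sub>1 * x) (s\<^sub>1 * (x + 1)), s\<^sub>2 * y)"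
| "reflect_edge s\<^sub>1 s\<^sub>2 (Ver (x, y)) = Ver (s\<^sub>1 * x, min (s\<^sub>2 * y) (s\<^sub>2 * (y + 1)))"

lemma lattice_symmetry_reflect:
  assumes "s\<^sub>1 \<in> {1, - 1}" "s\<^sub>2 \<in> {1, - 1}"
  shows "lattice_symmetry (reflect s\<^sub>1 s\<^sub>2) (reflect_edge s\<^sub>1 s\<^sub>2)"
  unfolding lattice_symmetry_def
proof (intro conjI allI)
  show "reflect s\<^sub>1 s\<^sub>2 (reflect s\<^sub>1 s\<^sub>2 v) = v" for v
    using assms by (cases v) (auto simp: reflect_def)
  show "edge_ends (reflect_edge s\<^sub>1 s\<^sub>2 e) = reflect s\<^sub>1 s\<^sub>2 ` edge_ends e" for e
    using assms by (cases e rule: swap_edge.cases) (auto simp: reflect_def min_def)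
qed

lemma ray_edges_symmetry:
  assumes "lattice_symmetry R E" "\<And>n. adjacent (\<gamma> n) (\<gamma> (Suc n))"
  shows "ray_edges (R \<circ> \<gamma>) = E ` ray_edges \<gamma>"
  unfolding ray_edges_def using symmetry_adjacent(2)[OF assms] by (auto simp: image_iff)

lemma distinct_rays_symmetry:
  assumes sym: "lattice_symmetry R E" and "\<And>n. adjacent (\<gamma> n) (\<gamma> (Suc n))" "\<And>n. adjacent (\<gamma>' n) (\<gamma>' (Suc n))"
  shows "distinct_rays (R \<circ> \<gamma>) (R \<circ> \<gamma>') \<longleftrightarrow> distinct_rays \<gamma> \<gamma>'"
proof -
  have inj: "inj E" using symmetry_edge_involution(1)[OF sym] by (rule inj_on_inverseI)
  have "ray_edges (R \<circ> \<gamma>) \<inter> ray_edges (R \<circ> \<gamma>') = E ` (ray_edges \<gamma> \<inter> ray_edges \<gamma>')"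
    using assms inj by (simp add: ray_edges_symmetry image_Int)
  then show ?thesis
    unfolding distinct_rays_def using inj by (simp add: finite_image_iff inj_on_subset)
qed

section \<open>Directions and uniqueness of rays under reflections\<close>

definition quadrant :: "int \<Rightarrow> int \<Rightarrow> (real \<times> real) set" where
  "quadrant s\<^sub>1 s\<^sub>2 = {x \<in> sphere 0 1. 0 \<le> of_int s\<^sub>1 * fst x \<and> 0 \<le> of_int s\<^sub>2 * snd x}"

definition reflect_point :: "int \<Rightarrow> int \<Rightarrow> real \<times> real \<Rightarrow> real \<times> real" where
  "reflect_point s\<^sub>1 s\<^sub>2 x = (of_int s\<^sub>1 * fst x, of_int s\<^sub>2 * snd x)"

lemma Dir_reflect_subset:
  assumes "s\<^sub>1 \<in> {1, - 1}" "s\<^sub>2 \<in> {1, - 1}" "x \<in> Dir f"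
  shows "reflect_point s\<^sub>1 s\<^sub>2 x \<in> Dir (reflect s\<^sub>1 s\<^sub>2 \<circ> f)"
proof -
  obtain r where x: "x \<in> sphere 0 1" and r: "strict_mono r" "(\<lambda>k. sgn (vertex_point (f (r k)))) \<longlonglongrightarrow> x"
    using assms(3) unfolding Dir_def by blast
  have norm: "norm (reflect_point s\<^sub>1 s\<^sub>2 z) = norm z" for z
    using assms by (auto simp: reflect_point_def norm_prod_def)
  have vp: "vertex_point (reflect s\<^sub>1 s\<^sub>2 v) = reflect_point s\<^sub>1 s\<^sub>2 (vertex_point v)" for v
    by (cases v) (simp add: vertex_point_def reflect_point_def reflect_def)
  have sgn: "sgn (reflect_point s\<^sub>1 s\<^sub>2 z) = reflect_point s\<^sub>1 s\<^sub>2 (sgn z)" for z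
    unfolding sgn_div_norm norm by (simp add: reflect_point_def)
  have "(\<lambda>k. reflect_point s\<^sub>1 s\<^sub>2 (sgn (vertex_point (f (r k))))) \<longlonglongrightarrow> reflect_point s\<^sub>1 s\<^sub>2 x"
    unfolding reflect_point_def using r(2) by (intro tendsto_intros)
  moreover have "reflect_point s\<^sub>1 s\<^sub>2 x \<in> sphere 0 1" using x norm by simp
  ultimately show ?thesis
    unfolding Dir_def using r(1) by (auto simp: vp sgn)
qed

lemma Dir_reflect_iff:
  assumes s: "s\<^sub>1 \<in> {1, - 1}" "s\<^sub>2 \<in> {1, - 1}"
  shows "Dir (reflect s\<^sub>1 s\<^sub>2 \<circ> f) = quadrant_arc \<longleftrightarrow> Dir f = quadrant s\<^sub>1 s\<^sub>2"
proof -
  let ?P = "reflect_point s\<^sub>1 s\<^sub>2"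
  have inv: "?P (?P x) = x" for x using s by (auto simp: reflect_point_def)
  have q: "?P x \<in> quadrant_arc \<longleftrightarrow> x \<in> quadrant s\<^sub>1 s\<^sub>2" for x
    using s by (auto simp: reflect_point_def quadrant_arc_def quadrant_def norm_prod_def)
  have "reflect s\<^sub>1 s\<^sub>2 \<circ> (reflect s\<^sub>1 s\<^sub>2 \<circ> f) = f"
    by (rule symmetry_involution(2)[OF lattice_symmetry_reflect[OF s]])
  then have "x \<in> Dir f \<longleftrightarrow> ?P x \<in> Dir (reflect s\<^sub>1 s\<^sub>2 \<circ> f)" for x
    using Dir_reflect_subset[OF s, of x f] Dir_reflect_subset[OF s, of "?P x" "reflect s\<^sub>1 s\<^sub>2 \<circ> f"] inv
    by auto
  then show ?thesis using q inv by (metis subsetI subset_antisym)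
qed

definition unique_ray :: "(edge \<Rightarrow> real) \<Rightarrow> (real \<times> real) set \<Rightarrow> bool" where
  "unique_ray t D \<longleftrightarrow>
    (\<exists>\<gamma>. geodesic_ray t \<gamma> \<and> \<gamma> 0 = (0, 0) \<and> Dir \<gamma> = D) \<and>
    (\<forall>\<gamma> \<gamma>'. geodesic_ray t \<gamma> \<and> \<gamma> 0 = (0, 0) \<and> Dir \<gamma> = D \<and>
            geodesic_ray t \<gamma>' \<and> \<gamma>' 0 = (0, 0) \<and> Dir \<gamma>' = D \<longrightarrow> \<not> distinct_rays \<gamma> \<gamma>')"

lemma unique_ray_reflect:
  assumes s: "s\<^sub>1 \<in> {1, - 1}" "s\<^sub>2 \<in> {1, - 1}" and t: "\<And>e. 0 \<le> t e"
    and unique: "unique_ray (t \<circ> reflect_edge s\<^sub>1 s\<^sub>2) quadrant_arc"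
  shows "unique_ray t (quadrant s\<^sub>1 s\<^sub>2)"
proof -
  let ?R = "reflect s\<^sub>1 s\<^sub>2" and ?t = "t \<circ> reflect_edge s\<^sub>1 s\<^sub>2"
  note sym = lattice_symmetry_reflect[OF s]
  define Q where "Q t D \<gamma> \<longleftrightarrow> geodesic_ray t \<gamma> \<and> \<gamma> 0 = (0, 0) \<and> Dir \<gamma> = D" for t D \<gamma>
  have "?R v = (0, 0) \<longleftrightarrow> v = (0, 0)" for v
    using s by (auto simp: reflect_def prod_eq_iff)
  then have Q: "Q ?t quadrant_arc (?R \<circ> \<gamma>) \<longleftrightarrow> Q t (quadrant s\<^sub>1 s\<^sub>2) \<gamma>" for \<gamma>
    unfolding Q_def comp_apply[of ?R \<gamma> 0] symmetry_geodesic_ray[OF sym, of t, OF t] Dir_reflect_iff[OF s]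
    by simp
  obtain \<gamma> where "Q ?t quadrant_arc \<gamma>"
    using unique unfolding unique_ray_def Q_def by blast
  then have "Q t (quadrant s\<^sub>1 s\<^sub>2) (?R \<circ> \<gamma>)"
    using Q[of "?R \<circ> \<gamma>"] unfolding symmetry_involution(2)[OF sym] by blast
  moreover have "\<not> distinct_rays \<gamma> \<gamma>'" if "Q t (quadrant s\<^sub>1 s\<^sub>2) \<gamma>" "Q t (quadrant s\<^sub>1 s\<^sub>2) \<gamma>'" for \<gamma> \<gamma>'
  proof -
    have "\<not> distinct_rays (?R \<circ> \<gamma>) (?R \<circ> \<gamma>')"
      using unique that[folded Q] unfolding unique_ray_def Q_def by blast
    moreover have "adjacent (\<gamma> n) (\<gamma> (Suc n))" "adjacent (\<gamma>' n) (\<gamma>' (Suc n))" for n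
      using that by (auto simp: Q_def geodesic_ray_def)
    ultimately show ?thesis using distinct_rays_symmetry[OF sym] by blast
  qed
  ultimately show ?thesis unfolding unique_ray_def Q_def by blast
qed

definition good_scales :: "(int \<Rightarrow> nat) \<Rightarrow> (int \<Rightarrow> nat) \<Rightarrow> bool" where
  "good_scales r c \<longleftrightarrow> (\<forall>m\<ge>1. \<forall>N. \<exists>j\<ge>N. good_scale r c j m)"

lemma (in environment) reflect_environment:
  assumes s: "s\<^sub>1 \<in> {1, - 1}" "s\<^sub>2 \<in> {1, - 1}"
  shows "environment \<alpha> (t \<circ> reflect_edge s\<^sub>1 s\<^sub>2) (\<lambda>y. r (s\<^sub>2 * y)) (\<lambda>x. c (s\<^sub>1 * x))
    (\<lambda>i. s\<^sub>2 * p i) (\<lambda>i. s\<^sub>1 * q i)"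
proof
  have dvd: "5 ^ i dvd s * y - z \<longleftrightarrow> 5 ^ i dvd y - s * z" if "s \<in> {1, - 1}" for i and s y z :: int
  proof (cases "s = 1")
    case False
    then have "s * y - z = - (y - s * z)" using that by simp
    then show ?thesis by (metis dvd_minus_iff)
  qed simp
  show "i \<le> r (s\<^sub>2 * y) \<longleftrightarrow> 5 ^ i dvd y - s\<^sub>2 * p i" for i y using row_class dvd s by simp
  show "i \<le> c (s\<^sub>1 * x) \<longleftrightarrow> 5 ^ i dvd x - s\<^sub>1 * q i" for i x using col_class dvd s by simp
qed (use alpha_pos alpha_less hor_lower hor_upper ver_lower ver_upper in auto)

lemma (in environment) unique_ray_quadrant:
  assumes s: "s\<^sub>1 \<in> {1, - 1}" "s\<^sub>2 \<in> {1, - 1}"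
    and scales: "good_scales (\<lambda>y. r (s\<^sub>2 * y)) (\<lambda>x. c (s\<^sub>1 * x))" "good_scales (\<lambda>x. c (s\<^sub>1 * x)) (\<lambda>y. r (s\<^sub>2 * y))"
  shows "unique_ray t (quadrant s\<^sub>1 s\<^sub>2)"
proof (rule unique_ray_reflect[OF s time_nonneg])
  interpret R: environment \<alpha> "t \<circ> reflect_edge s\<^sub>1 s\<^sub>2" "\<lambda>y. r (s\<^sub>2 * y)" "\<lambda>x. c (s\<^sub>1 * x)"
    "\<lambda>i. s\<^sub>2 * p i" "\<lambda>i. s\<^sub>1 * q i"
    by (rule reflect_environment[OF s])
  interpret R: good_environment \<alpha> "t \<circ> reflect_edge s\<^sub>1 s\<^sub>2" "\<lambda>y. r (s\<^sub>2 * y)" "\<lambda>x. c (s\<^sub>1 * x)"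
    "\<lambda>i. s\<^sub>2 * p i" "\<lambda>i. s\<^sub>1 * q i"
    by unfold_locales (use scales in \<open>auto simp: good_scales_def\<close>)
  show "unique_ray (t \<circ> reflect_edge s\<^sub>1 s\<^sub>2) quadrant_arc"
    using R.quadrant_ray unfolding unique_ray_def .
qed

section \<open>Tangent functionals of the diamond\<close>

lemma frontier_l1_ball: "frontier l1_ball \<subseteq> {x. l1_norm x = 1}"
proof -
  have cont: "continuous_on UNIV l1_norm" unfolding l1_norm_def by (intro continuous_intros)
  have "closed l1_ball" unfolding l1_ball_def by (intro closed_Collect_le cont continuous_on_const)
  moreover have "{x. l1_norm x < 1} \<subseteq> interior l1_ball"
    by (intro interior_maximal open_Collect_less cont continuous_on_const) (auto simp: l1_ball_def)
  ultimately have "frontier l1_ball \<subseteq> l1_ball - {x. l1_norm x < 1}"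
    unfolding frontier_def by (auto simp: closure_closed)
  then show ?thesis by (auto simp: l1_ball_def)
qed

text \<open>For \<open>a \<noteq> 0\<close> the sign is locally constant and the expansion is
  linear; at \<open>a = 0\<close> the absolute value has a kink. Both cases are kept in one formula
  so that corners of the diamond show up as a nonzero kink term.\<close>

lemma abs_add_near:
  fixes a b :: real
  shows "\<forall>\<^sub>F s in at 0. \<bar>a + s * b\<bar> = \<bar>a\<bar> + s * (sgn a * b) + \<bar>s\<bar> * (if a = 0 then \<bar>b\<bar> else 0)"
proof (cases "a = 0")
  case False
  have "((\<lambda>s. a + s * b) \<longlongrightarrow> a + 0 * b) (at 0)" by (intro tendsto_intros)
  then have "\<forall>\<^sub>F s in at 0. dist (a + s * b) a < \<bar>a\<bar>" using False by (intro tendstoD) auto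
  then show ?thesis
  proof (rule eventually_mono)
    fix s assume "dist (a + s * b) a < \<bar>a\<bar>"
    then show "\<bar>a + s * b\<bar> = \<bar>a\<bar> + s * (sgn a * b) + \<bar>s\<bar> * (if a = 0 then \<bar>b\<bar> else 0)"
      using False by (cases "a > 0") (auto simp: dist_real_def sgn_if abs_if split: if_splits)
  qed
qed (simp add: abs_mult)

text \<open>Testing with \<open>s = e\<close> and \<open>s = - e\<close> separates the odd part from
  the even part.\<close>

lemma derivative_zero_abs:
  fixes K M L :: real
  assumes "\<And>\<epsilon>. 0 < \<epsilon> \<Longrightarrow> \<forall>\<^sub>F s in at 0. \<bar>s * K + \<bar>s\<bar> * M\<bar> \<le> \<epsilon> * \<bar>s\<bar>"
  shows "K = 0" "M = 0"
proof -
  have "\<bar>K + M\<bar> \<le> \<epsilon> \<and> \<bar>K - M\<bar> \<le> \<epsilon>" if pos: "0 < \<epsilon>" for \<epsilon>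
  proof -
    obtain d where d: "0 < d" "\<And>s. s \<noteq> 0 \<Longrightarrow> \<bar>s\<bar> < d \<Longrightarrow> \<bar>s * K + \<bar>s\<bar> * M\<bar> \<le> \<epsilon> * \<bar>s\<bar>"
      using assms[OF pos] unfolding eventually_at by (auto simp: dist_real_def)
    define e where "e = d / 2"
    have e: "0 < e" "e < d" using d(1) by (auto simp: e_def)
    have "\<bar>e * K + \<bar>e\<bar> * M\<bar> = e * \<bar>K + M\<bar>" "\<bar>(- e) * K + \<bar>- e\<bar> * M\<bar> = e * \<bar>K - M\<bar>"
      using e(1) abs_mult[of e "K + M"] abs_mult[of "- e" "K - M"] by (simp_all add: algebra_simps)
    then have "e * \<bar>K + M\<bar> \<le> e * \<epsilon>" "e * \<bar>K - M\<bar> \<le> e * \<epsilon>"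
      using d(2)[of e] d(2)[of "- e"] e by (simp_all add: mult.commute)
    then show ?thesis using e(1) by simp
  qed
  then have "\<bar>K + M\<bar> \<le> 0" "\<bar>K - M\<bar> \<le> 0"
    using field_le_epsilon[of "\<bar>K + M\<bar>" 0] field_le_epsilon[of "\<bar>K - M\<bar>" 0] by auto
  then show "K = 0" "M = 0" by linarith+
qed

text \<open>A corner of the diamond has no tangent, so \<open>p\<close> lies inside a side. There
  \<rho> has the signs of the coordinates of \<open>p\<close> as coefficients, and it equals the
  norm exactly where no coordinate has the opposite sign.\<close>

lemma tangent_functional_l1_ball:
  assumes lin: "linear \<rho>" and tan: "tangent_functional \<rho> l1_ball"
  obtains s\<^sub>1 s\<^sub>2 :: int where "s\<^sub>1 \<in> {1, - 1}" "s\<^sub>2 \<in> {1, - 1}" "tangent_directions \<rho> = quadrant s\<^sub>1 s\<^sub>2"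
proof -
  obtain p u v g g' U where p: "p \<in> frontier l1_ball" and uv: "norm u = 1" "u \<bullet> v = 0"
    and U: "open U" "p \<in> U"
    and graph: "frontier l1_ball \<inter> U = range (\<lambda>s. p + s *\<^sub>R u + g s *\<^sub>R v) \<inter> U"
    and g: "g 0 = 0" "(g has_real_derivative g') (at 0)"
    and line: "{x. \<rho> x = 1} = range (\<lambda>s. p + s *\<^sub>R (u + g' *\<^sub>R v))"
    using tan unfolding tangent_functional_def is_boundary_tangent_def by blast
  define \<tau> where "\<tau> = u + g' *\<^sub>R v"
  have "\<tau> \<bullet> u = 1" using uv by (simp add: \<tau>_def inner_add_left inner_commute[of v u] norm_eq_1)
  then have \<tau>0: "\<tau> \<noteq> 0" by auto
  have p1: "\<bar>fst p\<bar> + \<bar>snd p\<bar> = 1" using p frontier_l1_ball by (auto simp: l1_norm_def)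
  have ev1: "\<forall>\<^sub>F s in at 0. l1_norm (p + s *\<^sub>R u + g s *\<^sub>R v) = 1"
  proof -
    have "(g \<longlongrightarrow> g 0) (at 0)" using DERIV_isCont[OF g(2)] by (simp add: isCont_def)
    then have "((\<lambda>s. p + s *\<^sub>R u + g s *\<^sub>R v) \<longlongrightarrow> p + 0 *\<^sub>R u + g 0 *\<^sub>R v) (at 0)"
      by (intro tendsto_intros)
    then have "\<forall>\<^sub>F s in at 0. p + s *\<^sub>R u + g s *\<^sub>R v \<in> U"
      using U g(1) by (intro topological_tendstoD) auto
    then show ?thesis
    proof (rule eventually_mono)
      fix s assume "p + s *\<^sub>R u + g s *\<^sub>R v \<in> U"
      then have "p + s *\<^sub>R u + g s *\<^sub>R v \<in> frontier l1_ball" using graph by blast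
      then show "l1_norm (p + s *\<^sub>R u + g s *\<^sub>R v) = 1" using frontier_l1_ball by blast
    qed
  qed
  \<comment> \<open>\<open>K\<close> and \<open>M\<close> are the linear and the kink coefficient of
    \<open>l1_norm (p + s *\<^sub>R \<tau>)\<close> at \<open>s = 0\<close>. The norm is 1 along the
    boundary graph, which differs from the tangent line by o(s), so both coefficients must
    vanish.\<close>
  define K where "K = sgn (fst p) * fst \<tau> + sgn (snd p) * snd \<tau>"
  define M where "M = (if fst p = 0 then \<bar>fst \<tau>\<bar> else 0) + (if snd p = 0 then \<bar>snd \<tau>\<bar> else 0)"
  have KM: "\<forall>\<^sub>F s in at 0. \<bar>s * K + \<bar>s\<bar> * M\<bar> \<le> \<epsilon> * \<bar>s\<bar>" if \<epsilon>: "0 < \<epsilon>" for \<epsilon>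
  proof -
    have l1v: "0 \<le> l1_norm v" by (simp add: l1_norm_def)
    define \<delta> where "\<delta> = \<epsilon> / (l1_norm v + 1)"
    have \<delta>: "0 < \<delta>" "\<delta> * l1_norm v \<le> \<epsilon>" using \<epsilon> l1v by (auto simp: \<delta>_def field_simps)
    have "((\<lambda>s. g s / s) \<longlongrightarrow> g') (at 0)" using g unfolding DERIV_def by simp
    then have "\<forall>\<^sub>F s in at 0. dist (g s / s) g' < \<delta>" using \<delta>(1) by (rule tendstoD)
    moreover have "\<forall>\<^sub>F s in at 0. s \<noteq> (0::real)" by (simp add: eventually_at_filter)
    ultimately show ?thesis
      using ev1 abs_add_near[of "fst p" "fst \<tau>"] abs_add_near[of "snd p" "snd \<tau>"]
    proof eventually_elim
      fix s assume s: "dist (g s / s) g' < \<delta>" "s \<noteq> 0" "l1_norm (p + s *\<^sub>R u + g s *\<^sub>R v) = 1"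
        and abs1: "\<bar>fst p + s * fst \<tau>\<bar> = \<bar>fst p\<bar> + s * (sgn (fst p) * fst \<tau>) + \<bar>s\<bar> * (if fst p = 0 then \<bar>fst \<tau>\<bar> else 0)"
        and abs2: "\<bar>snd p + s * snd \<tau>\<bar> = \<bar>snd p\<bar> + s * (sgn (snd p) * snd \<tau>) + \<bar>s\<bar> * (if snd p = 0 then \<bar>snd \<tau>\<bar> else 0)"
      have "g s - s * g' = s * (g s / s - g')" using s(2) by (simp add: field_simps)
      then have "\<bar>g s - s * g'\<bar> = \<bar>s\<bar> * \<bar>g s / s - g'\<bar>" by (simp add: abs_mult)
      also have "\<dots> \<le> \<bar>s\<bar> * \<delta>" using s(1) by (intro mult_left_mono) (auto simp: dist_real_def)
      finally have gs: "\<bar>g s - s * g'\<bar> \<le> \<bar>s\<bar> * \<delta>" .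
      have l1: "s * K + \<bar>s\<bar> * M = l1_norm (p + s *\<^sub>R \<tau>) - 1"
        using abs1 abs2 p1 by (simp add: l1_norm_def K_def M_def algebra_simps)
      have eq: "p + s *\<^sub>R \<tau> = (p + s *\<^sub>R u + g s *\<^sub>R v) - (g s - s * g') *\<^sub>R v"
        by (simp add: \<tau>_def algebra_simps)
      have diff: "\<bar>l1_norm (x - k *\<^sub>R v) - l1_norm x\<bar> \<le> \<bar>k\<bar> * l1_norm v" for x k
      proof -
        have abs: "\<bar>\<bar>z - y\<bar> - \<bar>z\<bar>\<bar> \<le> \<bar>y\<bar>" for y z :: real by linarith
        have "l1_norm (x - k *\<^sub>R v) - l1_norm x =
            (\<bar>fst x - k * fst v\<bar> - \<bar>fst x\<bar>) + (\<bar>snd x - k * snd v\<bar> - \<bar>snd x\<bar>)"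
          by (simp add: l1_norm_def)
        also have "\<bar>\<dots>\<bar> \<le> \<bar>k * fst v\<bar> + \<bar>k * snd v\<bar>"
          by (rule order_trans[OF abs_triangle_ineq add_mono[OF abs abs]])
        also have "\<dots> = \<bar>k\<bar> * l1_norm v"
          by (simp add: l1_norm_def abs_mult distrib_left)
        finally show ?thesis .
      qed
      have "\<bar>s * K + \<bar>s\<bar> * M\<bar> \<le> \<bar>g s - s * g'\<bar> * l1_norm v"
        using diff[of "p + s *\<^sub>R u + g s *\<^sub>R v" "g s - s * g'"] unfolding l1 eq s(3) .
      also have "\<dots> \<le> \<bar>s\<bar> * \<delta> * l1_norm v" using gs l1v by (rule mult_right_mono)
      also have "\<dots> \<le> \<epsilon> * \<bar>s\<bar>" using \<delta>(2) mult_right_mono[of "\<delta> * l1_norm v" \<epsilon> "\<bar>s\<bar>"] by (simp add: ac_simps)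
      finally show "\<bar>s * K + \<bar>s\<bar> * M\<bar> \<le> \<epsilon> * \<bar>s\<bar>" .
    qed
  qed
  have K0: "K = 0" and M0: "M = 0" using derivative_zero_abs[OF KM] by auto
  \<comment> \<open>If one coordinate of \<open>p\<close> were 0, then \<open>M = 0\<close> would
    kill that coordinate of \<tau> and \<open>K = 0\<close> the other one.\<close>
  have nz: "fst p \<noteq> 0" "snd p \<noteq> 0"
    using K0 M0 \<tau>0 p1 by (auto simp: K_def M_def prod_eq_iff sgn_if split: if_splits)
  define a b where "a = \<rho> (1, 0)" and "b = \<rho> (0, 1)"
  have \<rho>: "\<rho> x = a * fst x + b * snd x" for x
  proof -
    have "x = fst x *\<^sub>R (1, 0) + snd x *\<^sub>R (0, 1)" by (simp add: prod_eq_iff)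
    then have "\<rho> x = \<rho> (fst x *\<^sub>R (1, 0) + snd x *\<^sub>R (0, 1))" by simp
    then show ?thesis unfolding linear_add[OF lin] linear_scale[OF lin] by (simp add: a_def b_def)
  qed
  have "p + 0 *\<^sub>R \<tau> \<in> {x. \<rho> x = 1}" "p + 1 *\<^sub>R \<tau> \<in> {x. \<rho> x = 1}"
    unfolding line \<tau>_def by blast+
  then have \<rho>p: "\<rho> p = 1" and \<rho>\<tau>: "a * fst \<tau> + b * snd \<tau> = 0"
    by (auto simp: \<rho> algebra_simps)
  define \<sigma>\<^sub>1 \<sigma>\<^sub>2 where "\<sigma>\<^sub>1 = sgn (fst p)" and "\<sigma>\<^sub>2 = sgn (snd p)"
  have \<sigma>: "\<sigma>\<^sub>1 * \<sigma>\<^sub>1 = 1" "\<sigma>\<^sub>2 * \<sigma>\<^sub>2 = 1" "\<sigma>\<^sub>1 * fst \<tau> + \<sigma>\<^sub>2 * snd \<tau> = 0"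
    using nz K0 by (auto simp: \<sigma>\<^sub>1_def \<sigma>\<^sub>2_def sgn_if K_def)
  \<comment> \<open>The coefficient vector of \<rho> and the sign vector both annihilate the nonzero
    \<tau>, so they are proportional; the value 1 at \<open>p\<close> fixes the factor.\<close>
  have "(a * \<sigma>\<^sub>2 - b * \<sigma>\<^sub>1) * fst \<tau> =
      \<sigma>\<^sub>2 * (a * fst \<tau> + b * snd \<tau>) - b * (\<sigma>\<^sub>1 * fst \<tau> + \<sigma>\<^sub>2 * snd \<tau>)"
    "(a * \<sigma>\<^sub>2 - b * \<sigma>\<^sub>1) * snd \<tau> =
      a * (\<sigma>\<^sub>1 * fst \<tau> + \<sigma>\<^sub>2 * snd \<tau>) - \<sigma>\<^sub>1 * (a * fst \<tau> + b * snd \<tau>)"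
    by (simp_all add: algebra_simps)
  then have "(a * \<sigma>\<^sub>2 - b * \<sigma>\<^sub>1) * fst \<tau> = 0" "(a * \<sigma>\<^sub>2 - b * \<sigma>\<^sub>1) * snd \<tau> = 0"
    unfolding \<rho>\<tau> \<sigma>(3) by simp_all
  then have "a * \<sigma>\<^sub>2 = b * \<sigma>\<^sub>1" using \<tau>0 by (auto simp: prod_eq_iff)
  then have "(a * \<sigma>\<^sub>1) * \<sigma>\<^sub>2 = b * (\<sigma>\<^sub>1 * \<sigma>\<^sub>1)" by (simp add: ac_simps)
  then have ab: "(a * \<sigma>\<^sub>1) * \<sigma>\<^sub>1 = a" "(a * \<sigma>\<^sub>1) * \<sigma>\<^sub>2 = b"
    unfolding \<sigma>(1) by (simp_all add: mult.assoc \<sigma>(1))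
  have abs_p: "\<sigma>\<^sub>1 * fst p = \<bar>fst p\<bar>" "\<sigma>\<^sub>2 * snd p = \<bar>snd p\<bar>" by (auto simp: \<sigma>\<^sub>1_def \<sigma>\<^sub>2_def sgn_if)
  have "(a * \<sigma>\<^sub>1) * (\<sigma>\<^sub>1 * fst p + \<sigma>\<^sub>2 * snd p) = 1"
    using \<rho>p unfolding \<rho> distrib_left mult.assoc[symmetric] ab .
  then have "a * \<sigma>\<^sub>1 = 1" using p1 by (simp add: abs_p)
  then have ab': "a = \<sigma>\<^sub>1" "b = \<sigma>\<^sub>2" using ab by simp_all
  define s\<^sub>1 s\<^sub>2 :: int where "s\<^sub>1 = sgn (if fst p > 0 then 1 else - 1)" and "s\<^sub>2 = sgn (if snd p > 0 then 1 else - 1)"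
  have s: "s\<^sub>1 \<in> {1, - 1}" "s\<^sub>2 \<in> {1, - 1}" "of_int s\<^sub>1 = a" "of_int s\<^sub>2 = b"
    using nz by (auto simp: s\<^sub>1_def s\<^sub>2_def ab' \<sigma>\<^sub>1_def \<sigma>\<^sub>2_def sgn_if)
  have "\<rho> x = l1_norm x \<longleftrightarrow> 0 \<le> of_int s\<^sub>1 * fst x \<and> 0 \<le> of_int s\<^sub>2 * snd x" for x
    using s(1,2) unfolding \<rho> s(3,4)[symmetric] l1_norm_def by (auto simp: abs_if split: if_splits)
  then have "tangent_directions \<rho> = quadrant s\<^sub>1 s\<^sub>2"
    unfolding tangent_directions_def quadrant_def by auto
  then show ?thesis using that s(1,2) by blast
qed

section \<open>Arithmetic of the adding machine\<close>

definition digit_value :: "5 \<Rightarrow> int" where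
  "digit_value = Rep_bit1"

lemma digit_value_bounds: "0 \<le> digit_value x" "digit_value x \<le> 4"
  using Rep_bit1[of x] by (simp_all add: digit_value_def)

lemma digit_value_eq_iff: "digit_value x = digit_value y \<longleftrightarrow> x = y"
  by (simp add: digit_value_def bit1.Rep_inject_sym)

lemma digit_value_numeral: "digit_value 0 = 0" "digit_value 1 = 1" "digit_value (numeral w) = numeral w mod 5"
  by (simp_all add: digit_value_def bit1.Rep_0 bit1.Rep_1 bit1.Rep_numeral)

lemma digit_value_add_1: "digit_value (x + 1) = (digit_value x + 1) mod 5"
  unfolding digit_value_def bit1.add_def bit1.Rep_1 bit1.Rep_Abs_mod by simp

lemma digit_add_1_eq_0: "x + 1 = 0 \<longleftrightarrow> digit_value x = 4"
proof -
  have "x + 1 = 0 \<longleftrightarrow> (digit_value x + 1) mod 5 = 0"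
    by (simp flip: digit_value_eq_iff add: digit_value_add_1 digit_value_numeral)
  then show ?thesis using digit_value_bounds[of x] by presburger
qed

text \<open>The 5-adic integer with these digits, reduced modulo \<open>5 ^ i\<close>. In these
  terms the adding machine is addition of 1, and powers of it are translations.\<close>

definition prefix_value :: "nat \<Rightarrow> digits \<Rightarrow> int" where
  "prefix_value i \<omega> = (\<Sum>k<i. digit_value (\<omega> k) * 5 ^ k)"

lemma prefix_value_simps [simp]:
  "prefix_value 0 \<omega> = 0"
  "prefix_value (Suc i) \<omega> = prefix_value i \<omega> + digit_value (\<omega> i) * 5 ^ i"
  by (simp_all add: prefix_value_def)

lemma prefix_value_bounds: "0 \<le> prefix_value i \<omega>" "prefix_value i \<omega> < 5 ^ i"
proof -
  have "0 \<le> prefix_value i \<omega> \<and> prefix_value i \<omega> < 5 ^ i"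
  proof (induction i)
    case (Suc i)
    have "digit_value (\<omega> i) * 5 ^ i \<le> 4 * 5 ^ i" "0 \<le> digit_value (\<omega> i) * 5 ^ i"
      using digit_value_bounds[of "\<omega> i"] by auto
    then show ?case using Suc unfolding prefix_value_simps power_Suc by linarith
  qed simp
  then show "0 \<le> prefix_value i \<omega>" "prefix_value i \<omega> < 5 ^ i" by auto
qed

lemma prefix_value_eq_0_iff: "prefix_value i \<omega> = 0 \<longleftrightarrow> (\<forall>k<i. \<omega> k = 0)"
proof -
  have "0 \<le> digit_value (\<omega> k) * 5 ^ k" for k using digit_value_bounds by simp
  then have "prefix_value i \<omega> = 0 \<longleftrightarrow> (\<forall>k<i. digit_value (\<omega> k) = digit_value 0)"
    unfolding prefix_value_def by (subst sum_nonneg_eq_0_iff) (auto simp: digit_value_numeral)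
  then show ?thesis by (simp add: digit_value_eq_iff)
qed

lemma prefix_value_eq_max_iff: "prefix_value i \<omega> = 5 ^ i - 1 \<longleftrightarrow> (\<forall>k<i. \<omega> k + 1 = 0)"
proof (induction i)
  case (Suc i)
  have "prefix_value (Suc i) \<omega> = 5 ^ Suc i - 1 \<longleftrightarrow> prefix_value i \<omega> = 5 ^ i - 1 \<and> digit_value (\<omega> i) = 4"
  proof
    assume *: "prefix_value (Suc i) \<omega> = 5 ^ Suc i - 1"
    have "digit_value (\<omega> i) = 4"
    proof (rule ccontr)
      assume "digit_value (\<omega> i) \<noteq> 4"
      then have "digit_value (\<omega> i) \<le> 3" using digit_value_bounds[of "\<omega> i"] by simp
      then have "digit_value (\<omega> i) * 5 ^ i \<le> 3 * 5 ^ i" by simp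
      then show False
        using * prefix_value_bounds[of i \<omega>] unfolding prefix_value_simps power_Suc by linarith
    qed
    with * show "prefix_value i \<omega> = 5 ^ i - 1 \<and> digit_value (\<omega> i) = 4" by simp
  qed simp
  then show ?case using Suc by (auto simp: less_Suc_eq digit_add_1_eq_0)
qed simp

text \<open>Digit \<open>i\<close> receives a carry exactly when the lower digits are all 4, that
  is, when their prefix value is maximal and wraps around to 0.\<close>

lemma prefix_value_adding_machine:
  "prefix_value i (adding_machine \<omega>) = (prefix_value i \<omega> + 1) mod 5 ^ i"
proof (induction i)
  case (Suc i)
  show ?case
  proof (cases "\<forall>k<i. \<omega> k + 1 = 0")
    case True
    then have "prefix_value i \<omega> = 5 ^ i - 1" using prefix_value_eq_max_iff by blast
    moreover from this have "prefix_value i (adding_machine \<omega>) = 0" using Suc by simp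
    moreover have "adding_machine \<omega> i = \<omega> i + 1" using True by (simp add: adding_machine_def)
    moreover have "(5 ^ i - 1 + digit_value (\<omega> i) * 5 ^ i + 1) mod 5 ^ Suc i
        = ((digit_value (\<omega> i) + 1) * 5 ^ i) mod (5 * 5 ^ i)"
      by (simp add: algebra_simps)
    ultimately show ?thesis by (simp add: digit_value_add_1 mult_mod_left)
  next
    case False
    then have "prefix_value i \<omega> \<noteq> 5 ^ i - 1" using prefix_value_eq_max_iff by blast
    then have less: "prefix_value i \<omega> + 1 < 5 ^ i" using prefix_value_bounds[of i \<omega>] by linarith
    then have "prefix_value i (adding_machine \<omega>) = prefix_value i \<omega> + 1"
      using Suc prefix_value_bounds[of i \<omega>] by simp
    moreover have "adding_machine \<omega> i = \<omega> i" using False by (auto simp: adding_machine_def)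
    moreover have "0 \<le> digit_value (\<omega> i) * 5 ^ i" "digit_value (\<omega> i) * 5 ^ i \<le> 4 * 5 ^ i"
      using digit_value_bounds[of "\<omega> i"] by auto
    then have "(prefix_value i \<omega> + digit_value (\<omega> i) * 5 ^ i + 1) mod 5 ^ Suc i
        = prefix_value i \<omega> + digit_value (\<omega> i) * 5 ^ i + 1"
      using less prefix_value_bounds[of i \<omega>]
      unfolding power_Suc by (intro mod_pos_pos_trivial) linarith+
    ultimately show ?thesis by simp
  qed
qed simp

lemma prefix_value_power:
  "prefix_value i (adding_machine_power z \<omega>) = (prefix_value i \<omega> + z) mod 5 ^ i"
proof -
  have triv: "prefix_value i \<omega> mod 5 ^ i = prefix_value i \<omega>" for \<omega>
    using prefix_value_bounds[of i \<omega>] by simp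
  have fwd: "prefix_value i ((adding_machine ^^ n) \<omega>) = (prefix_value i \<omega> + int n) mod 5 ^ i" for n
    by (induction n) (simp_all add: triv prefix_value_adding_machine mod_simps ac_simps)
  have inv: "prefix_value i (inv adding_machine \<omega>) = (prefix_value i \<omega> - 1) mod 5 ^ i" for \<omega>
  proof -
    let ?\<omega> = "inv adding_machine \<omega>"
    have "adding_machine ?\<omega> = \<omega>" by (simp add: inv_adding_machine adding_machine_inv_right)
    then have "prefix_value i \<omega> = (prefix_value i ?\<omega> + 1) mod 5 ^ i"
      using prefix_value_adding_machine[of i ?\<omega>] by simp
    then have "(prefix_value i \<omega> - 1) mod 5 ^ i = (prefix_value i ?\<omega> + 1 - 1) mod 5 ^ i"
      by (simp only: mod_diff_left_eq)
    then show ?thesis by (simp add: triv)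
  qed
  have bwd: "prefix_value i ((inv adding_machine ^^ n) \<omega>) = (prefix_value i \<omega> - int n) mod 5 ^ i" for n
  proof (induction n)
    case (Suc n)
    then have "prefix_value i ((inv adding_machine ^^ Suc n) \<omega>) = ((prefix_value i \<omega> - int n) mod 5 ^ i - 1) mod 5 ^ i"
      by (simp add: inv)
    also have "\<dots> = (prefix_value i \<omega> - int n - 1) mod 5 ^ i" by (simp only: mod_diff_left_eq)
    finally show ?case by (simp add: algebra_simps)
  qed (simp add: triv)
  show ?thesis
    using fwd[of "nat z"] bwd[of "nat (- z)"] by (simp add: adding_machine_power_def)
qed

definition line_class :: "digits \<Rightarrow> int \<Rightarrow> nat" where
  "line_class \<omega> z = first_nonzero (adding_machine_power z \<omega>)"

text \<open>Rules out the sequences whose orbit contains the zero sequence.\<close>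

definition generic :: "digits \<Rightarrow> bool" where
  "generic \<omega> \<longleftrightarrow> (\<forall>N. \<exists>j\<ge>N. \<omega> j = 2)"

lemma prefix_value_middle:
  assumes "\<omega> j = 2"
  shows "2 * 5 ^ j \<le> prefix_value (Suc j) \<omega>" "prefix_value (Suc j) \<omega> < 3 * 5 ^ j"
  using prefix_value_bounds[of j \<omega>] assms by (simp_all add: digit_value_numeral)

text \<open>A class at least \<open>i\<close> means that the first \<open>i\<close> shifted digits
  vanish, that is, prefix value plus \<open>z\<close> is divisible by \<open>5 ^ i\<close>.
  Genericity ensures that some shifted digit is nonzero, so that the \<open>LEAST\<close> in
  \<open>first_nonzero\<close> is attained.\<close>

lemma line_class_ge_iff:
  assumes "generic \<omega>"
  shows "i \<le> line_class \<omega> z \<longleftrightarrow> 5 ^ i dvd z - (- prefix_value i \<omega>)"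
proof -
  let ?\<eta> = "adding_machine_power z \<omega>"
  obtain j where j: "j \<ge> nat \<bar>z\<bar>" "\<omega> j = 2" using assms unfolding generic_def by blast
  have "int j < int (5 ^ j)" using power_gt_expt[of 5 j] by (simp only: of_nat_less_iff)
  then have "int j < 5 ^ j" by (simp only: of_nat_power of_nat_numeral)
  then have z: "\<bar>z\<bar> < 5 ^ j" using j(1) by linarith
  define P where "P = prefix_value (Suc j) \<omega>"
  \<comment> \<open>A digit 2 at a place \<open>j\<close> with \<open>5 ^ j > \<bar>z\<bar>\<close>
    keeps the translate strictly between 0 and \<open>5 ^ Suc j\<close>, so no wrap-around can make
    it vanish.\<close>
  have P: "0 < P + z" "P + z < 5 ^ Suc j"
    using prefix_value_middle[of \<omega> j, OF j(2)] z unfolding P_def power_Suc by linarith+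
  have "prefix_value (Suc j) ?\<eta> = (P + z) mod 5 ^ Suc j"
    unfolding P_def by (rule prefix_value_power)
  also have "\<dots> = P + z" using P by (intro mod_pos_pos_trivial less_imp_le)
  finally have "prefix_value (Suc j) ?\<eta> \<noteq> 0" using P(1) by linarith
  then have ex: "\<exists>k. ?\<eta> k \<noteq> 0" using prefix_value_eq_0_iff[of "Suc j" ?\<eta>] by blast
  have "i \<le> line_class \<omega> z \<longleftrightarrow> (\<forall>k<i. ?\<eta> k = 0)"
  proof
    assume "i \<le> line_class \<omega> z"
    show "\<forall>k<i. ?\<eta> k = 0"
    proof (intro allI impI)
      fix k assume "k < i"
      then have "k < (LEAST i. ?\<eta> i \<noteq> 0)"
        using \<open>i \<le> line_class \<omega> z\<close> unfolding line_class_def first_nonzero_def by (rule less_le_trans)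
      from not_less_Least[OF this] show "?\<eta> k = 0" by simp
    qed
  next
    assume *: "\<forall>k<i. ?\<eta> k = 0"
    have "?\<eta> (line_class \<omega> z) \<noteq> 0"
      unfolding line_class_def first_nonzero_def using LeastI_ex[OF ex] .
    then show "i \<le> line_class \<omega> z" using * not_le by blast
  qed
  also have "\<dots> \<longleftrightarrow> (prefix_value i \<omega> + z) mod 5 ^ i = 0"
    by (simp add: prefix_value_power flip: prefix_value_eq_0_iff)
  finally show ?thesis by (simp add: dvd_eq_mod_eq_0 add.commute)
qed

section \<open>Digit patterns that produce good scales\<close>

lemma prefix_value_block_4:
  assumes "\<And>k. k < m \<Longrightarrow> \<omega> (j + k) = 4"
  shows "prefix_value (j + m) \<omega> = prefix_value j \<omega> + 5 ^ (j + m) - 5 ^ j"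
  using assms by (induction m) (simp_all add: digit_value_numeral power_add)

lemma prefix_value_block_0:
  assumes "\<And>k. k < m \<Longrightarrow> \<omega> (j + k) = 0"
  shows "prefix_value (j + m) \<omega> = prefix_value j \<omega>"
  using assms by (induction m) (simp_all add: digit_value_numeral)

text \<open>A block of 4s leaves the prefix at most \<open>5 ^ j\<close> below a multiple of the
  spacing, which puts a fast line just on the positive side; a block of 0s does the same on the
  negative side. The middle digit 2 puts the nearest lines of the other family at 2 to 3 times
  \<open>5 ^ (j + m)\<close> on both sides, so it serves every reflection.\<close>

definition favourable_digits :: "5 \<Rightarrow> nat \<Rightarrow> nat \<Rightarrow> digits \<Rightarrow> digits \<Rightarrow> bool" where
  "favourable_digits d j m \<omega> \<eta> \<longleftrightarrow> (\<forall>k\<le>m. \<omega> (j + k) = d) \<and> \<eta> (j + m) = 2"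

lemma good_scale_line_class:
  assumes gen: "generic \<omega>" "generic \<eta>" and s: "s \<in> {1, - 1}" "s' \<in> {1, - 1}"
    and sf: "favourable_digits (if s = 1 then 4 else 0) j m \<omega> \<eta>"
  shows "good_scale (\<lambda>y. line_class \<omega> (s * y)) (\<lambda>x. line_class \<eta> (s' * x)) j m"
proof -
  define M where "M = Suc (j + m)"
  \<comment> \<open>Lines of class at least \<open>M\<close> are the integers congruent to minus the
    prefix value; \<open>Y\<close> and \<open>A\<close> are the distances to the first of them in
    the directions given by the signs.\<close>
  define Y where "Y = (if s = 1 then 5 ^ M - prefix_value M \<omega> else prefix_value M \<omega>)"
  define A where "A = (if s' = 1 then 5 ^ M - prefix_value M \<eta> else prefix_value M \<eta>)"
  have M: "M = j + Suc m" by (simp add: M_def)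
  have dvd: "5 ^ M dvd \<epsilon> * (if \<epsilon> = 1 then 5 ^ M - z else z) - (- z)" if "\<epsilon> \<in> {1, - 1}" for \<epsilon> z :: int
    using that by auto
  have "0 \<le> Y \<and> Y \<le> 5 ^ j"
  proof (cases "s = 1")
    case True
    then have "prefix_value M \<omega> = prefix_value j \<omega> + 5 ^ M - 5 ^ j"
      unfolding M using sf by (intro prefix_value_block_4) (auto simp: favourable_digits_def less_Suc_eq_le)
    then show ?thesis using True prefix_value_bounds[of j \<omega>] by (simp add: Y_def)
  next
    case False
    then have "prefix_value M \<omega> = prefix_value j \<omega>"
      unfolding M using sf by (intro prefix_value_block_0) (auto simp: favourable_digits_def less_Suc_eq_le)
    then show ?thesis using False prefix_value_bounds[of j \<omega>] by (simp add: Y_def)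
  qed
  moreover have "2 * 5 ^ (j + m) \<le> A \<and> A \<le> 3 * 5 ^ (j + m)"
  proof -
    have "\<eta> (j + m) = 2" using sf by (simp add: favourable_digits_def)
    from prefix_value_middle[of \<eta> "j + m", OF this] have "2 * 5 ^ (j + m) \<le> prefix_value M \<eta>" "prefix_value M \<eta> < 3 * 5 ^ (j + m)"
      unfolding M_def .
    moreover have "(5 :: int) ^ M = 5 * 5 ^ (j + m)" by (simp add: M_def)
    ultimately show ?thesis unfolding A_def by auto
  qed
  moreover have "M \<le> line_class \<omega> (s * Y)" "M \<le> line_class \<eta> (s' * A)"
    unfolding line_class_ge_iff[OF gen(1)] line_class_ge_iff[OF gen(2)] Y_def A_def
    by (rule dvd[OF s(1)], rule dvd[OF s(2)])
  moreover have "M = j + m + 1" by (simp add: M_def)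
  ultimately show ?thesis unfolding good_scale_def by blast
qed

section \<open>Almost sure properties of the digits\<close>

lemma prob_cylinder:
  assumes "finite L"
  shows "measure digits_measure {\<omega>. \<forall>k\<in>L. \<omega> k = d} = (1 / 5) ^ card L"
proof -
  let ?U = "uniform_count_measure (UNIV :: 5 set)"
  interpret prob_space ?U by (rule prob_space_uniform_count_measure) auto
  interpret product_prob_space "\<lambda>_::nat. ?U" UNIV ..
  have "emeasure ?U {d} = ennreal (1 / 5)"
    by (subst emeasure_uniform_count_measure) auto
  then have "(\<Prod>k\<in>L. emeasure ?U {d}) = ennreal ((1 / 5) ^ card L)"
    by (simp only: prod_constant) (simp add: ennreal_power)
  moreover have "emeasure (PiM UNIV (\<lambda>_. ?U)) {\<omega>\<in>space (PiM UNIV (\<lambda>_. ?U)). \<forall>k\<in>L. \<omega> k \<in> {d}} = (\<Prod>k\<in>L. emeasure ?U {d})"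
    using assms by (intro emeasure_PiM_Collect) (auto simp: sets_uniform_count_measure)
  ultimately have "emeasure digits_measure {\<omega>. \<forall>k\<in>L. \<omega> k = d} = ennreal ((1 / 5) ^ card L)"
    using space_digits_measure by (simp add: digits_measure_def)
  then show ?thesis by (simp add: measure_eq_emeasure_eq_ennreal)
qed

lemma sets_digits_measureI:
  "Measurable.pred digits_measure P \<Longrightarrow> {\<omega>. P \<omega>} \<in> sets digits_measure"
  by (simp add: pred_def)

text \<open>Independence of disjoint blocks, derived from cylinder probabilities alone. The further
  prescribed digits \<open>L\<close> make the induction work: avoiding one more block means
  subtracting the same kind of event with that block added to \<open>L\<close>.\<close>

lemma prob_avoid_blocks:
  fixes f :: "nat \<Rightarrow> nat"
  assumes f: "\<And>i. f i + m < f (Suc i)" and "finite L" "\<And>i k. i < n \<Longrightarrow> k \<in> L \<Longrightarrow> f i + m < k"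
  shows "measure digits_measure {\<omega>. (\<forall>i<n. \<not> (\<forall>k\<le>m. \<omega> (f i + k) = d)) \<and> (\<forall>k\<in>L. \<omega> k = d)}
    = (1 - (1 / 5) ^ Suc m) ^ n * (1 / 5) ^ card L"
  using assms(2,3)
proof (induction n arbitrary: L)
  case 0
  then show ?case by (simp add: prob_cylinder)
next
  case (Suc n)
  interpret prob_space digits_measure by (rule prob_space_digits_measure)
  define S where "S n L = {\<omega> :: digits. (\<forall>i<n. \<not> (\<forall>k\<le>m. \<omega> (f i + k) = d)) \<and> (\<forall>k\<in>L. \<omega> k = d)}" for n L
  let ?B = "(\<lambda>k. f n + k) ` {..m}"
  have S: "S n L \<in> sets digits_measure" for n L
    unfolding S_def by (rule sets_digits_measureI) measurable
  have cardB: "card (L \<union> ?B) = card L + Suc m"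
  proof -
    have "card ?B = Suc m" by (subst card_image) auto
    moreover have "L \<inter> ?B = {}" using Suc.prems(2)[of n] by fastforce
    ultimately show ?thesis using Suc.prems(1) by (simp add: card_Un_disjoint)
  qed
  have mono: "f i + m < f n" if "i < n" for i
    using that
  proof (induction n)
    case (Suc n)
    then show ?case using f[of n] f[of i] by (cases "i = n") auto
  qed simp
  have "S (Suc n) L = S n L - S n (L \<union> ?B)"
    unfolding S_def by (auto simp: less_Suc_eq)
  moreover have "S n (L \<union> ?B) \<subseteq> S n L" unfolding S_def by auto
  ultimately have "measure digits_measure (S (Suc n) L) = measure digits_measure (S n L) - measure digits_measure (S n (L \<union> ?B))"
    using S by (simp add: finite_measure_Diff)
  also have "measure digits_measure (S n L) = (1 - (1 / 5) ^ Suc m) ^ n * (1 / 5) ^ card L"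
    unfolding S_def by (rule Suc.IH) (use Suc.prems in auto)
  also have "measure digits_measure (S n (L \<union> ?B)) = (1 - (1 / 5) ^ Suc m) ^ n * (1 / 5) ^ card (L \<union> ?B)"
    unfolding S_def
  proof (rule Suc.IH)
    fix i k assume "i < n" "k \<in> L \<union> ?B"
    then show "f i + m < k" using Suc.prems(2)[of i k] mono[of i] by auto
  qed (use Suc.prems in auto)
  finally show ?case unfolding S_def[symmetric] cardB by (simp add: power_add algebra_simps)
qed

text \<open>Infinitely many disjoint blocks start in \<open>J\<close>, and the probability of
  missing the first \<open>n\<close> of them tends to 0 geometrically.\<close>

lemma AE_block:
  assumes "infinite J"
  shows "AE \<omega> in digits_measure. \<exists>j\<in>J. \<forall>k\<le>m. \<omega> (j + k) = d"
proof -
  interpret prob_space digits_measure by (rule prob_space_digits_measure)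
  have "\<exists>f. \<forall>i. f i \<in> J \<and> f i + m < f (Suc i)"
  proof (rule dependent_nat_choice)
    show "\<exists>x. x \<in> J" using assms infinite_imp_nonempty by blast
    show "\<exists>y. y \<in> J \<and> x + m < y" for x and i :: nat
      using assms unfolding infinite_nat_iff_unbounded by blast
  qed
  then obtain f where f: "\<And>i. f i \<in> J" "\<And>i. f i + m < f (Suc i)" by blast
  define q :: real where "q = 1 - (1 / 5) ^ Suc m"
  have q: "0 \<le> q" "q < 1"
    using power_le_one[of "1 / 5 :: real" "Suc m"] by (auto simp: q_def simp del: power_Suc)
  define N where "N = {\<omega> :: digits. \<forall>i. \<not> (\<forall>k\<le>m. \<omega> (f i + k) = d)}"
  have N: "N \<in> sets digits_measure" unfolding N_def by (rule sets_digits_measureI) measurable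
  have "prob N \<le> q ^ n" for n
  proof -
    let ?S = "{\<omega>. (\<forall>i<n. \<not> (\<forall>k\<le>m. \<omega> (f i + k) = d)) \<and> (\<forall>k\<in>{}. \<omega> k = d)}"
    have "?S \<in> sets digits_measure" by (rule sets_digits_measureI) measurable
    then have "prob N \<le> prob ?S" by (intro finite_measure_mono) (auto simp: N_def)
    also have "\<dots> = q ^ n" by (subst prob_avoid_blocks[of f m "{}" n d, OF f(2)]) (auto simp: q_def)
    finally show ?thesis .
  qed
  then have "prob N \<le> 0"
    using LIMSEQ_le_const[OF LIMSEQ_power_zero[of q]] q by auto
  then have "emeasure digits_measure N = 0" by (simp add: emeasure_eq_measure measure_le_0_iff)
  then show ?thesis
    by (rule AE_I[rotated]) (use f(1) N in \<open>auto simp: N_def\<close>)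
qed

lemma AE_blocks:
  assumes "infinite J"
  shows "AE \<omega> in digits_measure. \<forall>N. \<exists>j\<in>J. N \<le> j \<and> (\<forall>k\<le>m. \<omega> (j + k) = d)"
  unfolding AE_all_countable
proof
  fix N
  have "J - {..<N} \<subseteq> J \<inter> {N..}" by auto
  then have "infinite (J \<inter> {N..})" using assms by (meson finite_Diff2 finite_lessThan finite_subset)
  from AE_block[OF this] show "AE \<omega> in digits_measure. \<exists>j\<in>J. N \<le> j \<and> (\<forall>k\<le>m. \<omega> (j + k) = d)"
    by (rule AE_mp) (auto intro!: AE_I2)
qed

lemma AE_generic: "AE \<omega> in digits_measure. generic \<omega>"
  using AE_blocks[of UNIV 0 2] unfolding generic_def by simp

definition good_digits :: "digits \<Rightarrow> digits \<Rightarrow> bool" where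
  "good_digits \<omega> \<eta> \<longleftrightarrow> generic \<omega> \<and> generic \<eta> \<and>
     (\<forall>d m N. (\<exists>j\<ge>N. favourable_digits d j m \<omega> \<eta>) \<and> (\<exists>j\<ge>N. favourable_digits d j m \<eta> \<omega>))"

lemma measurable_digit_fst [measurable]:
  "(\<lambda>z. fst z i) \<in> digits_measure \<Otimes>\<^sub>M digits_measure \<rightarrow>\<^sub>M count_space UNIV"
  by (rule measurable_compose[OF measurable_fst measurable_digit])

lemma measurable_digit_snd [measurable]:
  "(\<lambda>z. snd z i) \<in> digits_measure \<Otimes>\<^sub>M digits_measure \<rightarrow>\<^sub>M count_space UNIV"
  by (rule measurable_compose[OF measurable_snd measurable_digit])

lemma AE_infinite_block: "AE \<omega> in digits_measure. infinite {j. \<forall>k\<le>m. \<omega> (j + k) = d}"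
  using AE_blocks[of UNIV m d]
  by (rule AE_mp) (auto intro!: AE_I2 simp: infinite_nat_iff_unbounded_le)

lemma AE_infinite_digit: "AE \<omega> in digits_measure. infinite {j. \<omega> (j + m) = d}"
proof -
  have "AE \<omega> in digits_measure. \<forall>N. \<exists>j. N \<le> j \<and> \<omega> j = d" using AE_blocks[of UNIV 0 d] by simp
  then show ?thesis
  proof (rule eventually_mono)
    fix \<omega> :: digits assume *: "\<forall>N. \<exists>j. N \<le> j \<and> \<omega> j = d"
    show "infinite {j. \<omega> (j + m) = d}"
      unfolding infinite_nat_iff_unbounded_le
    proof
      fix N
      obtain j where "N + m \<le> j" "\<omega> j = d" using * by blast
      then show "\<exists>n\<ge>N. n \<in> {j. \<omega> (j + m) = d}" by (intro exI[of _ "j - m"]) auto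
    qed
  qed
qed

text \<open>Fubini: for a fixed typical first sequence the admissible positions form an infinite
  set, and the second sequence is searched along that set. Either sequence may supply the block,
  which yields scales for rows and for columns.\<close>

lemma AE_good_digits: "AE z in digits_measure \<Otimes>\<^sub>M digits_measure. good_digits (fst z) (snd z)"
proof -
  interpret D: prob_space digits_measure by (rule prob_space_digits_measure)
  interpret pair_sigma_finite digits_measure digits_measure ..
  have meas: "Measurable.pred (digits_measure \<Otimes>\<^sub>M digits_measure) (\<lambda>z. good_digits (fst z) (snd z))"
    unfolding good_digits_def generic_def favourable_digits_def by measurable
  have "AE \<omega> in digits_measure. generic \<omega> \<and> (\<forall>d m. infinite {j. \<forall>k\<le>m. \<omega> (j + k) = d}) \<and>
      (\<forall>m. infinite {j. \<omega> (j + m) = 2})"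
    by (intro AE_conjI AE_generic) (simp_all add: AE_all_countable AE_infinite_block AE_infinite_digit)
  then have "AE \<omega> in digits_measure. AE \<eta> in digits_measure. good_digits \<omega> \<eta>"
  proof (rule eventually_mono)
    fix \<omega> assume \<omega>: "generic \<omega> \<and> (\<forall>d m. infinite {j. \<forall>k\<le>m. \<omega> (j + k) = d}) \<and>
      (\<forall>m. infinite {j. \<omega> (j + m) = 2})"
    have 1: "AE \<eta> in digits_measure. \<forall>N. \<exists>j\<ge>N. favourable_digits d j m \<omega> \<eta>" for d m
    proof -
      have "infinite ((\<lambda>j. j + m) ` {j. \<forall>k\<le>m. \<omega> (j + k) = d})"
        using \<omega> by (simp add: finite_image_iff)
      from AE_blocks[OF this, of 0 2] show ?thesis
      proof (rule eventually_mono)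
        fix \<eta> :: digits
        assume *: "\<forall>N. \<exists>j\<in>(\<lambda>j. j + m) ` {j. \<forall>k\<le>m. \<omega> (j + k) = d}. N \<le> j \<and> (\<forall>k\<le>0. \<eta> (j + k) = 2)"
        show "\<forall>N. \<exists>j\<ge>N. favourable_digits d j m \<omega> \<eta>"
        proof
          fix N
          obtain j where "N + m \<le> j + m" "\<forall>k\<le>m. \<omega> (j + k) = d" "\<eta> (j + m) = 2"
            using *[rule_format, of "N + m"] by auto
          then show "\<exists>j\<ge>N. favourable_digits d j m \<omega> \<eta>" by (auto simp: favourable_digits_def)
        qed
      qed
    qed
    have 2: "AE \<eta> in digits_measure. \<forall>N. \<exists>j\<ge>N. favourable_digits d j m \<eta> \<omega>" for d m
    proof -
      have "infinite {j. \<omega> (j + m) = 2}" using \<omega> by blast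
      from AE_blocks[OF this, of m d] show ?thesis
        by (rule AE_mp) (auto intro!: AE_I2 simp: favourable_digits_def)
    qed
    have "AE \<eta> in digits_measure. generic \<eta> \<and> (\<forall>d m. \<forall>N. \<exists>j\<ge>N. favourable_digits d j m \<omega> \<eta>) \<and>
        (\<forall>d m. \<forall>N. \<exists>j\<ge>N. favourable_digits d j m \<eta> \<omega>)"
      by (intro AE_conjI AE_generic) (use 1 2 in \<open>simp_all add: AE_all_countable\<close>)
    then show "AE \<eta> in digits_measure. good_digits \<omega> \<eta>"
      by (rule AE_mp) (use \<omega> in \<open>auto intro!: AE_I2 simp: good_digits_def\<close>)
  qed
  then show ?thesis
    using meas by (intro AE_pair_measure) (auto simp: pred_def)
qed

text \<open>Edges are spelled out by integer coordinates so that the quantifiers range over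
  countable types.\<close>

lemma AE_noise:
  assumes "0 < \<alpha>" "\<alpha> < 1"
  shows "AE X in noise_measure \<alpha>. \<forall>j x y. X (j, Hor (x, y)) \<in> {0..\<alpha> ^ j * (1 - \<alpha>) / 1000} \<and>
    X (j, Ver (x, y)) \<in> {0..\<alpha> ^ j * (1 - \<alpha>) / 1000}"
proof -
  have "AE X in noise_measure \<alpha>. X (j, e) \<in> {0..\<alpha> ^ j * (1 - \<alpha>) / 1000}" for j e
  proof -
    let ?M = "\<lambda>(j, e :: edge). uniform_measure lborel {0..\<alpha> ^ j * (1 - \<alpha>) / 1000}"
    have "AE x in ?M (j, e). x \<in> {0..\<alpha> ^ j * (1 - \<alpha>) / 1000}"
      by (auto intro: AE_uniform_measureI)
    then show ?thesis
      unfolding noise_measure_def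
      by (rule AE_PiM_component[rotated 2]) (use assms in \<open>auto intro!: prob_space_uniform_measure\<close>)
  qed
  then show ?thesis by (simp add: AE_all_countable AE_conj_iff del: atLeastAtMost_iff)
qed

section \<open>Good environments are almost sure\<close>

definition row_class_of :: "real \<Rightarrow> (edge \<Rightarrow> real) \<Rightarrow> int \<Rightarrow> nat" where
  "row_class_of \<alpha> t y = (LEAST k. 1 + \<alpha> ^ k \<le> t (Hor (0, y)))"

definition col_class_of :: "real \<Rightarrow> (edge \<Rightarrow> real) \<Rightarrow> int \<Rightarrow> nat" where
  "col_class_of \<alpha> t x = (LEAST k. 1 + \<alpha> ^ k \<le> t (Ver (x, 0)))"

text \<open>The law \<open>fpp_law\<close> forgets the digits, but the classes can be read off the passage times; this makes
  the event measurable.\<close>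

definition good_times :: "real \<Rightarrow> (edge \<Rightarrow> real) \<Rightarrow> bool" where
  "good_times \<alpha> t \<longleftrightarrow>
    (\<forall>x y. 1 + \<alpha> ^ row_class_of \<alpha> t y \<le> t (Hor (x, y)) \<and>
      t (Hor (x, y)) \<le> 1 + 1.001 * \<alpha> ^ row_class_of \<alpha> t y \<and>
      1 + \<alpha> ^ col_class_of \<alpha> t x \<le> t (Ver (x, y)) \<and>
      t (Ver (x, y)) \<le> 1 + 1.001 * \<alpha> ^ col_class_of \<alpha> t x) \<and>
    (\<forall>i. \<exists>p. \<forall>y. i \<le> row_class_of \<alpha> t y \<longleftrightarrow> 5 ^ i dvd y - p) \<and>
    (\<forall>i. \<exists>q. \<forall>x. i \<le> col_class_of \<alpha> t x \<longleftrightarrow> 5 ^ i dvd x - q) \<and>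
    (\<forall>s\<^sub>1\<in>{1, - 1}. \<forall>s\<^sub>2\<in>{1, - 1}.
      good_scales (\<lambda>y. row_class_of \<alpha> t (s\<^sub>2 * y)) (\<lambda>x. col_class_of \<alpha> t (s\<^sub>1 * x)) \<and>
      good_scales (\<lambda>x. col_class_of \<alpha> t (s\<^sub>1 * x)) (\<lambda>y. row_class_of \<alpha> t (s\<^sub>2 * y)))"

lemma unique_ray_if_good_times:
  assumes "0 < \<alpha>" "5 * \<alpha> < 1" "good_times \<alpha> t" "s\<^sub>1 \<in> {1, - 1}" "s\<^sub>2 \<in> {1, - 1}"
  shows "unique_ray t (quadrant s\<^sub>1 s\<^sub>2)"
proof -
  obtain p q where pq: "\<And>i y. i \<le> row_class_of \<alpha> t y \<longleftrightarrow> 5 ^ i dvd y - p i"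
      "\<And>i x. i \<le> col_class_of \<alpha> t x \<longleftrightarrow> 5 ^ i dvd x - q i"
    using assms(3) unfolding good_times_def by metis
  interpret environment \<alpha> t "row_class_of \<alpha> t" "col_class_of \<alpha> t" p q
    by unfold_locales (use assms(1-3) pq in \<open>auto simp: good_times_def\<close>)
  show ?thesis
    using assms(3-5) by (intro unique_ray_quadrant) (auto simp: good_times_def)
qed

text \<open>Consecutive powers of \<alpha> differ by a factor above 5 while the noise adds at most a
  thousandth, so the ranges of different classes are disjoint.\<close>

lemma Least_class:
  fixes \<alpha> :: real
  assumes "0 < \<alpha>" "5 * \<alpha> < 1" "1 + \<alpha> ^ k \<le> z" "z \<le> 1 + 1.001 * \<alpha> ^ k"
  shows "(LEAST k. 1 + \<alpha> ^ k \<le> z) = k"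
proof (rule Least_equality)
  fix i assume i: "1 + \<alpha> ^ i \<le> z"
  show "k \<le> i"
  proof (rule ccontr)
    assume "\<not> k \<le> i"
    then have "\<alpha> ^ k \<le> \<alpha> ^ Suc i" using assms by (intro power_decreasing) auto
    moreover have "5 * \<alpha> * \<alpha> ^ i < 1 * \<alpha> ^ i" using assms by (intro mult_strict_right_mono) auto
    moreover have "0 < \<alpha> ^ k" using assms by simp
    ultimately show False using i assms(4) by simp
  qed
qed (use assms in auto)

lemma good_times_passage_times:
  assumes \<alpha>: "0 < \<alpha>" "5 * \<alpha> < 1" and dig: "good_digits \<omega> \<eta>"
    and X: "\<And>j x y. X (j, Hor (x, y)) \<in> {0..\<alpha> ^ j * (1 - \<alpha>) / 1000}"
      "\<And>j x y. X (j, Ver (x, y)) \<in> {0..\<alpha> ^ j * (1 - \<alpha>) / 1000}"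
  shows "good_times \<alpha> (passage_times \<alpha> ((\<omega>, \<eta>), X))"
proof -
  let ?t = "passage_times \<alpha> ((\<omega>, \<eta>), X)"
  have gen: "generic \<omega>" "generic \<eta>" using dig by (auto simp: good_digits_def)
  have noise: "0 \<le> z \<and> z \<le> 0.001 * \<alpha> ^ k" if "z \<in> {0..\<alpha> ^ k * (1 - \<alpha>) / 1000}" for z k
  proof -
    have "\<alpha> ^ k * (1 - \<alpha>) \<le> \<alpha> ^ k * 1" using \<alpha> by (intro mult_left_mono) auto
    then show ?thesis using that by auto
  qed
  have hor: "1 + \<alpha> ^ line_class \<omega> y \<le> ?t (Hor (x, y)) \<and> ?t (Hor (x, y)) \<le> 1 + 1.001 * \<alpha> ^ line_class \<omega> y" for x y
    using noise[OF X(1)[of "line_class \<omega> y" x y]] by (simp add: passage_times_def line_class_def)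
  have ver: "1 + \<alpha> ^ line_class \<eta> x \<le> ?t (Ver (x, y)) \<and> ?t (Ver (x, y)) \<le> 1 + 1.001 * \<alpha> ^ line_class \<eta> x" for x y
    using noise[OF X(2)[of "line_class \<eta> x" x y]] by (simp add: passage_times_def line_class_def)
  have r: "row_class_of \<alpha> ?t = line_class \<omega>"
    unfolding row_class_of_def using Least_class[OF \<alpha>] hor by blast
  have c: "col_class_of \<alpha> ?t = line_class \<eta>"
    unfolding col_class_of_def using Least_class[OF \<alpha>] ver by blast
  have scales: "good_scales (\<lambda>y. line_class \<omega> (s * y)) (\<lambda>x. line_class \<eta> (s' * x))"
      "good_scales (\<lambda>x. line_class \<eta> (s * x)) (\<lambda>y. line_class \<omega> (s' * y))"
    if s: "s \<in> {1, - 1}" "s' \<in> {1, - 1}" for s s'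
  proof -
    have "\<exists>j\<ge>N. favourable_digits (if s = 1 then 4 else 0) j m \<omega> \<eta>" "\<exists>j\<ge>N. favourable_digits (if s = 1 then 4 else 0) j m \<eta> \<omega>" for m N
      using dig unfolding good_digits_def by blast+
    then show "good_scales (\<lambda>y. line_class \<omega> (s * y)) (\<lambda>x. line_class \<eta> (s' * x))"
      "good_scales (\<lambda>x. line_class \<eta> (s * x)) (\<lambda>y. line_class \<omega> (s' * y))"
      unfolding good_scales_def using good_scale_line_class[OF gen s] good_scale_line_class[OF gen(2,1) s]
      by blast+
  qed
  show ?thesis
    unfolding good_times_def r c
  proof (intro conjI allI ballI)
    fix i
    show "\<exists>p. \<forall>y. i \<le> line_class \<omega> y \<longleftrightarrow> 5 ^ i dvd y - p"
      using line_class_ge_iff[OF gen(1)] by blast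
    show "\<exists>q. \<forall>x. i \<le> line_class \<eta> x \<longleftrightarrow> 5 ^ i dvd x - q"
      using line_class_ge_iff[OF gen(2)] by blast
  qed (use hor ver scales in blast)+
qed

lemma measurable_good_times: "Measurable.pred (PiM UNIV (\<lambda>_. borel)) (good_times \<alpha>)"
proof -
  let ?M = "PiM UNIV (\<lambda>_. borel) :: (edge \<Rightarrow> real) measure"
  have comp [measurable]: "(\<lambda>t. t e) \<in> borel_measurable ?M" for e
    by (rule measurable_component_singleton) simp
  have r [measurable]: "(\<lambda>t. row_class_of \<alpha> t y) \<in> ?M \<rightarrow>\<^sub>M count_space UNIV" for y
    unfolding row_class_of_def by measurable
  have c [measurable]: "(\<lambda>t. col_class_of \<alpha> t x) \<in> ?M \<rightarrow>\<^sub>M count_space UNIV" for x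
    unfolding col_class_of_def by measurable
  have [measurable]: "(\<lambda>t. \<alpha> ^ row_class_of \<alpha> t y) \<in> borel_measurable ?M" for y
    by (rule measurable_compose[OF r]) simp
  have [measurable]: "(\<lambda>t. \<alpha> ^ col_class_of \<alpha> t x) \<in> borel_measurable ?M" for x
    by (rule measurable_compose[OF c]) simp
  show ?thesis
    unfolding good_times_def good_scales_def good_scale_def by measurable
qed

lemma AE_good_times:
  assumes "0 < \<alpha>" "5 * \<alpha> < 1"
  shows "AE t in fpp_law \<alpha>. good_times \<alpha> t"
proof -
  interpret D: prob_space digits_measure by (rule prob_space_digits_measure)
  interpret DD: pair_prob_space digits_measure digits_measure ..
  interpret N: prob_space "noise_measure \<alpha>" using assms by (intro prob_space_noise_measure) auto
  interpret pair_sigma_finite "digits_measure \<Otimes>\<^sub>M digits_measure" "noise_measure \<alpha>" ..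
  have "{z \<in> space ((digits_measure \<Otimes>\<^sub>M digits_measure) \<Otimes>\<^sub>M noise_measure \<alpha>). good_times \<alpha> (passage_times \<alpha> z)}
      \<in> sets ((digits_measure \<Otimes>\<^sub>M digits_measure) \<Otimes>\<^sub>M noise_measure \<alpha>)"
    using measurable_compose[OF measurable_passage_times measurable_good_times] by (simp add: pred_def)
  moreover have "AE z in digits_measure \<Otimes>\<^sub>M digits_measure. AE X in noise_measure \<alpha>. good_times \<alpha> (passage_times \<alpha> (z, X))"
    using AE_good_digits
  proof (rule eventually_mono)
    fix z assume z: "good_digits (fst z) (snd z)"
    have "AE X in noise_measure \<alpha>. \<forall>j x y. X (j, Hor (x, y)) \<in> {0..\<alpha> ^ j * (1 - \<alpha>) / 1000} \<and>
        X (j, Ver (x, y)) \<in> {0..\<alpha> ^ j * (1 - \<alpha>) / 1000}"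
      using assms by (intro AE_noise) auto
    then show "AE X in noise_measure \<alpha>. good_times \<alpha> (passage_times \<alpha> (z, X))"
    proof (rule eventually_mono)
      fix X assume "\<forall>j x y. X (j, Hor (x, y)) \<in> {0..\<alpha> ^ j * (1 - \<alpha>) / 1000} \<and>
        X (j, Ver (x, y)) \<in> {0..\<alpha> ^ j * (1 - \<alpha>) / 1000}"
      then show "good_times \<alpha> (passage_times \<alpha> (z, X))"
        using good_times_passage_times[OF assms z, of X] by simp
    qed
  qed
  ultimately have "AE z in (digits_measure \<Otimes>\<^sub>M digits_measure) \<Otimes>\<^sub>M noise_measure \<alpha>. good_times \<alpha> (passage_times \<alpha> z)"
    by (rule AE_pair_measure)
  then show ?thesis
    unfolding fpp_law_def using measurable_good_times[of \<alpha>]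
    by (subst AE_distr_iff) (auto simp: pred_def)
qed

theorem theorem2:
  fixes \<alpha> :: real and \<rho> :: "real \<times> real \<Rightarrow> real"
  assumes "0 < \<alpha>" and "\<alpha> < 0.2"
    and "linear \<rho>" and "tangent_functional \<rho> l1_ball"
  shows "AE t in fpp_law \<alpha>.
    (\<exists>\<gamma>. geodesic_ray t \<gamma> \<and> \<gamma> 0 = (0, 0) \<and> Dir \<gamma> = tangent_directions \<rho>) \<and>
    (\<forall>\<gamma> \<gamma>'. geodesic_ray t \<gamma> \<and> \<gamma> 0 = (0, 0) \<and> Dir \<gamma> = tangent_directions \<rho> \<and>
            geodesic_ray t \<gamma>' \<and> \<gamma>' 0 = (0, 0) \<and> Dir \<gamma>' = tangent_directions \<rho> \<longrightarrow>
            \<not> distinct_rays \<gamma> \<gamma>')"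
proof -
  obtain s\<^sub>1 s\<^sub>2 :: int where s: "s\<^sub>1 \<in> {1, - 1}" "s\<^sub>2 \<in> {1, - 1}" "tangent_directions \<rho> = quadrant s\<^sub>1 s\<^sub>2"
    using tangent_functional_l1_ball[OF assms(3,4)] .
  have \<alpha>: "0 < \<alpha>" "5 * \<alpha> < 1" using assms(1,2) by simp_all
  show ?thesis
    using AE_good_times[OF \<alpha>]
  proof (rule eventually_mono)
    fix t assume "good_times \<alpha> t"
    from unique_ray_if_good_times[OF \<alpha> this s(1,2)]
    show "(\<exists>\<gamma>. geodesic_ray t \<gamma> \<and> \<gamma> 0 = (0, 0) \<and> Dir \<gamma> = tangent_directions \<rho>) \<and>
      (\<forall>\<gamma> \<gamma>'. geodesic_ray t \<gamma> \<and> \<gamma> 0 = (0, 0) \<and> Dir \<gamma> = tangent_directions \<rho> \<and>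
            geodesic_ray t \<gamma>' \<and> \<gamma>' 0 = (0, 0) \<and> Dir \<gamma>' = tangent_directions \<rho> \<longrightarrow>
            \<not> distinct_rays \<gamma> \<gamma>')"
      unfolding unique_ray_def s(3) .
  qed
qed

end
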